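(* Let $(\vartheta,\boldsymbol P)$ be a non-degenerate primitive random substitution on $\mathcal A=\{a_1,\dots,a_n\}$ with non-empty RS-subshift $X_\vartheta$, and let $\boldsymbol R_\ell$ be the statistically normalised right Perron--Frobenius eigenvector of the induced random substitution matrix $M_\ell$ and $\mu$ the associated shift-invariant probability measure on $X_\vartheta$. (a) The dynamical system $(X_\vartheta,S)$ is uniquely ergodic only if the right Perron--Frobenius eigenvectors $\boldsymbol R_\ell$ are independent of the probability vectors $\boldsymbol p_i$ for every $\ell\ge 1$ and every $i\in\{1,\dots,n\}$. (b) Suppose additionally that $\mu$ is ergodic. Then $(X_\vartheta,S)$ is uniquely ergodic if and only if the right Perron--Frobenius eigenvectors $\boldsymbol R_\ell$ are independent of the probability vectors $\boldsymbol p_i$ for every $\ell\ge 1$ and every $i\in\{1,\dots,n\}$.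
   Context: Let $\mathcal A=\{a_1,\dots,a_n\}$ be a finite alphabet, $\mathcal A^+$ the set of non-empty finite words, $\mathcal A^{\mathbb Z}$ the bi-infinite sequences with the product topology. A random substitution $(\vartheta,\boldsymbol P)$ assigns to each letter $a_i$ a finite set $\vartheta(a_i)=\{w^{(i,1)},\dots,w^{(i,k_i)}\}\subset\mathcal A^+$, $k_i\ge1$, together with a probability vector $\boldsymbol p_i=(p_{i1},\dots,p_{ik_i})$, $\boldsymbol P=\{\boldsymbol p_1,\dots,\boldsymbol p_n\}$; the letter $a_i$ is mapped to $w^{(i,j)}$ with probability $p_{ij}$. It is non-degenerate if all $p_{ij}\neq0$. Realisations of $\vartheta(u)$, $u=u_0\cdots u_{m-1}\in\mathcal A^+$, are the words $x_0\cdots x_{m-1}$ with $x_j\in\vartheta(u_j)$ chosen independently (with the product probability); realisations of $\vartheta^{k+1}(u)$ are the realisations of $\vartheta(v)$ for $v$ a realisation of $\vartheta^k(u)$. $\vartheta$ is primitive if there is $k\in\mathbb N$ such that for all $i,j$ the letter $a_i$ is a subword of some realisation of $\vartheta^k(a_j)$. A word is $\vartheta$-legal if it is a subword of some realisation of some $\vartheta^k(a_j)$. $X_\vartheta\subseteq\mathcal A^{\mathbb Z}$ is the set of bi-infinite sequences all of whose finite non-empty subwords are legal, with shift $S(w)_i=w_{i+1}$; it does not depend on the choice of $\boldsymbol P$ among non-degenerate choices. For $\ell\ge1$ let $\mathcal A_\ell$ be the set of $\vartheta$-legal words of length $\ell$, regarded as an alphabet. The induced random substitution $\vartheta_\ell$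 on $\mathcal A_\ell$ is defined as follows: for $w=w_0\cdots w_{\ell-1}\in\mathcal A_\ell$ and each choice of realisations $x_j\in\vartheta(w_j)$ ($0\le j\le\ell-1$), put $v=x_0\cdots x_{\ell-1}$ and map $w$ to the word $(v_{[0,\ell-1]})(v_{[1,\ell]})\cdots(v_{[|x_0|-1,|x_0|+\ell-2]})$ over $\mathcal A_\ell$, of length $|x_0|$ (where $v_{[r,s]}=v_r\cdots v_s$), with probability equal to the product of the probabilities of the $x_j$ (probabilities being added when the same image word arises more than once). The induced random substitution matrix $M_\ell$ is indexed by $\mathcal A_\ell\times\mathcal A_\ell$; its $(u,w)$ entry is the expected number of occurrences of the letter $u$ in $\vartheta_\ell(w)$. For non-degenerate primitive $\vartheta$ with $X_\vartheta\ne\emptyset$ the matrix $M_\ell$ is primitive, and $\boldsymbol R_\ell$ denotes its unique positive right eigenvector for the Perron--Frobenius eigenvalue with $\|\boldsymbol R_\ell\|_1=1$; $\boldsymbol R_\ell(v)$ is its entry at $v\in\mathcal A_\ell$. The measure $\mu$ is the $S$-invariant Borel probability measure on $X_\vartheta$ determined by $\mu(\{w\in X_\vartheta: w_{[k,k+\ell-1]}=v\})=\boldsymbol R_\ell(v)$ for all $\ell\ge1$, $k\in\mathbb Z$ and $v\in\mathcal A_\ell$. "Independent of the probability vectors" means: keeping the sets $\vartheta(a_i)$ fixed, $\boldsymbol R_\ell$ takes the same value for every non-degenerate choice of $\boldsymbol P$. $(X_\vartheta,S)$ is uniquely ergodic if it has exactly one $S$-invariant Borel probability measure. *)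

theory Defs
  imports "HOL-Probability.Probability" "HOL-Library.Sublist"
begin

text \<open>
  The alphabet is a finite type. The set \<open>\<theta> a\<close> consists of the words to which the letter \<open>a\<close>
  may be mapped, and \<open>pmf (P a) w\<close> is the probability that \<open>a\<close> is mapped to \<open>w\<close>. Words are lists;
  the empty word is excluded explicitly where the mathematics speaks of non-empty words.
\<close>

definition random_substitution ::
  "('a::finite \<Rightarrow> 'a list set) \<Rightarrow> ('a \<Rightarrow> 'a list pmf) \<Rightarrow> bool" where
  "random_substitution \<theta> P \<longleftrightarrow>
     (\<forall>a. finite (\<theta> a) \<and> \<theta> a \<noteq> {} \<and> [] \<notin> \<theta> a \<and> set_pmf (P a) \<subseteq> \<theta> a)"

definition nondegenerate ::
  "('a::finite \<Rightarrow> 'a list set) \<Rightarrow> ('a \<Rightarrow> 'a list pmf) \<Rightarrow> bool" where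
  "nondegenerate \<theta> P \<longleftrightarrow> (\<forall>a. \<forall>w\<in>\<theta> a. pmf (P a) w \<noteq> 0)"

definition realisations :: "('a \<Rightarrow> 'a list set) \<Rightarrow> 'a list \<Rightarrow> 'a list set" where
  "realisations \<theta> u = concat ` listset (map \<theta> u)"

primrec power_realisations :: "('a \<Rightarrow> 'a list set) \<Rightarrow> nat \<Rightarrow> 'a list \<Rightarrow> 'a list set" where
  "power_realisations \<theta> 0 u = {u}"
| "power_realisations \<theta> (Suc k) u = (\<Union>v\<in>power_realisations \<theta> k u. realisations \<theta> v)"

definition primitive_substitution :: "('a::finite \<Rightarrow> 'a list set) \<Rightarrow> bool" where
  "primitive_substitution \<theta> \<longleftrightarrow>
     (\<exists>k. \<forall>a b. \<exists>v\<in>power_realisations \<theta> k [b]. sublist [a] v)"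

definition legal :: "('a::finite \<Rightarrow> 'a list set) \<Rightarrow> 'a list \<Rightarrow> bool" where
  "legal \<theta> u \<longleftrightarrow> u \<noteq> [] \<and> (\<exists>k a. \<exists>v\<in>power_realisations \<theta> k [a]. sublist u v)"

definition legal_words :: "('a::finite \<Rightarrow> 'a list set) \<Rightarrow> nat \<Rightarrow> 'a list set" where
  "legal_words \<theta> l = {u. legal \<theta> u \<and> length u = l}"

text \<open>\<open>window x k n\<close> is the word \<open>x\<^sub>k \<dots> x\<^bsub>k+n-1\<^esub>\<close>.\<close>

definition window :: "(int \<Rightarrow> 'a) \<Rightarrow> int \<Rightarrow> nat \<Rightarrow> 'a list" where
  "window x k n = map (\<lambda>j. x (k + int j)) [0..<n]"

definition rs_subshift :: "('a::finite \<Rightarrow> 'a list set) \<Rightarrow> (int \<Rightarrow> 'a) set" where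
  "rs_subshift \<theta> = {x. \<forall>k n. n \<ge> 1 \<longrightarrow> legal \<theta> (window x k n)}"

definition left_shift :: "(int \<Rightarrow> 'a) \<Rightarrow> (int \<Rightarrow> 'a)" where
  "left_shift x = (\<lambda>i. x (i + 1))"

definition rs_topology :: "('a::finite \<Rightarrow> 'a list set) \<Rightarrow> (int \<Rightarrow> 'a) topology" where
  "rs_topology \<theta> =
     subtopology (product_topology (\<lambda>_. discrete_topology UNIV) UNIV) (rs_subshift \<theta>)"

definition borel_on :: "'b topology \<Rightarrow> 'b measure" where
  "borel_on T = sigma (topspace T) {U. openin T U}"

definition invariant_prob :: "'b topology \<Rightarrow> ('b \<Rightarrow> 'b) \<Rightarrow> 'b measure \<Rightarrow> bool" where
  "invariant_prob T f M \<longleftrightarrow>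
     prob_space M \<and> sets M = sets (borel_on T) \<and>
     (\<forall>B\<in>sets M. emeasure M (f -` B \<inter> space M) = emeasure M B)"

definition ergodic :: "('b \<Rightarrow> 'b) \<Rightarrow> 'b measure \<Rightarrow> bool" where
  "ergodic f M \<longleftrightarrow>
     (\<forall>B\<in>sets M. f -` B \<inter> space M = B \<longrightarrow> measure M B = 0 \<or> measure M B = 1)"

definition uniquely_ergodic :: "'b topology \<Rightarrow> ('b \<Rightarrow> 'b) \<Rightarrow> bool" where
  "uniquely_ergodic T f \<longleftrightarrow> (\<exists>!M. invariant_prob T f M)"

text \<open>The joint distribution of independent choices of an image word for each letter of a word.\<close>

primrec choice_pmf :: "('a \<Rightarrow> 'a list pmf) \<Rightarrow> 'a list \<Rightarrow> 'a list list pmf" where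
  "choice_pmf P [] = return_pmf []"
| "choice_pmf P (a # u) = map_pmf (\<lambda>(x, xs). x # xs) (pair_pmf (P a) (choice_pmf P u))"

text \<open>
  For the choice \<open>xs = [x\<^sub>0, \<dots>, x\<^bsub>l-1\<^esub>]\<close>, the image of a word of length \<open>l \<ge> 1\<close>: the
  words of length \<open>l\<close> starting at the positions \<open>0, \<dots>, |x\<^sub>0| - 1\<close> of \<open>x\<^sub>0 \<dots> x\<^bsub>l-1\<^esub>\<close>.
\<close>

definition induced_word :: "nat \<Rightarrow> 'a list list \<Rightarrow> 'a list list" where
  "induced_word l xs = map (\<lambda>r. take l (drop r (concat xs))) [0..<length (hd xs)]"

definition induced_substitution ::
  "('a \<Rightarrow> 'a list pmf) \<Rightarrow> nat \<Rightarrow> 'a list \<Rightarrow> 'a list list pmf" where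
  "induced_substitution P l w = map_pmf (induced_word l) (choice_pmf P w)"

text \<open>
  The matrix is given on all pairs of words; it is only ever used with both indices in
  \<open>legal_words \<theta> l\<close>.
\<close>

definition induced_matrix ::
  "('a \<Rightarrow> 'a list pmf) \<Rightarrow> nat \<Rightarrow> 'a list \<Rightarrow> 'a list \<Rightarrow> real" where
  "induced_matrix P l u w =
     measure_pmf.expectation (induced_substitution P l w) (\<lambda>z. real (count_list z u))"

text \<open>Real square matrices are indexed by a finite set \<open>I\<close>; only entries in \<open>I \<times> I\<close> matter.\<close>

definition matrix_eigenvalue :: "'b set \<Rightarrow> ('b \<Rightarrow> 'b \<Rightarrow> real) \<Rightarrow> complex \<Rightarrow> bool" where
  "matrix_eigenvalue I M z \<longleftrightarrow>
     (\<exists>x. (\<exists>i\<in>I. x i \<noteq> 0) \<and> (\<forall>i\<in>I. (\<Sum>j\<in>I. complex_of_real (M i j) * x j) = z * x i))"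

text \<open>For a primitive matrix the Perron--Frobenius eigenvalue is the spectral radius.\<close>

definition pf_eigenvalue :: "'b set \<Rightarrow> ('b \<Rightarrow> 'b \<Rightarrow> real) \<Rightarrow> real" where
  "pf_eigenvalue I M = Sup (cmod ` {z. matrix_eigenvalue I M z})"

text \<open>
  The positive right eigenvector with \<open>l\<^sup>1\<close> norm \<open>1\<close>. Setting it to \<open>0\<close> outside \<open>I\<close> makes it
  unique as a function on the whole type.
\<close>

definition pf_right_eigenvector :: "'b set \<Rightarrow> ('b \<Rightarrow> 'b \<Rightarrow> real) \<Rightarrow> 'b \<Rightarrow> real" where
  "pf_right_eigenvector I M =
     (THE R. (\<forall>i\<in>I. 0 < R i) \<and> (\<forall>i. i \<notin> I \<longrightarrow> R i = 0) \<and> (\<Sum>i\<in>I. \<bar>R i\<bar>) = 1 \<and>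
             (\<forall>i\<in>I. (\<Sum>j\<in>I. M i j * R j) = pf_eigenvalue I M * R i))"

definition induced_eigenvector ::
  "('a::finite \<Rightarrow> 'a list set) \<Rightarrow> ('a \<Rightarrow> 'a list pmf) \<Rightarrow> nat \<Rightarrow> 'a list \<Rightarrow> real" where
  "induced_eigenvector \<theta> P l = pf_right_eigenvector (legal_words \<theta> l) (induced_matrix P l)"

definition eigenvectors_independent_of_probabilities :: "('a::finite \<Rightarrow> 'a list set) \<Rightarrow> bool" where
  "eigenvectors_independent_of_probabilities \<theta> \<longleftrightarrow>
     (\<forall>l\<ge>1. \<forall>P P'.
        random_substitution \<theta> P \<and> nondegenerate \<theta> P \<and>
        random_substitution \<theta> P' \<and> nondegenerate \<theta> P' \<longrightarrow>
        induced_eigenvector \<theta> P l = induced_eigenvector \<theta> P' l)"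

definition rs_measure ::
  "('a::finite \<Rightarrow> 'a list set) \<Rightarrow> ('a \<Rightarrow> 'a list pmf) \<Rightarrow> (int \<Rightarrow> 'a) measure" where
  "rs_measure \<theta> P =
     (THE M. invariant_prob (rs_topology \<theta>) left_shift M \<and>
             (\<forall>l\<ge>1. \<forall>k. \<forall>v\<in>legal_words \<theta> l.
                measure M {x \<in> rs_subshift \<theta>. window x k l = v} = induced_eigenvector \<theta> P l v))"

end

theory Submission
  imports Defs
begin

text \<open>
  If the system is uniquely ergodic, the measures belonging to two choices of probability vectors agree,
  and so do their values on cylinders, which are the entries of the eigenvectors.

  Conversely, suppose that the frequencies \<open>R\<close> do not depend on the probability vectors. Letting
  the vectors degenerate to Dirac masses, \<open>R\<close> is also invariant under an expanding deterministic
  substitution \<open>f\<close>, hence under all \<open>f\<^sup>k\<close>. So most long words are factors of some \<open>f\<^sup>k v\<close> with \<open>v\<close> short,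
  there are few of them, and a letter can be predicted from sufficiently many of its successors with
  arbitrarily small error. For the non-degenerate random substitution this is only possible if, of
  any two realisations of a legal word, one is a suffix of the other. Applied to the word \<open>a v a\<close>, this shows
  \<open>w\<^sub>1 V w\<^sub>2 = w\<^sub>2 V w\<^sub>1\<close> for \<open>w\<^sub>1, w\<^sub>2\<close> realisations of \<open>a\<close> and \<open>V\<close> one of \<open>v\<close>. Hence either every letter has
  only one realisation, and the system is that of a primitive substitution, or all legal words have the
  common period \<open>|w\<^sub>2| - |w\<^sub>1|\<close>, and the system is one periodic orbit. In both cases all words have uniform
  frequencies.
\<close>

section \<open>Realisations and legal words\<close>

text \<open>Prediction runs from right to left because \<open>induced_word\<close> attributes a
  window to the block in which it starts: the images of the letters further to the right are
  independent choices and can serve as a common random future for two competing letters. The same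
  asymmetry makes the right marginal of \<open>freq\<close> a consequence of uniqueness of the
  eigenvector, whereas the left marginal rests on expansion. Both are needed, since the measure with
  cylinder values \<open>freq\<close> has to be constructed, by Kolmogorov extension.

  Dirac masses are degenerate probability vectors, and no eigenvector of their own is available.
  What survives the limit is the eigenvector equation: its expectations on a fixed word vary
  continuously with the vectors, while \<open>freq\<close> does not move by assumption.

  Heuristically, invariance under an expanding deterministic map forces zero entropy, so the past is
  a function of the future; the halving predictor is a finite, quantitative form of this. It
  contradicts any choice of positive probability that the future does not reveal.\<close>

lemma length_listset: "xs \<in> listset (map \<theta> u) \<Longrightarrow> length xs = length u"
  by (induction u arbitrary: xs) (auto simp: set_Cons_def)

lemma append_mem_listset:
  "xs \<in> listset (map \<theta> u) \<Longrightarrow> ys \<in> listset (map \<theta> v) \<Longrightarrow> xs @ ys \<in> listset (map \<theta> (u @ v))"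
  by (induction u arbitrary: xs) (auto simp: set_Cons_def)

lemma take_mem_listset: "xs \<in> listset (map \<theta> u) \<Longrightarrow> take n xs \<in> listset (map \<theta> (take n u))"
proof (induction u arbitrary: xs n)
  case (Cons a u) then show ?case by (cases n) (auto simp: set_Cons_def)
qed auto

lemma drop_mem_listset: "xs \<in> listset (map \<theta> u) \<Longrightarrow> drop n xs \<in> listset (map \<theta> (drop n u))"
proof (induction u arbitrary: xs n)
  case (Cons a u) then show ?case by (cases n) (auto simp: set_Cons_def)
qed auto

lemma realisations_append:
  "x \<in> realisations \<theta> u \<Longrightarrow> y \<in> realisations \<theta> v \<Longrightarrow> x @ y \<in> realisations \<theta> (u @ v)"
  unfolding realisations_def using append_mem_listset[of _ \<theta> u _ v]
  by (auto simp del: map_append) (metis concat_append image_eqI)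

lemma realisations_singleton: "realisations \<theta> [a] = \<theta> a"
proof -
  have "listset (map \<theta> [a]) = (\<lambda>x. [x]) ` \<theta> a" by (auto simp: set_Cons_def)
  then show ?thesis by (simp add: realisations_def image_image del: listset.simps list.map)
qed

lemma power_realisations_append:
  "x \<in> power_realisations \<theta> k u \<Longrightarrow> y \<in> power_realisations \<theta> k v \<Longrightarrow>
     x @ y \<in> power_realisations \<theta> k (u @ v)"
proof (induction k arbitrary: x y)
  case (Suc k)
  then show ?case by (auto intro: realisations_append)
qed auto

lemma power_realisations_add:
  "power_realisations \<theta> (k + m) u = (\<Union>v\<in>power_realisations \<theta> k u. power_realisations \<theta> m v)"
  by (induction m) auto

lemma length_concat_ge: "\<forall>z\<in>set zs. z \<noteq> [] \<Longrightarrow> length (concat zs) \<ge> length zs"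
proof (induction zs)
  case (Cons z zs)
  then show ?case by (cases z) auto
qed auto

text \<open>Windows of a concatenation are grouped by the block in which they start: this is why inducing is
  compatible with composing substitutions.\<close>

lemma concat_induced_word:
  assumes "n \<ge> 1" "L + n \<le> length xs + 1" "\<forall>x\<in>set xs. x \<noteq> []"
  shows "concat (map (\<lambda>r. induced_word n (take n (drop r xs))) [0..<L]) =
         map (\<lambda>s. take n (drop s (concat xs))) [0..<length (concat (take L xs))]"
  using assms(2,3)
proof (induction xs arbitrary: L)
  case Nil
  then show ?case using assms(1) by auto
next
  case (Cons x xs)
  show ?case
  proof (cases L)
    case 0
    then show ?thesis by simp
  next
    case (Suc L')
    have IH: "concat (map (\<lambda>r. induced_word n (take n (drop r xs))) [0..<L']) =
         map (\<lambda>s. take n (drop s (concat xs))) [0..<length (concat (take L' xs))]"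
      using Cons.IH[of L'] Cons.prems Suc by auto
    have hd: "hd (take n (x # xs)) = x" using assms(1) by (cases n) auto
    \<comment> \<open>The window starts inside \<open>x\<close>, and the \<open>n - 1\<close>
      non-empty blocks after \<open>x\<close> supply at least \<open>n - 1\<close> letters, so it
      ends within the first \<open>n\<close> blocks.\<close>
    have *: "take n (drop r (concat (take n (x # xs)))) = take n (drop r (concat (x # xs)))"
      if "r < length x" for r
    proof -
      obtain n' where n': "n = Suc n'" using assms(1) by (cases n) auto
      have "n' \<le> length (concat (take n' xs))"
        using length_concat_ge[of "take n' xs"] Cons.prems Suc n' by (auto dest: in_set_takeD)
      moreover have "concat xs = concat (take n' xs) @ concat (drop n' xs)"
        by (metis append_take_drop_id concat_append)
      ultimately show ?thesis using that n' by auto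
    qed
    have "concat (map (\<lambda>r. induced_word n (take n (drop r (x # xs)))) [0..<L]) =
       induced_word n (take n (x # xs)) @
         concat (map (\<lambda>r. induced_word n (take n (drop r xs))) [0..<L'])"
      unfolding Suc upt_conv_Cons[OF zero_less_Suc] map_Suc_upt[symmetric] by (simp add: comp_def)
    also have "induced_word n (take n (x # xs)) =
       map (\<lambda>s. take n (drop s (concat (x # xs)))) [0..<length x]"
      unfolding induced_word_def hd using * by (intro map_cong) auto
    also have "concat (map (\<lambda>r. induced_word n (take n (drop r xs))) [0..<L']) =
       map (\<lambda>s. take n (drop s (concat (x # xs)))) [length x..<length x + length (concat (take L' xs))]"
      unfolding IH
      by (subst add.commute, subst map_add_upt[symmetric]) (simp add: comp_def)
    finally show ?thesis
      unfolding Suc using upt_add_eq_append[of 0 "length x" "length (concat (take L' xs))"] by simp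
  qed
qed

text \<open>Even a window starting at the last letter of the first block is complete: the other
  \<open>n - 1\<close> blocks are non-empty.\<close>

lemma length_mem_induced_word:
  assumes "\<forall>z\<in>set xs. z \<noteq> []" "length xs = n" "n \<ge> 1" "z \<in> set (induced_word n xs)"
  shows "length z = n"
proof -
  obtain x ys where xs: "xs = x # ys" using assms by (cases xs) auto
  then have "length (concat ys) \<ge> n - 1" using length_concat_ge[of ys] assms by auto
  then show ?thesis using assms(4) xs by (auto simp: induced_word_def)
qed

lemma induced_word_append:
  assumes "\<forall>z\<in>set xs. z \<noteq> []" "length xs \<ge> n" "n \<ge> 1"
  shows "induced_word n (xs @ ys) = induced_word n xs"
proof -
  obtain x zs where xs: "xs = x # zs" using assms by (cases xs) auto
  then have "length (concat zs) \<ge> n - 1" using length_concat_ge[of zs] assms by auto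
  then show ?thesis using xs by (auto simp: induced_word_def)
qed

lemma length_induced_word: "length (induced_word n xs) = length (hd xs)"
  by (simp add: induced_word_def)

text \<open>The assumptions that do not mention probabilities. Two choices of \<open>P\<close> can
  thus be interpreted over the same legal words, subshift and cylinders.\<close>

locale primitive_rs =
  fixes \<theta> :: "'a::finite \<Rightarrow> 'a list set"
  assumes finite_images: "finite (\<theta> a)"
    and images_ne: "\<theta> a \<noteq> {}"
    and nonerasing: "[] \<notin> \<theta> a"
    and primitive: "primitive_substitution \<theta>"
    and subshift_ne: "rs_subshift \<theta> \<noteq> {}"
begin

lemma listset_nonempty_blocks: "xs \<in> listset (map \<theta> u) \<Longrightarrow> \<forall>x\<in>set xs. x \<noteq> []"
proof (induction u arbitrary: xs)
  case (Cons a u)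
  from Cons.prems obtain x ys where "xs = x # ys" "x \<in> \<theta> a" "ys \<in> listset (map \<theta> u)"
    by (auto simp: set_Cons_def)
  with Cons.IH[of ys] nonerasing[of a] show ?case by auto
qed auto

lemma listset_ne: "listset (map \<theta> u) \<noteq> {}"
proof (induction u)
  case (Cons a u) then show ?case using images_ne[of a] by (auto simp: set_Cons_def)
qed auto

lemma realisations_ne: "realisations \<theta> u \<noteq> {}"
  using listset_ne by (auto simp: realisations_def)

lemma realisations_length: "x \<in> realisations \<theta> u \<Longrightarrow> length u \<le> length x"
  unfolding realisations_def
  using length_concat_ge[OF listset_nonempty_blocks] length_listset by (metis imageE)

lemma power_realisations_ne: "power_realisations \<theta> k u \<noteq> {}"
  by (induction k) (auto simp: realisations_ne)

lemma power_realisations_length: "x \<in> power_realisations \<theta> k u \<Longrightarrow> length u \<le> length x"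
  by (induction k arbitrary: x) (auto dest!: realisations_length intro: order_trans)

lemma power_realisations_sublist:
  assumes "sublist u v" "x \<in> power_realisations \<theta> k u"
  shows "\<exists>y\<in>power_realisations \<theta> k v. sublist x y"
proof -
  obtain p s where v: "v = p @ u @ s" using assms(1) by (auto simp: sublist_def)
  obtain p' s' where "p' \<in> power_realisations \<theta> k p" "s' \<in> power_realisations \<theta> k s"
    using power_realisations_ne by blast
  then have "p' @ x @ s' \<in> power_realisations \<theta> k v"
    unfolding v using assms(2) by (intro power_realisations_append)
  then show ?thesis by (auto simp: sublist_def)
qed

text \<open>Primitivity speaks of one exponent \<open>K\<close>. For larger \<open>k\<close>, any
  letter present after \<open>k - K\<close> steps produces \<open>a\<close> in the remaining
  \<open>K\<close>.\<close>

lemma letter_eventually_everywhere: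
  "\<exists>K. \<forall>k\<ge>K. \<forall>b. \<exists>x\<in>power_realisations \<theta> k [b]. sublist [a] x"
proof -
  obtain K where K: "\<And>a b. \<exists>x\<in>power_realisations \<theta> K [b]. sublist [a] x"
    using primitive unfolding primitive_substitution_def by blast
  have "\<exists>x\<in>power_realisations \<theta> k [b]. sublist [a] x" if "k \<ge> K" for k b
  proof -
    obtain y where y: "y \<in> power_realisations \<theta> (k - K) [b]" using power_realisations_ne by blast
    then have "y \<noteq> []" using power_realisations_length by force
    then obtain c ys where c: "y = c # ys" by (cases y) auto
    obtain x where "x \<in> power_realisations \<theta> K [c]" "sublist [a] x" using K by blast
    moreover have "sublist [c] y" by (auto simp: c sublist_Cons_right)
    ultimately obtain z where "z \<in> power_realisations \<theta> K y" "sublist [a] z"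
      using power_realisations_sublist sublist_order.order_trans by blast
    moreover have "power_realisations \<theta> k [b] = (\<Union>v\<in>power_realisations \<theta> (k - K) [b]. power_realisations \<theta> K v)"
      using power_realisations_add[of \<theta> "k - K" K "[b]"] that by simp
    ultimately show ?thesis using y by blast
  qed
  then show ?thesis by blast
qed

lemma legal_eventually_everywhere:
  assumes "legal \<theta> u"
  shows "\<exists>K. \<forall>k\<ge>K. \<forall>b. \<exists>x\<in>power_realisations \<theta> k [b]. sublist u x"
proof -
  obtain m a x where m: "x \<in> power_realisations \<theta> m [a]" "sublist u x"
    using assms unfolding legal_def by blast
  obtain K where K: "\<And>k b. k \<ge> K \<Longrightarrow> \<exists>x\<in>power_realisations \<theta> k [b]. sublist [a] x"
    using letter_eventually_everywhere by blast
  have "\<exists>x\<in>power_realisations \<theta> k [b]. sublist u x" if "k \<ge> K + m" for k b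
  proof -
    have "k - m \<ge> K" using that by simp
    then obtain y where y: "y \<in> power_realisations \<theta> (k - m) [b]" "sublist [a] y"
      using K[of "k - m" b] by blast
    then obtain z where "z \<in> power_realisations \<theta> m y" "sublist x z"
      using power_realisations_sublist m by blast
    moreover have "power_realisations \<theta> k [b] = (\<Union>v\<in>power_realisations \<theta> (k - m) [b]. power_realisations \<theta> m v)"
      using power_realisations_add[of \<theta> "k - m" m "[b]"] that by simp
    ultimately show ?thesis using y(1) m(2) sublist_order.order_trans by blast
  qed
  then show ?thesis by blast
qed

lemma legal_sublist: "legal \<theta> u \<Longrightarrow> sublist v u \<Longrightarrow> v \<noteq> [] \<Longrightarrow> legal \<theta> v"
  unfolding legal_def by (meson sublist_order.order_trans)

lemma legal_power_realisation:
  assumes "legal \<theta> u" "x \<in> power_realisations \<theta> k u"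
  shows "legal \<theta> x"
proof -
  obtain m a y where m: "y \<in> power_realisations \<theta> m [a]" "sublist u y"
    using assms unfolding legal_def by blast
  obtain z where z: "z \<in> power_realisations \<theta> k y" "sublist x z"
    using power_realisations_sublist[OF m(2) assms(2)] by blast
  then have "z \<in> power_realisations \<theta> (m + k) [a]" using m by (auto simp: power_realisations_add)
  moreover have "x \<noteq> []" using power_realisations_length[OF assms(2)] assms(1)
    by (auto simp: legal_def)
  ultimately show ?thesis using z(2) unfolding legal_def by blast
qed

lemma legal_realisation: "legal \<theta> u \<Longrightarrow> x \<in> realisations \<theta> u \<Longrightarrow> legal \<theta> x"
  using legal_power_realisation[of u x 1] by simp

lemma legal_words_ne: "l \<ge> 1 \<Longrightarrow> legal_words \<theta> l \<noteq> {}"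
proof -
  assume l: "l \<ge> 1"
  obtain x where "x \<in> rs_subshift \<theta>" using subshift_ne by blast
  then have "legal \<theta> (window x 0 l)"
    using l by (simp add: rs_subshift_def)
  then have "window x 0 l \<in> legal_words \<theta> l"
    by (simp add: legal_words_def window_def)
  then show ?thesis by blast
qed

text \<open>Non-emptiness of the subshift provides a legal word of length three; inflated often
  enough, its letters contain \<open>u\<close>, \<open>v\<close> and \<open>w\<close> respectively.
  This is how a given word gets placed between two occurrences of a letter.\<close>

lemma legal_join:
  assumes "legal \<theta> u" "legal \<theta> v" "legal \<theta> w"
  shows "\<exists>q r. legal \<theta> (u @ q @ v @ r @ w)"
proof -
  obtain K1 K2 K3 where K: "\<And>k b. k \<ge> K1 \<Longrightarrow> \<exists>x\<in>power_realisations \<theta> k [b]. sublist u x"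
    "\<And>k b. k \<ge> K2 \<Longrightarrow> \<exists>x\<in>power_realisations \<theta> k [b]. sublist v x"
    "\<And>k b. k \<ge> K3 \<Longrightarrow> \<exists>x\<in>power_realisations \<theta> k [b]. sublist w x"
    using legal_eventually_everywhere assms by metis
  define k where "k = K1 + K2 + K3"
  obtain t where t: "legal \<theta> t" "length t = 3" using legal_words_ne[of 3] by (auto simp: legal_words_def)
  then obtain a b c where abc: "t = [a] @ [b] @ [c]"
    by (auto simp: numeral_3_eq_3 length_Suc_conv)
  obtain x y z where x: "x \<in> power_realisations \<theta> k [a]" "sublist u x"
    and y: "y \<in> power_realisations \<theta> k [b]" "sublist v y"
    and z: "z \<in> power_realisations \<theta> k [c]" "sublist w z"
    using K(1)[of k a] K(2)[of k b] K(3)[of k c] unfolding k_def by auto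
  have "legal \<theta> (x @ y @ z)"
    using legal_power_realisation[OF t(1)[unfolded abc]
      power_realisations_append[OF x(1) power_realisations_append[OF y(1) z(1)]]] .
  moreover obtain x1 x2 y1 y2 z1 z2 where
    "x = x1 @ u @ x2" "y = y1 @ v @ y2" "z = z1 @ w @ z2"
    using x(2) y(2) z(2) unfolding sublist_def by blast
  moreover have "u \<noteq> []" using assms by (simp add: legal_def)
  ultimately have "legal \<theta> (u @ (x2 @ y1) @ v @ (y2 @ z1) @ w)"
    by (elim legal_sublist) (auto simp: sublist_def)
  then show ?thesis by blast
qed

lemma legal_letter: "legal \<theta> [a]"
  unfolding legal_def by (auto intro!: exI[of _ "0::nat"] exI[of _ a])

text \<open>The source of all expansion. If letters were only mapped to letters, no legal word of
  length two would exist, and the subshift would be empty.\<close>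

lemma long_image: "\<exists>a. \<exists>w\<in>\<theta> a. length w \<ge> 2"
proof (rule ccontr)
  assume "\<not> ?thesis"
  then have short: "length w \<le> 1" if "w \<in> \<theta> a" for a w using that by force
  have 1: "length (concat xs) \<le> length u" if "xs \<in> listset (map \<theta> u)" for xs u
    using that
  proof (induction u arbitrary: xs)
    case (Cons a u)
    from Cons.prems obtain x ys where "xs = x # ys" "x \<in> \<theta> a" "ys \<in> listset (map \<theta> u)"
      by (auto simp: set_Cons_def)
    with Cons.IH[of ys] short[of x a] show ?case by auto
  qed auto
  have 2: "length x \<le> length u" if "x \<in> power_realisations \<theta> k u" for k u x
    using that by (induction k arbitrary: x) (auto simp: realisations_def dest!: 1 intro: order_trans)
  obtain u where "legal \<theta> u" "length u = 2" using legal_words_ne[of 2] by (auto simp: legal_words_def)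
  then obtain k a v where "v \<in> power_realisations \<theta> k [a]" "sublist u v" unfolding legal_def by blast
  then show False using 2[of v k "[a]"] sublist_length_le[of u v] \<open>length u = 2\<close> by simp
qed

lemma mem_induced_word_legal:
  assumes "w \<in> legal_words \<theta> l" "l \<ge> 1" "xs \<in> listset (map \<theta> w)" "u \<in> set (induced_word l xs)"
  shows "u \<in> legal_words \<theta> l"
proof -
  have "length u = l"
    using length_mem_induced_word[OF listset_nonempty_blocks[OF assms(3)] _ assms(2,4)] length_listset[OF assms(3)]
      assms(1) by (auto simp: legal_words_def)
  moreover have "sublist u (concat xs)"
    using assms(4) sublist_order.order_trans[OF sublist_take sublist_drop]
    by (auto simp: induced_word_def)
  moreover have "legal \<theta> (concat xs)"
    using assms legal_realisation[of w] by (auto simp: realisations_def legal_words_def)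
  moreover have "u \<noteq> []" using \<open>length u = l\<close> assms(2) by auto
  ultimately show ?thesis using legal_sublist[of "concat xs" u] by (auto simp: legal_words_def)
qed

text \<open>Irreducibility of the induced substitution matrix.\<close>

lemma legal_words_irreducible:
  assumes l: "l \<ge> 1" and Z: "Z \<subseteq> legal_words \<theta> l" "Z \<noteq> {}"
    and closed: "\<And>w xs. w \<in> Z \<Longrightarrow> xs \<in> listset (map \<theta> w) \<Longrightarrow> set (induced_word l xs) \<subseteq> Z"
  shows "Z = legal_words \<theta> l"
proof
  show "legal_words \<theta> l \<subseteq> Z"
  proof
    fix u assume "u \<in> legal_words \<theta> l"
    then have u: "legal \<theta> u" "length u = l" by (auto simp: legal_words_def)
    obtain w where w: "w \<in> Z" using Z by blast
    then have "length w = l" using Z by (auto simp: legal_words_def)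
    then obtain b w' where bw: "w = b # w'" "length w' = l - 1" using l by (cases w) auto
    \<comment> \<open>Only windows starting in the image of \<open>b\<close> are followed;
      \<open>Y'\<close> supplies the letters that complete those reaching beyond the end of
      \<open>Y\<close>.\<close>
    have windows: "take l (drop r (Y @ Y')) \<in> Z"
      if "Y \<in> power_realisations \<theta> k [b]" "Y' \<in> power_realisations \<theta> k w'" "r < length Y" for Y Y' r k
      using that
    proof (induction k arbitrary: Y Y' r)
      case 0
      then show ?case using w bw l by (auto simp: Suc_le_eq)
    next
      case (Suc k)
      obtain v v' xs xs' where v: "v \<in> power_realisations \<theta> k [b]" "v' \<in> power_realisations \<theta> k w'"
        and xs: "xs \<in> listset (map \<theta> v)" "xs' \<in> listset (map \<theta> v')" "Y = concat xs" "Y' = concat xs'"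
        using Suc.prems by (auto simp: realisations_def)
      define zs where "zs = xs @ xs'"
      have zs: "zs \<in> listset (map \<theta> (v @ v'))" unfolding zs_def using xs append_mem_listset by metis
      have lens: "length xs = length v" "length xs' = length v'" using xs length_listset by blast+
      have "length v' \<ge> l - 1" using power_realisations_length[OF v(2)] bw by simp
      then have "concat (map (\<lambda>r. induced_word l (take l (drop r zs))) [0..<length v]) =
         map (\<lambda>s. take l (drop s (concat zs))) [0..<length (concat (take (length v) zs))]"
        using l lens listset_nonempty_blocks[OF zs] by (intro concat_induced_word) (auto simp: zs_def)
      moreover have "concat (take (length v) zs) = Y" "concat zs = Y @ Y'"
        using lens xs by (auto simp: zs_def)
      ultimately have "take l (drop r (Y @ Y')) \<in>
        set (concat (map (\<lambda>r. induced_word l (take l (drop r zs))) [0..<length v]))"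
        using Suc.prems(3) by auto
      then obtain r' where r': "r' < length v" "take l (drop r (Y @ Y')) \<in> set (induced_word l (take l (drop r' zs)))"
        by auto
      have "take l (drop r' (v @ v')) \<in> Z" using Suc.IH[OF v r'(1)] .
      moreover have "take l (drop r' zs) \<in> listset (map \<theta> (take l (drop r' (v @ v'))))"
        using zs by (intro take_mem_listset drop_mem_listset)
      ultimately show ?case using closed r'(2) by blast
    qed
    obtain K where "\<And>k b. k \<ge> K \<Longrightarrow> \<exists>x\<in>power_realisations \<theta> k [b]. sublist u x"
      using legal_eventually_everywhere[OF u(1)] by blast
    then obtain Y where Y: "Y \<in> power_realisations \<theta> K [b]" "sublist u Y" by blast
    obtain Y' where Y': "Y' \<in> power_realisations \<theta> K w'" using power_realisations_ne by blast
    obtain p s where "Y = p @ u @ s" using Y(2) by (auto simp: sublist_def)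
    then show "u \<in> Z" using windows[OF Y(1) Y', of "length p"] u l by auto
  qed
qed (use Z in blast)

end

section \<open>Perron--Frobenius theory for a matrix with a positive left eigenvector\<close>

text \<open>Bolzano-Weierstrass, one coordinate at a time: a further subsequence keeps the earlier
  coordinates convergent.\<close>

lemma finite_convergent_subsequence:
  fixes y :: "nat \<Rightarrow> 'b \<Rightarrow> real"
  assumes "finite I" "\<And>n i. i \<in> I \<Longrightarrow> \<bar>y n i\<bar> \<le> B"
  shows "\<exists>r. strict_mono r \<and> (\<forall>i\<in>I. convergent (\<lambda>n. y (r n) i))"
  using assms
proof (induction I rule: finite_induct)
  case empty
  then show ?case by (auto intro: exI[of _ id] simp: strict_mono_def)
next
  case (insert i I)
  then obtain r where r: "strict_mono r" "\<forall>i\<in>I. convergent (\<lambda>n. y (r n) i)" by auto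
  have "\<forall>n. y (r n) i \<in> {-B..B}" using insert.prems[of i] by (auto simp: abs_le_iff minus_le_iff)
  then obtain l s where s: "strict_mono s" "(\<lambda>n. y (r (s n)) i) \<longlonglongrightarrow> l"
    using seq_compactE[OF compact_imp_seq_compact[OF compact_Icc[of "-B" B]], of "\<lambda>n. y (r n) i"]
    unfolding comp_def by metis
  have "convergent (\<lambda>n. y ((r \<circ> s) n) j)" if "j \<in> insert i I" for j
    using that s r(2) convergent_subseq_convergent[OF _ s(1)]
    by (auto simp: comp_def convergent_def intro: LIMSEQ_subseq_LIMSEQ[unfolded comp_def])
  then show ?case using strict_mono_o[OF r(1) s(1)] by blast
qed

text \<open>No sign condition is imposed, so that uniqueness covers all real vectors. Vanishing
  outside \<open>I\<close> turns uniqueness into equality of functions.\<close>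

definition normalised_eigenvector :: "'b set \<Rightarrow> ('b \<Rightarrow> 'b \<Rightarrow> real) \<Rightarrow> real \<Rightarrow> ('b \<Rightarrow> real) \<Rightarrow> bool" where
  "normalised_eigenvector I M c y \<longleftrightarrow> (\<forall>i. i \<notin> I \<longrightarrow> y i = 0) \<and> (\<Sum>i\<in>I. y i) = 1 \<and>
     (\<forall>i\<in>I. (\<Sum>j\<in>I. M i j * y j) = c * y i)"

text \<open>The limit points of the Cesaro means of \<open>M\<^sup>k x / c\<^sup>k\<close> are eigenvectors; the left eigenvector
  provides the bounds and guarantees that they do not vanish.\<close>

lemma nonneg_right_eigenvector_exists:
  fixes M :: "'b \<Rightarrow> 'b \<Rightarrow> real"
  assumes I: "finite I" "I \<noteq> {}" and M: "\<And>i j. i \<in> I \<Longrightarrow> j \<in> I \<Longrightarrow> 0 \<le> M i j"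
    and L: "\<And>i. i \<in> I \<Longrightarrow> 0 < L i" and c: "0 < c"
    and left: "\<And>j. j \<in> I \<Longrightarrow> (\<Sum>i\<in>I. L i * M i j) = c * L j"
  shows "\<exists>R. (\<forall>i\<in>I. 0 \<le> R i) \<and> normalised_eigenvector I M c R"
proof -
  define S where "S = (\<Sum>i\<in>I. L i)"
  have S: "S > 0" unfolding S_def using I L by (intro sum_pos) auto
  define z :: "nat \<Rightarrow> 'b \<Rightarrow> real" where
    "z = rec_nat (\<lambda>_. 1 / S) (\<lambda>_ z i. (\<Sum>j\<in>I. M i j * z j) / c)"
  have z0: "z 0 i = 1 / S" and zS: "z (Suc k) i = (\<Sum>j\<in>I. M i j * z k j) / c" for k i
    by (simp_all add: z_def)
  have z_nonneg: "i \<in> I \<Longrightarrow> 0 \<le> z k i" for i k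
  proof (induction k arbitrary: i)
    case (Suc k) then show ?case using M c by (auto simp: zS intro!: divide_nonneg_pos sum_nonneg)
  qed (use S in \<open>simp add: z0\<close>)
  have z_sum: "(\<Sum>i\<in>I. L i * z k i) = 1" for k
  proof (induction k)
    case 0 then show ?case using S by (simp add: z0 S_def flip: sum_divide_distrib)
  next
    case (Suc k)
    have "(\<Sum>i\<in>I. L i * z (Suc k) i) = (\<Sum>i\<in>I. \<Sum>j\<in>I. L i * M i j * z k j) / c"
      by (simp add: zS sum_distrib_left sum_divide_distrib mult.assoc)
    also have "\<dots> = (\<Sum>j\<in>I. (\<Sum>i\<in>I. L i * M i j) * z k j) / c"
      by (subst sum.swap) (simp add: sum_distrib_right)
    also have "\<dots> = (\<Sum>j\<in>I. L j * z k j)"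
      using c by (simp add: left mult.assoc flip: sum_distrib_left)
    finally show ?case using Suc by simp
  qed
  have z_le: "z k i \<le> 1 / L i" if i: "i \<in> I" for k i
  proof -
    have "L i * z k i \<le> (\<Sum>i\<in>I. L i * z k i)"
      using z_nonneg L I i by (intro member_le_sum) (auto simp: less_imp_le)
    then show ?thesis using L[OF i] z_sum by (simp add: field_simps)
  qed
  define B where "B = (\<Sum>i\<in>I. 1 / L i)"
  have z_B: "\<bar>z k i\<bar> \<le> B" if i: "i \<in> I" for k i
  proof -
    have "1 / L i \<le> B" unfolding B_def using L I i by (intro member_le_sum) (auto simp: less_imp_le)
    then show ?thesis using z_le[OF i, of k] z_nonneg[OF i, of k] by simp
  qed
  define y where "y n i = (\<Sum>k<Suc n. z k i) / Suc n" for n i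
  have y_nonneg: "i \<in> I \<Longrightarrow> 0 \<le> y n i" for i n
    unfolding y_def using z_nonneg by (auto intro!: divide_nonneg_pos sum_nonneg simp del: sum.lessThan_Suc)
  have y_B: "\<bar>y n i\<bar> \<le> B" if "i \<in> I" for n i
  proof -
    have "\<bar>\<Sum>k<Suc n. z k i\<bar> \<le> (\<Sum>k<Suc n. B)"
      using z_B[OF that] by (intro order_trans[OF sum_abs] sum_mono) auto
    then show ?thesis by (simp add: y_def field_simps del: sum.lessThan_Suc)
  qed
  have y_sum: "(\<Sum>i\<in>I. L i * y n i) = 1" for n
  proof -
    have "(\<Sum>i\<in>I. L i * y n i) = (\<Sum>k<Suc n. \<Sum>i\<in>I. L i * z k i) / Suc n"
      unfolding y_def by (subst sum.swap) (simp add: sum_distrib_left sum_divide_distrib del: sum.lessThan_Suc)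
    then show ?thesis by (simp add: z_sum)
  qed
  \<comment> \<open>Applying \<open>M\<close> shifts the Cesaro sum by one index, so the mean fails
    to be an eigenvector only by a difference of two bounded terms divided by its length.\<close>
  have y_eq: "(\<Sum>j\<in>I. M i j * y n j) = c * y n i + c * (z (Suc n) i - z 0 i) / Suc n" for i n
  proof -
    have "(\<Sum>j\<in>I. M i j * y n j) = (\<Sum>k<Suc n. \<Sum>j\<in>I. M i j * z k j) / Suc n"
      unfolding y_def by (subst sum.swap) (simp add: sum_distrib_left sum_divide_distrib del: sum.lessThan_Suc)
    also have "(\<Sum>k<Suc n. \<Sum>j\<in>I. M i j * z k j) = c * (\<Sum>k<Suc n. z (Suc k) i)"
      using c by (simp add: zS sum_distrib_left del: sum.lessThan_Suc flip: sum_divide_distrib)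
        (simp add: sum_divide_distrib sum_distrib_left del: sum.lessThan_Suc)
    also have "(\<Sum>k<Suc n. z (Suc k) i) = (\<Sum>k<Suc n. z k i) + (z (Suc n) i - z 0 i)"
      by (induction n) auto
    finally show ?thesis by (simp add: y_def add_divide_distrib diff_divide_distrib algebra_simps del: sum.lessThan_Suc)
  qed
  obtain r where r: "strict_mono r" "\<forall>i\<in>I. convergent (\<lambda>n. y (r n) i)"
    using finite_convergent_subsequence[of I y B] I(1) y_B by blast
  then obtain R where R: "\<And>i. i \<in> I \<Longrightarrow> (\<lambda>n. y (r n) i) \<longlonglongrightarrow> R i"
    unfolding convergent_def by metis
  have R_nonneg: "0 \<le> R i" if "i \<in> I" for i
    using LIMSEQ_le_const[OF R[OF that], of 0] y_nonneg that by blast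
  have R_sum: "(\<Sum>i\<in>I. L i * R i) = 1"
  proof -
    have "(\<lambda>n. \<Sum>i\<in>I. L i * y (r n) i) \<longlonglongrightarrow> (\<Sum>i\<in>I. L i * R i)"
      using R by (intro tendsto_sum tendsto_mult tendsto_const)
    then show ?thesis using y_sum LIMSEQ_unique[OF _ tendsto_const[of "1::real"]] by auto
  qed
  have R_eq: "(\<Sum>j\<in>I. M i j * R j) = c * R i" if i: "i \<in> I" for i
  proof -
    have 1: "(\<lambda>n. \<Sum>j\<in>I. M i j * y (r n) j) \<longlonglongrightarrow> (\<Sum>j\<in>I. M i j * R j)"
      using R by (intro tendsto_sum tendsto_mult tendsto_const)
    have "(\<lambda>n. c * (z (Suc n) i - z 0 i) / Suc n) \<longlonglongrightarrow> 0"
    proof (rule Lim_null_comparison[of _ "\<lambda>n. (2 * c * B) / Suc n"])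
      have "\<bar>z (Suc n) i - z 0 i\<bar> \<le> 2 * B" for n using z_B[OF i, of "Suc n"] z_B[OF i, of 0] by linarith
      then show "\<forall>\<^sub>F n in sequentially. norm (c * (z (Suc n) i - z 0 i) / Suc n) \<le> (2 * c * B) / Suc n"
        using c by (intro always_eventually allI)
          (simp add: abs_mult divide_right_mono del: of_nat_Suc)
      show "(\<lambda>n. (2 * c * B) / Suc n) \<longlonglongrightarrow> 0"
        using LIMSEQ_Suc[OF lim_const_over_n[of "2 * c * B"]] by simp
    qed
    from LIMSEQ_subseq_LIMSEQ[OF this r(1)]
    have "(\<lambda>n. c * y (r n) i + c * (z (Suc (r n)) i - z 0 i) / Suc (r n)) \<longlonglongrightarrow> c * R i + 0"
      using R[OF i] by (intro tendsto_add tendsto_mult tendsto_const) (simp_all add: comp_def)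
    then show ?thesis using LIMSEQ_unique[OF 1] by (simp add: y_eq)
  qed
  \<comment> \<open>So far the limit is normalised by the weights \<open>L\<close>. That weighted
    sum being \<open>1\<close> also shows \<open>R\<close> to be non-zero, which permits rescaling
    to plain sum \<open>1\<close>.\<close>
  define T where "T = (\<Sum>i\<in>I. R i)"
  have "T \<noteq> 0"
  proof
    assume "T = 0"
    then have "\<forall>i\<in>I. R i = 0" using R_nonneg I(1) unfolding T_def by (simp add: sum_nonneg_eq_0_iff)
    then show False using R_sum by simp
  qed
  moreover have "T \<ge> 0" unfolding T_def using R_nonneg by (simp add: sum_nonneg)
  ultimately have T: "T > 0" by simp
  show ?thesis
    using T R_nonneg R_eq
    by (intro exI[of _ "\<lambda>i. if i \<in> I then R i / T else 0"])
       (auto simp: T_def normalised_eigenvector_def simp flip: sum_divide_distrib)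
qed

text \<open>The left eigenvector pins down the eigenvalue, and \<open>R0\<close> serves as a
  yardstick. The support of a non-negative eigenvector is closed under \<open>M\<close>, hence is
  all of \<open>I\<close> unless empty. Uniqueness: subtract from \<open>y\<close> the largest
  multiple of \<open>R0\<close> below it; the difference is a non-negative eigenvector with a zero
  entry, hence zero. Spectral radius: compare the moduli of a complex eigenvector with the least
  multiple of \<open>R0\<close> above them, at an index where they meet.\<close>

lemma perron_frobenius:
  fixes M :: "'b \<Rightarrow> 'b \<Rightarrow> real"
  assumes I: "finite I" "I \<noteq> {}" and M: "\<And>i j. i \<in> I \<Longrightarrow> j \<in> I \<Longrightarrow> 0 \<le> M i j"
    and L: "\<And>i. i \<in> I \<Longrightarrow> 0 < L i" and c: "0 < c"
    and left: "\<And>j. j \<in> I \<Longrightarrow> (\<Sum>i\<in>I. L i * M i j) = c * L j"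
    and irr: "\<And>Z. Z \<subseteq> I \<Longrightarrow> Z \<noteq> {} \<Longrightarrow> (\<And>i j. j \<in> Z \<Longrightarrow> i \<in> I \<Longrightarrow> M i j > 0 \<Longrightarrow> i \<in> Z) \<Longrightarrow> Z = I"
  shows "\<And>i. i \<in> I \<Longrightarrow> 0 < pf_right_eigenvector I M i"
    and "\<And>y. normalised_eigenvector I M c y \<longleftrightarrow> y = pf_right_eigenvector I M"
proof -
  have pos: "y i > 0" if "\<And>i. i \<in> I \<Longrightarrow> 0 \<le> y i" "j \<in> I" "y j > 0" "i \<in> I"
    "\<And>i. i \<in> I \<Longrightarrow> (\<Sum>j\<in>I. M i j * y j) = c * y i" for y and i j
  proof -
    have "{i \<in> I. y i > 0} = I"
    proof (rule irr)
      fix i j assume j: "j \<in> {i \<in> I. y i > 0}" and i: "i \<in> I" "M i j > 0"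
      have "0 < M i j * y j" using i j by simp
      also have "\<dots> \<le> (\<Sum>j\<in>I. M i j * y j)"
        using I j i that(1) M by (intro member_le_sum) auto
      finally show "i \<in> {i \<in> I. y i > 0}" using that(5)[OF i(1)] i(1) c by (simp add: zero_less_mult_iff)
    qed (use that in auto)
    then show ?thesis using that by blast
  qed
  obtain R0 where R0: "\<And>i. i \<in> I \<Longrightarrow> 0 \<le> R0 i" "\<And>i. i \<notin> I \<Longrightarrow> R0 i = 0" "(\<Sum>i\<in>I. R0 i) = 1"
    "\<And>i. i \<in> I \<Longrightarrow> (\<Sum>j\<in>I. M i j * R0 j) = c * R0 i"
    using nonneg_right_eigenvector_exists[OF I M L c left] unfolding normalised_eigenvector_def by metis
  have "\<exists>j\<in>I. R0 j > 0"
  proof (rule ccontr)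
    assume "\<not> ?thesis"
    then have "(\<Sum>i\<in>I. R0 i) \<le> 0" by (intro sum_nonpos) force
    then show False using R0(3) by simp
  qed
  then have R0_pos: "R0 i > 0" if "i \<in> I" for i using pos[OF R0(1) _ _ that R0(4)] by blast
  have uniq: "y = R0" if y: "\<And>i. i \<notin> I \<Longrightarrow> y i = 0" "(\<Sum>i\<in>I. y i) = 1"
    "\<And>i. i \<in> I \<Longrightarrow> (\<Sum>j\<in>I. M i j * y j) = c * y i" for y
  proof -
    define t where "t = Min ((\<lambda>i. y i / R0 i) ` I)"
    have "t \<in> (\<lambda>i. y i / R0 i) ` I" unfolding t_def using I by (intro Min_in) auto
    then obtain k where k: "k \<in> I" "t = y k / R0 k" by blast
    have t_le: "t \<le> y i / R0 i" if "i \<in> I" for i unfolding t_def using I that by (intro Min_le) auto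
    define d where "d i = y i - t * R0 i" for i
    have d_nonneg: "i \<in> I \<Longrightarrow> 0 \<le> d i" for i
      using t_le[of i] R0_pos[of i] by (auto simp: d_def pos_le_divide_eq)
    have d_eq: "(\<Sum>j\<in>I. M i j * d j) = c * d i" if "i \<in> I" for i
    proof -
      have "(\<Sum>j\<in>I. M i j * d j) = (\<Sum>j\<in>I. M i j * y j) - t * (\<Sum>j\<in>I. M i j * R0 j)"
        by (simp add: d_def algebra_simps sum_subtractf sum_distrib_left)
      then show ?thesis using y(3) R0(4) that by (simp add: d_def algebra_simps)
    qed
    have "d k = 0" using k R0_pos[OF k(1)] by (simp add: d_def)
    then have "\<not> d j > 0" if "j \<in> I" for j using pos[OF d_nonneg that _ k(1) d_eq] by auto
    then have y_eq: "y i = t * R0 i" for i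
      using d_nonneg[of i] y(1) R0(2) by (cases "i \<in> I") (force simp: d_def)+
    then have "t = 1" using y(2) R0(3) by (simp flip: sum_distrib_left)
    then show ?thesis using y_eq by auto
  qed
  have le: "cmod w \<le> c" if "matrix_eigenvalue I M w" for w
  proof -
    obtain x k where x: "\<forall>i\<in>I. (\<Sum>j\<in>I. complex_of_real (M i j) * x j) = w * x i" "k \<in> I" "x k \<noteq> 0"
      using \<open>matrix_eigenvalue I M w\<close> unfolding matrix_eigenvalue_def by blast
    define m where "m = Max ((\<lambda>i. cmod (x i) / R0 i) ` I)"
    have "m \<in> (\<lambda>i. cmod (x i) / R0 i) ` I" unfolding m_def using I by (intro Max_in) auto
    then obtain i where i: "i \<in> I" "m = cmod (x i) / R0 i" by blast
    have m_ge: "cmod (x j) \<le> m * R0 j" if "j \<in> I" for j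
    proof -
      have "cmod (x j) / R0 j \<le> m" unfolding m_def using I that by (intro Max_ge) auto
      then show ?thesis using R0_pos[OF that] by (simp add: pos_divide_le_eq)
    qed
    have "0 < cmod (x k)" using x(3) by simp
    then have "m * R0 k > 0" using m_ge[OF x(2)] by linarith
    then have m: "m > 0" using R0_pos[OF x(2)] by (simp add: zero_less_mult_iff)
    have "cmod w * cmod (x i) = cmod (\<Sum>j\<in>I. complex_of_real (M i j) * x j)"
      using x(1) i(1) by (simp add: norm_mult)
    also have "\<dots> \<le> (\<Sum>j\<in>I. M i j * (m * R0 j))"
    proof (intro order_trans[OF norm_sum] sum_mono)
      fix j assume "j \<in> I"
      then show "cmod (complex_of_real (M i j) * x j) \<le> M i j * (m * R0 j)"
        using M[OF i(1)] m_ge by (simp add: norm_mult mult_left_mono)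
    qed
    also have "\<dots> = c * (m * R0 i)" using R0(4)[OF i(1)] by (simp add: mult.left_commute flip: sum_distrib_left)
    also have "m * R0 i = cmod (x i)" using i R0_pos[of i] by simp
    finally have *: "cmod w * cmod (x i) \<le> c * cmod (x i)" .
    have "cmod (x i) > 0" using i m R0_pos[OF i(1)] by (simp add: zero_less_divide_iff)
    with * show ?thesis by simp
  qed
  have ev: "matrix_eigenvalue I M (complex_of_real c)"
    unfolding matrix_eigenvalue_def
  proof (intro exI[of _ "\<lambda>i. complex_of_real (R0 i)"] conjI ballI)
    show "\<exists>i\<in>I. complex_of_real (R0 i) \<noteq> 0" using I R0_pos by fastforce
    fix i assume "i \<in> I"
    then show "(\<Sum>j\<in>I. complex_of_real (M i j) * complex_of_real (R0 j)) = complex_of_real c * complex_of_real (R0 i)"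
      using R0(4)[of i] by (simp flip: of_real_mult of_real_sum)
  qed
  have pf: "pf_eigenvalue I M = c"
    unfolding pf_eigenvalue_def
  proof (rule cSup_eq_maximum)
    show "c \<in> cmod ` {z. matrix_eigenvalue I M z}"
      using ev c by (intro image_eqI[of _ _ "complex_of_real c"]) auto
  qed (use le in auto)
  have R: "pf_right_eigenvector I M = R0"
    unfolding pf_right_eigenvector_def pf
  proof (rule the_equality)
    show "(\<forall>i\<in>I. 0 < R0 i) \<and> (\<forall>i. i \<notin> I \<longrightarrow> R0 i = 0) \<and> (\<Sum>i\<in>I. \<bar>R0 i\<bar>) = 1 \<and>
      (\<forall>i\<in>I. (\<Sum>j\<in>I. M i j * R0 j) = c * R0 i)"
      using R0 R0_pos by simp
  next
    fix y assume y: "(\<forall>i\<in>I. 0 < y i) \<and> (\<forall>i. i \<notin> I \<longrightarrow> y i = 0) \<and> (\<Sum>i\<in>I. \<bar>y i\<bar>) = 1 \<and>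
      (\<forall>i\<in>I. (\<Sum>j\<in>I. M i j * y j) = c * y i)"
    then have "(\<Sum>i\<in>I. \<bar>y i\<bar>) = (\<Sum>i\<in>I. y i)" by (intro sum.cong) auto
    then show "y = R0" using y by (intro uniq) auto
  qed
  show "\<And>i. i \<in> I \<Longrightarrow> 0 < pf_right_eigenvector I M i"
    unfolding R by (rule R0_pos)
  show "\<And>y. normalised_eigenvector I M c y \<longleftrightarrow> y = pf_right_eigenvector I M"
    unfolding R normalised_eigenvector_def using R0 uniq by blast
qed

section \<open>Expectations over independent choices\<close>

definition expct :: "('a \<Rightarrow> 'a list pmf) \<Rightarrow> 'a list \<Rightarrow> ('a list list \<Rightarrow> real) \<Rightarrow> real" where
  "expct P w g = measure_pmf.expectation (choice_pmf P w) g"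

lemma set_choice_pmf: "set_pmf (choice_pmf P w) = listset (map (\<lambda>a. set_pmf (P a)) w)"
  by (induction w) (auto simp: set_Cons_def image_iff)

lemma finite_listset: "(\<And>a. finite (\<theta> a)) \<Longrightarrow> finite (listset (map \<theta> w))"
proof (induction w)
  case (Cons a w)
  have "set_Cons (\<theta> a) (listset (map \<theta> w)) = (\<lambda>(x, y). x # y) ` (\<theta> a \<times> listset (map \<theta> w))"
    by (auto simp: set_Cons_def)
  then show ?case using Cons by simp
qed auto

lemma choice_pmf_Cons:
  "choice_pmf P (a # u) = bind_pmf (P a) (\<lambda>x. map_pmf ((#) x) (choice_pmf P u))"
  by (simp add: pair_pmf_def map_bind_pmf map_pmf_comp bind_return_pmf map_pmf_def[symmetric])

text \<open>Stated for finite supports only, so that the rules also apply to the perturbed vectors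
  of \<open>mix_pmf\<close>.\<close>

locale finite_choices =
  fixes P :: "'a \<Rightarrow> 'a list pmf"
  assumes finite_P: "finite (set_pmf (P a))"
begin

abbreviation "chs w \<equiv> listset (map (\<lambda>a. set_pmf (P a)) w)"

lemma finite_choice: "finite (set_pmf (choice_pmf P w))"
  unfolding set_choice_pmf by (intro finite_listset finite_P)

lemma expct_sum_form: "expct P w g = (\<Sum>xs\<in>chs w. pmf (choice_pmf P w) xs * g xs)"
  unfolding expct_def using finite_choice[of w]
  by (subst integral_measure_pmf_real[of "chs w"]) (auto simp: set_choice_pmf mult.commute)

lemma expct_const: "expct P w (\<lambda>_. c) = c"
  by (simp add: expct_def)

lemma expct_cong: "(\<And>xs. xs \<in> chs w \<Longrightarrow> g xs = h xs) \<Longrightarrow> expct P w g = expct P w h"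
  unfolding expct_sum_form by (intro sum.cong) auto

lemma expct_mono: "(\<And>xs. xs \<in> chs w \<Longrightarrow> g xs \<le> h xs) \<Longrightarrow> expct P w g \<le> expct P w h"
  unfolding expct_sum_form by (intro sum_mono mult_left_mono) auto

lemma expct_nonneg: "(\<And>xs. xs \<in> chs w \<Longrightarrow> 0 \<le> g xs) \<Longrightarrow> 0 \<le> expct P w g"
  unfolding expct_sum_form by (intro sum_nonneg mult_nonneg_nonneg) auto

lemma expct_add: "expct P w (\<lambda>xs. g xs + h xs) = expct P w g + expct P w h"
  unfolding expct_sum_form by (simp add: algebra_simps sum.distrib)

lemma expct_cmult: "expct P w (\<lambda>xs. c * g xs) = c * expct P w g"
  unfolding expct_sum_form by (simp add: sum_distrib_left algebra_simps)

lemma expct_sum: "expct P w (\<lambda>xs. \<Sum>i\<in>A. g i xs) = (\<Sum>i\<in>A. expct P w (g i))"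
  unfolding expct_sum_form by (subst sum.swap) (simp add: sum_distrib_left)

lemma expct_ge_single:
  assumes "xs \<in> chs w" "\<And>xs. xs \<in> chs w \<Longrightarrow> 0 \<le> g xs"
  shows "pmf (choice_pmf P w) xs * g xs \<le> expct P w g"
  unfolding expct_sum_form using assms finite_choice[of w]
  by (intro member_le_sum) (auto simp: set_choice_pmf)

lemma expct_Nil [simp]: "expct P [] g = g []"
  by (simp add: expct_def)

lemma expct_Cons: "expct P (a # u) g = (\<Sum>x\<in>set_pmf (P a). pmf (P a) x * expct P u (\<lambda>ys. g (x # ys)))"
proof -
  have "expct P (a # u) g = measure_pmf.expectation (P a) (\<lambda>x. expct P u (\<lambda>ys. g (x # ys)))"
    unfolding expct_def choice_pmf_Cons
    by (subst pmf_expectation_bind[of "set_pmf (P a)"])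
       (use finite_P finite_choice in \<open>auto simp: integral_measure_pmf_real[of "set_pmf (P a)"] mult.commute\<close>)
  then show ?thesis using finite_P
    by (subst (asm) integral_measure_pmf_real[of "set_pmf (P a)"]) (auto simp: mult.commute)
qed

lemma expct_append: "expct P (u @ v) g = expct P u (\<lambda>xs. expct P v (\<lambda>ys. g (xs @ ys)))"
  by (induction u arbitrary: g) (simp_all add: expct_Cons)

lemma expct_pos:
  assumes "xs \<in> chs w" "\<And>xs. xs \<in> chs w \<Longrightarrow> 0 \<le> g xs" "g xs > 0"
  shows "expct P w g > 0"
proof -
  have "pmf (choice_pmf P w) xs > 0" using assms(1) by (simp add: pmf_positive_iff set_choice_pmf)
  then show ?thesis using expct_ge_single[of xs w g] assms by (meson less_le_trans mult_pos_pos)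
qed

end

lemma induced_matrix_expct:
  "induced_matrix P l u w = expct P w (\<lambda>xs. real (count_list (induced_word l xs) u))"
  by (simp add: induced_matrix_def induced_substitution_def expct_def)

lemma sum_count_list:
  fixes h :: "'b \<Rightarrow> real"
  assumes "finite A" "set zs \<subseteq> A"
  shows "(\<Sum>u\<in>A. h u * real (count_list zs u)) = sum_list (map h zs)"
  using assms(2)
proof (induction zs)
  case (Cons z zs)
  have "(\<Sum>u\<in>A. h u * real (count_list (z # zs) u)) =
     (\<Sum>u\<in>A. h u * real (count_list zs u)) + (\<Sum>u\<in>A. if u = z then h u else 0)"
    by (subst sum.distrib[symmetric], intro sum.cong) (auto simp: algebra_simps)
  then show ?case using Cons assms(1) by simp
qed simp

section \<open>The inflation factor\<close>

text \<open>Irreducibility on the level of letters: all powers of \<open>a\<close> remain in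
  \<open>Z\<close>, and every letter occurs in one of them.\<close>

lemma (in primitive_rs) closed_letter_set_full:
  assumes "a \<in> Z" "\<And>a w. a \<in> Z \<Longrightarrow> w \<in> \<theta> a \<Longrightarrow> set w \<subseteq> Z"
  shows "Z = UNIV"
proof -
  have 1: "set (concat xs) \<subseteq> Z" if "xs \<in> listset (map \<theta> u)" "set u \<subseteq> Z" for xs u
    using that
  proof (induction u arbitrary: xs)
    case (Cons b u)
    from Cons.prems obtain x ys where "xs = x # ys" "x \<in> \<theta> b" "ys \<in> listset (map \<theta> u)" "b \<in> Z"
      by (auto simp: set_Cons_def)
    then show ?case using Cons.IH[of ys] Cons.prems assms(2)[of b x] by auto
  qed auto
  have 2: "set x \<subseteq> Z" if "x \<in> power_realisations \<theta> k [a]" for k x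
    using that
  proof (induction k arbitrary: x)
    case (Suc k)
    then obtain v xs where "v \<in> power_realisations \<theta> k [a]" "xs \<in> listset (map \<theta> v)" "x = concat xs"
      by (auto simp: realisations_def)
    then show ?case using Suc.IH[of v] 1[of xs v] by blast
  qed (use assms(1) in auto)
  have "b \<in> Z" for b
  proof -
    obtain K where "\<And>k c. k \<ge> K \<Longrightarrow> \<exists>x\<in>power_realisations \<theta> k [c]. sublist [b] x"
      using letter_eventually_everywhere by blast
    then obtain x where "x \<in> power_realisations \<theta> K [a]" "sublist [b] x" by blast
    then show ?thesis using 2 set_mono_sublist[of "[b]" x] by auto
  qed
  then show ?thesis by blast
qed

lemma (in primitive_rs) letter_in_image: "\<exists>a. \<exists>w\<in>\<theta> a. b \<in> set w"
proof -
  obtain K where "\<And>k c. k \<ge> K \<Longrightarrow> \<exists>x\<in>power_realisations \<theta> k [c]. sublist [b] x"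
    using letter_eventually_everywhere by blast
  then obtain x where x: "x \<in> power_realisations \<theta> (Suc K) [b]" "sublist [b] x" by (meson le_SucI order_refl)
  then obtain v xs where "xs \<in> listset (map \<theta> v)" "x = concat xs"
    by (auto simp: realisations_def)
  moreover have "b \<in> set x" using x(2) set_mono_sublist[of "[b]" x] by auto
  moreover have "\<exists>a. \<exists>w\<in>\<theta> a. b \<in> set w" if "xs \<in> listset (map \<theta> v)" "b \<in> set (concat xs)" for xs v
    using that
  proof (induction v arbitrary: xs)
    case (Cons c v)
    from Cons.prems obtain x ys where "xs = x # ys" "x \<in> \<theta> c" "ys \<in> listset (map \<theta> v)"
      by (auto simp: set_Cons_def)
    then show ?case using Cons.IH[of ys] Cons.prems by auto
  qed auto
  ultimately show ?thesis by blast
qed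

text \<open>The equation \<open>set_P\<close> combines two facts: images outside
  \<open>\<theta> a\<close> have probability zero, and those inside have positive
  probability.\<close>

locale random_rs = primitive_rs \<theta> for \<theta> :: "'a::finite \<Rightarrow> 'a list set" +
  fixes P :: "'a \<Rightarrow> 'a list pmf"
  assumes set_P: "set_pmf (P a) = \<theta> a"

sublocale random_rs \<subseteq> finite_choices P
  by unfold_locales (simp add: set_P finite_images)

context random_rs
begin

lemma chs_eq: "chs w = listset (map \<theta> w)"
  by (simp add: set_P)

lemma pmf_pos: "w \<in> \<theta> a \<Longrightarrow> pmf (P a) w > 0"
  by (simp add: pmf_positive_iff set_P)

lemma sum_pmf: "(\<Sum>w\<in>\<theta> a. pmf (P a) w) = 1"
  using sum_pmf_eq_1[of "\<theta> a" "P a"] finite_images set_P by auto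

text \<open>Brouwer's theorem for the normalised action of the letter matrix \<open>m\<close>
  (expected numbers of letters in images) on the simplex \<open>S\<close>. Normalising is possible
  since every letter occurs in some image. A fixed point is positive because its zero set is closed
  under taking images.\<close>

lemma left_eigenvector_exists:
  "\<exists>L c. (\<forall>a. (0::real) < L a) \<and> (0::real) < c \<and> (\<forall>a. (\<Sum>w\<in>\<theta> a. pmf (P a) w * sum_list (map L w)) = c * L a)"
proof -
  define m where "m b a = (\<Sum>w\<in>\<theta> a. pmf (P a) w * real (count_list w b))" for a b
  have m: "(\<Sum>w\<in>\<theta> a. pmf (P a) w * sum_list (map L w)) = (\<Sum>b\<in>UNIV. L b * m b a)" for L :: "'a \<Rightarrow> real" and a
  proof -
    have "(\<Sum>w\<in>\<theta> a. pmf (P a) w * sum_list (map L w)) =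
      (\<Sum>w\<in>\<theta> a. pmf (P a) w * (\<Sum>b\<in>UNIV. L b * real (count_list w b)))"
      by (simp add: sum_count_list)
    also have "\<dots> = (\<Sum>b\<in>UNIV. L b * m b a)"
      unfolding m_def sum_distrib_left by (subst sum.swap) (simp add: mult_ac)
    finally show ?thesis .
  qed
  have m_nonneg: "m b a \<ge> 0" for a b unfolding m_def by (intro sum_nonneg) auto
  have m_row: "\<exists>a. m b a > 0" for b
  proof -
    obtain a w where w: "w \<in> \<theta> a" "b \<in> set w" using letter_in_image by blast
    have "0 < pmf (P a) w * real (count_list w b)"
      using w pmf_pos count_list_0_iff[of w b] by simp
    also have "\<dots> \<le> m b a" unfolding m_def using w finite_images by (intro member_le_sum) auto
    finally show ?thesis by blast
  qed
  define S where "S = {x :: real^'a. (\<forall>a. 0 \<le> x $ a) \<and> (\<Sum>a\<in>UNIV. x $ a) = 1}"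
  define G :: "real^'a \<Rightarrow> real^'a" where "G x = (\<chi> a. \<Sum>b\<in>UNIV. x $ b * m b a)" for x
  define N where "N x = (\<Sum>a\<in>UNIV. G x $ a)" for x
  define F where "F x = (1 / N x) *\<^sub>R G x" for x
  have le1: "x $ a \<le> 1" if "x \<in> S" for x a
  proof -
    have "x $ a \<le> (\<Sum>a\<in>UNIV. x $ a)" using that by (intro member_le_sum) (auto simp: S_def)
    then show ?thesis using that by (simp add: S_def)
  qed
  have G_nonneg: "G x $ a \<ge> 0" if "x \<in> S" for x a
    using that m_nonneg by (auto simp: G_def S_def intro!: sum_nonneg)
  have N_pos: "N x > 0" if x: "x \<in> S" for x
  proof -
    have "\<exists>b. x $ b > 0"
    proof (rule ccontr)
      assume "\<not> ?thesis"
      then have "(\<Sum>a\<in>UNIV. x $ a) \<le> 0" by (intro sum_nonpos) (simp add: not_less)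
      then show False using x by (simp add: S_def)
    qed
    then obtain b where b: "x $ b > 0" by blast
    obtain a where a: "m b a > 0" using m_row by blast
    have "0 < x $ b * m b a" using a b by simp
    also have "\<dots> \<le> (\<Sum>b\<in>UNIV. x $ b * m b a)"
      using x m_nonneg by (intro member_le_sum) (auto simp: S_def)
    also have "\<dots> = G x $ a" by (simp add: G_def)
    also have "\<dots> \<le> N x" unfolding N_def using G_nonneg[OF x] by (intro member_le_sum) auto
    finally show ?thesis .
  qed
  have contG: "continuous_on S G"
    unfolding G_def by (intro continuous_on_vec_lambda continuous_intros)
  have "continuous_on S F"
    unfolding F_def N_def using contG N_pos unfolding N_def
    by (intro continuous_intros) (auto, metis less_irrefl)
  moreover have "F ` S \<subseteq> S"
  proof safe
    fix x assume x: "x \<in> S"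
    have "(\<Sum>a\<in>UNIV. F x $ a) = N x / N x" unfolding F_def by (simp add: N_def flip: sum_divide_distrib)
    moreover have "0 \<le> F x $ a" for a using N_pos[OF x] G_nonneg[OF x] by (simp add: F_def)
    ultimately show "F x \<in> S" using N_pos[OF x] by (simp add: S_def)
  qed
  moreover have "compact S"
  proof -
    have "closed S" unfolding S_def
      by (intro closed_Collect_conj closed_Collect_all closed_Collect_le closed_Collect_eq continuous_intros)
    moreover have "bounded S"
    proof (rule bounded_subset[OF bounded_cbox[of "0" "1"]])
      show "S \<subseteq> cbox 0 1" using le1 by (auto simp: S_def mem_box_cart)
    qed
    ultimately show ?thesis by (simp add: compact_eq_bounded_closed)
  qed
  moreover have "convex S"
    unfolding convex_def S_def by (auto simp: sum.distrib simp flip: sum_distrib_left)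
  moreover have "(\<chi> a. if a = undefined then 1 else 0) \<in> S" by (simp add: S_def)
  ultimately obtain x where x: "x \<in> S" "F x = x" using brouwer[of S F] by blast
  define c where "c = N x"
  have c: "c > 0" using N_pos x by (simp add: c_def)
  have "G x = c *\<^sub>R F x" using c by (simp add: F_def c_def)
  then have "G x $ a = c * x $ a" for a using x(2) by simp
  then have eig: "(\<Sum>w\<in>\<theta> a. pmf (P a) w * sum_list (map (($) x) w)) = c * x $ a" for a
    unfolding m by (simp add: G_def)
  have nonneg: "0 \<le> x $ a" for a using x by (simp add: S_def)
  have pos: "x $ a > 0" for a
  proof (rule ccontr)
    assume "\<not> x $ a > 0"
    then have "a \<in> {a. x $ a = 0}" using nonneg[of a] by simp
    then have "{a. x $ a = 0} = UNIV"
    proof (rule closed_letter_set_full)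
      fix b w assume b: "b \<in> {a. x $ a = 0}" "w \<in> \<theta> b"
      have "pmf (P b) w * sum_list (map (($) x) w) \<le> (\<Sum>w\<in>\<theta> b. pmf (P b) w * sum_list (map (($) x) w))"
        using b finite_images nonneg by (intro member_le_sum) (auto intro!: mult_nonneg_nonneg sum_list_nonneg)
      also have "\<dots> = 0" using eig[of b] b by simp
      finally have "sum_list (map (($) x) w) \<le> 0" using pmf_pos[OF b(2)] by (simp add: mult_le_0_iff)
      then have "sum_list (map (($) x) w) = 0" using nonneg by (intro antisym sum_list_nonneg) auto
      then show "set w \<subseteq> {a. x $ a = 0}"
        by (subst (asm) sum_list_nonneg_eq_0_iff) (use nonneg in auto)
    qed
    then have "x $ a = 0" for a by blast
    then have "(\<Sum>a\<in>UNIV. x $ a) = 0" by simp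
    then show False using x by (simp add: S_def)
  qed
  show ?thesis using c pos eig by (intro exI[of _ "($) x"] exI[of _ c]) auto
qed

text \<open>If \<open>c \<le> 1\<close>, a letter of minimal weight has only images consisting of
  one letter of minimal weight, as any other image would push the average up. Such letters form a
  closed set, so all images would have length one.\<close>

lemma inflation_gt_1:
  assumes L: "\<And>a. (0::real) < L a" and c: "0 < c"
    and eig: "\<And>a. (\<Sum>w\<in>\<theta> a. pmf (P a) w * sum_list (map L w)) = c * L a"
  shows "c > 1"
proof (rule ccontr)
  assume "\<not> c > 1"
  define t where "t = Min (range L)"
  have t_le: "t \<le> L a" for a unfolding t_def by (intro Min_le) auto
  have "t \<in> range L" unfolding t_def by (intro Min_in) auto
  then obtain a where a: "L a = t" by auto
  have t: "t > 0" using L[of a] a by simp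
  have sl: "t * length w \<le> sum_list (map L w)" for w
    by (induction w) (use t_le in \<open>auto simp: algebra_simps intro: add_mono\<close>)
  have sing: "length w = 1 \<and> set w \<subseteq> {a. L a = t}" if b: "L b = t" and w: "w \<in> \<theta> b" for b w
  proof -
    have ge: "sum_list (map L v) \<ge> t" if "v \<in> \<theta> b" for v
    proof -
      have "length v \<ge> 1" using nonerasing[of b] that by (cases v) auto
      then have "t * 1 \<le> t * length v" using t by (intro mult_left_mono) auto
      then show ?thesis using sl[of v] by linarith
    qed
    have "(\<Sum>v\<in>\<theta> b. pmf (P b) v * (sum_list (map L v) - t)) = c * t - t"
      using eig[of b] b sum_pmf[of b] by (simp add: algebra_simps sum_subtractf flip: sum_distrib_left)
    also have "\<dots> \<le> 0" using \<open>\<not> c > 1\<close> t by simp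
    finally have "(\<Sum>v\<in>\<theta> b. pmf (P b) v * (sum_list (map L v) - t)) \<le> 0" .
    moreover have "pmf (P b) w * (sum_list (map L w) - t) \<le> (\<Sum>v\<in>\<theta> b. pmf (P b) v * (sum_list (map L v) - t))"
      using w ge finite_images by (intro member_le_sum) auto
    ultimately have "pmf (P b) w * (sum_list (map L w) - t) \<le> 0" by linarith
    then have eq: "sum_list (map L w) = t" using pmf_pos[OF w] ge[OF w] by (simp add: mult_le_0_iff)
    then have "t * length w \<le> t * 1" using sl[of w] by simp
    then have "length w \<le> 1" using t by (simp only: mult_le_cancel_left_pos)
    moreover have "w \<noteq> []" using nonerasing[of b] w by auto
    ultimately have "length w = 1" by (cases w) auto
    then show ?thesis using eq by (auto simp: length_Suc_conv)
  qed
  have "{a. L a = t} = UNIV"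
    by (rule closed_letter_set_full[of a]) (use a sing in auto)
  moreover obtain b w where "w \<in> \<theta> b" "length w \<ge> 2" using long_image by blast
  ultimately show False using sing[of b w] by auto
qed

end

section \<open>The frequency function\<close>

lemma finite_words: "finite {u :: 'a::finite list. length u = n}"
  using finite_lists_length_eq[of "UNIV :: 'a set" n] by simp

lemma sum_words_snoc:
  fixes g :: "'a::finite list \<Rightarrow> real"
  shows "(\<Sum>w | length w = Suc n. g w) = (\<Sum>v | length v = n. \<Sum>a\<in>UNIV. g (v @ [a]))"
proof -
  have "(\<Sum>w | length w = Suc n. g w) = (\<Sum>(v, a)\<in>{v. length v = n} \<times> UNIV. g (v @ [a]))"
    by (rule sum.reindex_bij_witness[of _ "\<lambda>(v, a). v @ [a]" "\<lambda>w. (butlast w, last w)"])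
       (auto simp: length_Suc_conv_rev)
  then show ?thesis by (simp add: sum.cartesian_product)
qed

lemma sum_words_Cons:
  fixes g :: "'a::finite list \<Rightarrow> real"
  shows "(\<Sum>w | length w = Suc n. g w) = (\<Sum>v | length v = n. \<Sum>a\<in>UNIV. g (a # v))"
proof -
  have "(\<Sum>w | length w = Suc n. g w) = (\<Sum>(v, a)\<in>{v. length v = n} \<times> UNIV. g (a # v))"
    by (rule sum.reindex_bij_witness[of _ "\<lambda>(v, a). a # v" "\<lambda>w. (tl w, hd w)"])
       (auto simp: length_Suc_conv)
  then show ?thesis by (simp add: sum.cartesian_product)
qed

text \<open>The windows are indexed by the positions of the first block and so spell it with their
  first letters. Hence a left eigenvector on letters, composed with \<open>hd\<close>, is one on
  words of any length.\<close>

lemma map_hd_induced_word: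
  assumes "l \<ge> 1" "xs \<noteq> []"
  shows "map hd (induced_word l xs) = hd xs"
proof -
  obtain x ys where xs: "xs = x # ys" using assms(2) by (cases xs) auto
  have "hd (take l (drop r (x @ concat ys))) = x ! r" if "r < length x" for r
    using that assms(1) by (simp add: hd_drop_conv_nth nth_append)
  then show ?thesis unfolding xs induced_word_def by (intro nth_equalityI) auto
qed

text \<open>Dropping the first letter moves every window one place to the right. The sum telescopes
  up to two windows: the one at the start of the first block and the one at the start of the
  second.\<close>

lemma sum_induced_word_tl:
  fixes h :: "'a list \<Rightarrow> real"
  assumes "xs \<noteq> []"
  shows "(\<Sum>z\<leftarrow>induced_word (Suc l) xs. h (tl z)) =
    (\<Sum>z\<leftarrow>induced_word l xs. h z) - h (take l (concat xs)) + h (take l (concat (tl xs)))"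
proof -
  define f where "f r = h (take l (drop r (concat xs)))" for r
  have "tl (take (Suc l) (drop r zs)) = take l (drop (Suc r) zs)" for r and zs :: "'a list"
    by (simp add: tl_take tl_drop drop_Suc)
  then have "(\<Sum>z\<leftarrow>induced_word (Suc l) xs. h (tl z)) = (\<Sum>r\<leftarrow>[0..<length (hd xs)]. f (Suc r))"
    unfolding induced_word_def f_def by (simp add: comp_def)
  also have "\<dots> = (\<Sum>r<length (hd xs). f (Suc r))"
    by (simp add: interv_sum_list_conv_sum_set_nat atLeast0LessThan)
  also have "\<dots> = (\<Sum>r<n. f r) - f 0 + f n" if "n = length (hd xs)" for n
    unfolding that[symmetric] by (induction n) auto
  also have "(\<Sum>r<length (hd xs). f r) = (\<Sum>z\<leftarrow>induced_word l xs. h z)"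
    by (simp add: induced_word_def comp_def f_def interv_sum_list_conv_sum_set_nat atLeast0LessThan)
  finally show ?thesis using assms by (cases xs) (simp_all add: f_def)
qed

context random_rs
begin

text \<open>One function for all word lengths; the value \<open>1\<close> at the empty word extends
  the marginal identities down to length zero.\<close>

definition freq :: "'a list \<Rightarrow> real" where
  "freq v = (if v = [] then 1 else induced_eigenvector \<theta> P (length v) v)"

text \<open>Formulated on letters: the same \<open>c\<close> then serves as the eigenvalue for all
  lengths, which the comparison of \<open>freq\<close> on different lengths depends on.\<close>

definition eigen_pair :: "('a \<Rightarrow> real) \<Rightarrow> real \<Rightarrow> bool" where
  "eigen_pair L c \<longleftrightarrow> (\<forall>a. 0 < L a) \<and> 1 < c \<and>
     (\<forall>a. (\<Sum>w\<in>\<theta> a. pmf (P a) w * sum_list (map L w)) = c * L a)"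

lemma eigen_pair_exists: "\<exists>L c. eigen_pair L c"
  using left_eigenvector_exists inflation_gt_1 unfolding eigen_pair_def by metis

lemma finite_legal_words: "finite (legal_words \<theta> l)"
  by (rule finite_subset[OF _ finite_words[of l]]) (auto simp: legal_words_def)

lemma induced_matrix_nonneg: "0 \<le> induced_matrix P l u w"
  unfolding induced_matrix_expct by (intro expct_nonneg) auto

lemma sum_induced_matrix:
  assumes "l \<ge> 1" "w \<in> legal_words \<theta> l"
  shows "(\<Sum>u\<in>legal_words \<theta> l. h u * induced_matrix P l u w) =
           expct P w (\<lambda>xs. \<Sum>z\<leftarrow>induced_word l xs. h z)"
proof -
  have "(\<Sum>u\<in>legal_words \<theta> l. h u * induced_matrix P l u w) =
    expct P w (\<lambda>xs. \<Sum>u\<in>legal_words \<theta> l. h u * real (count_list (induced_word l xs) u))"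
    by (simp add: induced_matrix_expct expct_sum expct_cmult)
  also have "\<dots> = expct P w (\<lambda>xs. \<Sum>z\<leftarrow>induced_word l xs. h z)"
    using mem_induced_word_legal[OF assms(2,1)] finite_legal_words
    by (intro expct_cong sum_count_list) (auto simp: chs_eq)
  finally show ?thesis .
qed

lemma induced_eigenvector_pf:
  assumes l: "l \<ge> 1" and ep: "eigen_pair L c"
  shows "\<And>w. w \<in> legal_words \<theta> l \<Longrightarrow> 0 < induced_eigenvector \<theta> P l w"
    and "\<And>y. normalised_eigenvector (legal_words \<theta> l) (induced_matrix P l) c y \<longleftrightarrow>
           y = induced_eigenvector \<theta> P l"
proof -
  have left: "(\<Sum>u\<in>legal_words \<theta> l. L (hd u) * induced_matrix P l u w) = c * L (hd w)"
    if w: "w \<in> legal_words \<theta> l" for w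
  proof -
    obtain a v where av: "w = a # v" using w l by (cases w) (auto simp: legal_words_def)
    have "(\<Sum>z\<leftarrow>induced_word l xs. L (hd z)) = sum_list (map L (hd xs))" if "xs \<in> chs w" for xs
    proof -
      have "xs \<noteq> []" using length_listset[OF that] av by auto
      then show ?thesis using arg_cong[OF map_hd_induced_word[OF l], of xs "map L"] by (simp add: comp_def)
    qed
    then have "(\<Sum>u\<in>legal_words \<theta> l. L (hd u) * induced_matrix P l u w) =
      expct P w (\<lambda>xs. sum_list (map L (hd xs)))"
      unfolding sum_induced_matrix[OF l w] by (intro expct_cong) auto
    also have "\<dots> = c * L a"
      using ep by (simp add: av expct_Cons expct_const set_P eigen_pair_def)
    finally show ?thesis by (simp add: av)
  qed
  have irr: "Z = legal_words \<theta> l" if Z: "Z \<subseteq> legal_words \<theta> l" "Z \<noteq> {}"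
    and cl: "\<And>i j. j \<in> Z \<Longrightarrow> i \<in> legal_words \<theta> l \<Longrightarrow> induced_matrix P l i j > 0 \<Longrightarrow> i \<in> Z" for Z
  proof (rule legal_words_irreducible[OF l Z])
    fix w xs assume w: "w \<in> Z" and xs: "xs \<in> listset (map \<theta> w)"
    show "set (induced_word l xs) \<subseteq> Z"
    proof
      fix u assume u: "u \<in> set (induced_word l xs)"
      have "count_list (induced_word l xs) u > 0" using u count_list_0_iff by (metis gr0I)
      then have "0 < induced_matrix P l u w" unfolding induced_matrix_expct
        using xs by (intro expct_pos[of xs]) (auto simp: chs_eq)
      then show "u \<in> Z" using mem_induced_word_legal[OF _ l xs u] Z w cl by blast
    qed
  qed
  have pos: "\<And>i. i \<in> legal_words \<theta> l \<Longrightarrow> 0 < L (hd i)" and c: "0 < c" using ep by (auto simp: eigen_pair_def)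
  note pf = perron_frobenius[where L = "\<lambda>w. L (hd w)", OF finite_legal_words legal_words_ne[OF l]
      induced_matrix_nonneg pos c left irr, folded induced_eigenvector_def]
  show "\<And>w. w \<in> legal_words \<theta> l \<Longrightarrow> 0 < induced_eigenvector \<theta> P l w"
    by (rule pf(1))
  show "\<And>y. normalised_eigenvector (legal_words \<theta> l) (induced_matrix P l) c y \<longleftrightarrow>
      y = induced_eigenvector \<theta> P l"
    by (rule pf(2))
qed

lemma induced_eigenvector_normalised:
  assumes "l \<ge> 1" "eigen_pair L c"
  shows "\<And>w. w \<notin> legal_words \<theta> l \<Longrightarrow> induced_eigenvector \<theta> P l w = 0"
    and "(\<Sum>w\<in>legal_words \<theta> l. induced_eigenvector \<theta> P l w) = 1"
    and "\<And>u. u \<in> legal_words \<theta> l \<Longrightarrow> (\<Sum>w\<in>legal_words \<theta> l. induced_matrix P l u w *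
           induced_eigenvector \<theta> P l w) = c * induced_eigenvector \<theta> P l u"
  using induced_eigenvector_pf(2)[OF assms, of "induced_eigenvector \<theta> P l"]
  by (simp_all add: normalised_eigenvector_def)

lemma freq_eq: "length v = l \<Longrightarrow> l \<ge> 1 \<Longrightarrow> freq v = induced_eigenvector \<theta> P l v"
  by (auto simp: freq_def)

lemma freq_pos: "legal \<theta> v \<Longrightarrow> 0 < freq v"
  using induced_eigenvector_pf(1)[of "length v" _ _ v] eigen_pair_exists
  by (auto simp: freq_def legal_words_def Suc_le_eq)

lemma freq_zero: "v \<noteq> [] \<Longrightarrow> \<not> legal \<theta> v \<Longrightarrow> freq v = 0"
  using induced_eigenvector_normalised(1)[of "length v" _ _ v] eigen_pair_exists
  by (auto simp: freq_def legal_words_def Suc_le_eq)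

lemma freq_nonneg: "0 \<le> freq v"
  using freq_pos[of v] freq_zero[of v] by (cases "v = []"; cases "legal \<theta> v") (auto simp: freq_def)

lemma sum_freq_legal:
  "l \<ge> 1 \<Longrightarrow> (\<Sum>w | length w = l. freq w * g w) = (\<Sum>w\<in>legal_words \<theta> l. induced_eigenvector \<theta> P l w * g w)"
  by (rule sum.mono_neutral_cong_right[OF finite_words]) (use freq_zero in \<open>auto simp: legal_words_def freq_def\<close>)

lemma freq_sum: "(\<Sum>w | length w = l. freq w) = 1"
proof (cases "l = 0")
  case True
  have "{w :: 'a list. length w = 0} = {[]}" by auto
  then show ?thesis using True by (simp add: freq_def)
next
  case False
  obtain L c where "eigen_pair L c" using eigen_pair_exists by blast
  then show ?thesis using False sum_freq_legal[of l "\<lambda>_. 1"] induced_eigenvector_normalised(2)[of l L c] by simp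
qed

text \<open>The eigenvector equation tested against an arbitrary \<open>h\<close>. Sums run over all
  words of the given length, illegal ones having weight zero.\<close>

lemma freq_eigen:
  assumes l: "l \<ge> 1" and ep: "eigen_pair L c"
  shows "c * (\<Sum>u | length u = l. freq u * h u) =
    (\<Sum>w | length w = l. freq w * expct P w (\<lambda>xs. \<Sum>z\<leftarrow>induced_word l xs. h z))"
proof -
  let ?R = "induced_eigenvector \<theta> P l" and ?I = "legal_words \<theta> l"
  have "c * (\<Sum>u | length u = l. freq u * h u) = (\<Sum>u\<in>?I. h u * (c * ?R u))"
    unfolding sum_freq_legal[OF l] by (simp add: sum_distrib_left mult_ac)
  also have "\<dots> = (\<Sum>u\<in>?I. h u * (\<Sum>w\<in>?I. induced_matrix P l u w * ?R w))"
    using induced_eigenvector_normalised(3)[OF l ep] by (intro sum.cong) auto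
  also have "\<dots> = (\<Sum>w\<in>?I. ?R w * (\<Sum>u\<in>?I. h u * induced_matrix P l u w))"
    unfolding sum_distrib_left by (subst sum.swap) (simp add: mult_ac)
  also have "\<dots> = (\<Sum>w\<in>?I. ?R w * expct P w (\<lambda>xs. \<Sum>z\<leftarrow>induced_word l xs. h z))"
    using sum_induced_matrix[OF l] by (intro sum.cong) auto
  finally show ?thesis using sum_freq_legal[OF l] by simp
qed

text \<open>The right marginal from length \<open>l + 1\<close> solves the eigenvector problem for
  length \<open>l\<close> with the same eigenvalue, because the image of the last letter cannot
  affect windows of length \<open>l\<close> starting in the first block. Uniqueness identifies it
  with \<open>freq\<close>.\<close>

lemma freq_snoc: "(\<Sum>a\<in>UNIV. freq (v @ [a])) = freq v"
proof (cases "v = []")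
  case True
  then show ?thesis using freq_sum[of 1] sum_words_snoc[of freq 0] by (simp add: freq_def)
next
  case False
  define l where "l = length v"
  have l: "l \<ge> 1" using False by (simp add: l_def Suc_le_eq)
  obtain L c where ep: "eigen_pair L c" using eigen_pair_exists by blast
  define y where "y v = (if length v = l then \<Sum>a\<in>UNIV. freq (v @ [a]) else 0)" for v
  have "y = induced_eigenvector \<theta> P l"
  proof (rule induced_eigenvector_pf(2)[OF l ep, THEN iffD1], unfold normalised_eigenvector_def,
      intro conjI allI impI ballI)
    show y0: "y i = 0" if "i \<notin> legal_words \<theta> l" for i
    proof (cases "length i = l")
      case True
      then have "\<not> legal \<theta> (i @ [a])" for a
        using that l True legal_sublist[of "i @ [a]" i] by (cases "i = []") (auto simp: legal_words_def)
      then show ?thesis using freq_zero by (simp add: y_def)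
    qed (simp add: y_def)
    have sum_y: "(\<Sum>w\<in>legal_words \<theta> l. y w * g w) = (\<Sum>w | length w = l. y w * g w)" for g
      using y0 finite_words by (intro sum.mono_neutral_left) (auto simp: legal_words_def)
    show "(\<Sum>i\<in>legal_words \<theta> l. y i) = 1"
      using sum_y[of "\<lambda>_. 1"] freq_sum[of "Suc l"] sum_words_snoc[of freq l] by (simp add: y_def)
    fix u assume u: "u \<in> legal_words \<theta> l"
    then have lu: "length u = l" by (simp add: legal_words_def)
    define h where "h z = (if take l z = u then 1 else (0::real))" for z
    have "(\<Sum>w\<in>legal_words \<theta> l. induced_matrix P l u w * y w) = (\<Sum>w | length w = l. y w * induced_matrix P l u w)"
      using sum_y[of "\<lambda>w. induced_matrix P l u w"] by (simp add: mult.commute)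
    also have "\<dots> = (\<Sum>w | length w = l. \<Sum>a\<in>UNIV. freq (w @ [a]) * expct P (w @ [a]) (\<lambda>xs. \<Sum>z\<leftarrow>induced_word (Suc l) xs. h z))"
    proof (intro sum.cong refl)
      fix w :: "'a list" assume "w \<in> {w. length w = l}"
      then have w: "length w = l" by simp
      have "expct P (w @ [a]) (\<lambda>xs. \<Sum>z\<leftarrow>induced_word (Suc l) xs. h z) = induced_matrix P l u w" for a
        unfolding induced_matrix_expct expct_append
      proof (rule expct_cong)
        fix xs assume xs: "xs \<in> chs w"
        have len: "length xs = l" using length_listset[OF xs] w by simp
        have ne: "\<forall>x\<in>set xs. x \<noteq> []" using xs listset_nonempty_blocks chs_eq by blast
        have "(\<Sum>z\<leftarrow>induced_word (Suc l) (xs @ ys). h z) = real (count_list (induced_word l xs) u)" for ys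
        proof -
          have "map (take l) (induced_word (Suc l) (xs @ ys)) = induced_word l (xs @ ys)"
            using len l by (auto simp: induced_word_def take_take min_def)
          also have "\<dots> = induced_word l xs" using induced_word_append[OF ne _ l] len by simp
          finally have *: "induced_word l xs = map (take l) (induced_word (Suc l) (xs @ ys))" ..
          have "(\<Sum>z\<leftarrow>zs. h z) = real (count_list (map (take l) zs) u)" for zs
            by (induction zs) (auto simp: h_def)
          then show ?thesis unfolding * .
        qed
        then show "expct P [a] (\<lambda>ys. \<Sum>z\<leftarrow>induced_word (Suc l) (xs @ ys). h z) = real (count_list (induced_word l xs) u)"
          by (simp add: expct_const)
      qed
      then show "y w * induced_matrix P l u w = (\<Sum>a\<in>UNIV. freq (w @ [a]) * expct P (w @ [a]) (\<lambda>xs. \<Sum>z\<leftarrow>induced_word (Suc l) xs. h z))"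
        using w by (simp add: y_def sum_distrib_right)
    qed
    also have "\<dots> = (\<Sum>w | length w = Suc l. freq w * expct P w (\<lambda>xs. \<Sum>z\<leftarrow>induced_word (Suc l) xs. h z))"
      by (rule sum_words_snoc[symmetric])
    also have "\<dots> = c * (\<Sum>w | length w = Suc l. freq w * h w)"
      using freq_eigen[OF _ ep, of "Suc l" h] by simp
    also have "(\<Sum>w | length w = Suc l. freq w * h w) = (\<Sum>w | length w = l. if w = u then \<Sum>a\<in>UNIV. freq (w @ [a]) else 0)"
      unfolding sum_words_snoc by (intro sum.cong) (auto simp: h_def)
    also have "\<dots> = y u" using lu by (simp add: y_def finite_words)
    finally show "(\<Sum>w\<in>legal_words \<theta> l. induced_matrix P l u w * y w) = c * y u" .
  qed
  then have "y v = freq v" using freq_eq[of v l] l by (simp add: l_def)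
  then show ?thesis by (simp add: y_def l_def)
qed

text \<open>The difference \<open>d\<close> of the left marginal and \<open>freq\<close> satisfies \<open>c d = A d\<close> for a substochastic matrix
  \<open>A\<close>, hence vanishes because \<open>c > 1\<close>.\<close>

lemma freq_Cons: "(\<Sum>a\<in>UNIV. freq (a # v)) = freq v"
proof (cases "v = []")
  case True
  then show ?thesis using freq_sum[of 1] sum_words_snoc[of freq 0] by (simp add: freq_def)
next
  case False
  define l where "l = length v"
  have l: "l \<ge> 1" using False by (simp add: l_def Suc_le_eq)
  obtain L c where ep: "eigen_pair L c" using eigen_pair_exists by blast
  define y where "y v = (\<Sum>a\<in>UNIV. freq (a # v))" for v
  define d where "d v = y v - freq v" for v
  \<comment> \<open>Testing with the sign of \<open>d\<close> turns the sum of
    \<open>d v * h v\<close> into the \<open>l1\<close> norm of \<open>d\<close>.\<close>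
  define h where "h v = sgn (d v)" for v
  \<comment> \<open>The expected test value at the very beginning of an image. By
    \<open>sum_induced_word_tl\<close> it enters with a minus sign for \<open>butlast w\<close> and
    a plus sign for \<open>tl w\<close>, so that summation leaves exactly \<open>d\<close> against
    \<open>A\<close>.\<close>
  define A where "A w = expct P w (\<lambda>xs. h (take l (concat xs)))" for w
  have h1: "\<bar>h z\<bar> \<le> 1" for z by (simp add: h_def sgn_if)
  have A1: "\<bar>A w\<bar> \<le> 1" for w
  proof -
    have "A w \<le> expct P w (\<lambda>_. 1)" "expct P w (\<lambda>_. -1) \<le> A w"
      unfolding A_def using h1 by (intro expct_mono; simp add: abs_le_iff minus_le_iff)+
    then show ?thesis by (simp add: expct_const abs_le_iff)
  qed
  let ?B = "\<lambda>w. expct P w (\<lambda>xs. \<Sum>z\<leftarrow>induced_word l xs. h z)"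
  have "c * (\<Sum>v | length v = l. y v * h v) = c * (\<Sum>w | length w = Suc l. freq w * h (tl w))"
    unfolding sum_words_Cons by (simp add: y_def sum_distrib_right)
  also have "\<dots> = (\<Sum>w | length w = Suc l. freq w * expct P w (\<lambda>xs. \<Sum>z\<leftarrow>induced_word (Suc l) xs. h (tl z)))"
    using freq_eigen[OF _ ep, of "Suc l" "\<lambda>z. h (tl z)"] by simp
  also have "\<dots> = (\<Sum>w | length w = Suc l. freq w * (?B (butlast w) - A (butlast w) + A (tl w)))"
  proof (intro sum.cong refl arg_cong2[where f = "(*)"])
    fix w :: "'a list" assume "w \<in> {w. length w = Suc l}"
    then have w: "length w = Suc l" by simp
    have wl: "w = butlast w @ [last w]" "w = hd w # tl w" using w by (cases w; auto)+
    have "expct P w (\<lambda>xs. \<Sum>z\<leftarrow>induced_word (Suc l) xs. h (tl z)) =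
      expct P w (\<lambda>xs. ((\<Sum>z\<leftarrow>induced_word l xs. h z) + (- 1) * h (take l (concat xs))) + h (take l (concat (tl xs))))"
    proof (rule expct_cong)
      fix xs assume "xs \<in> chs w"
      then have "xs \<noteq> []" using length_listset w by fastforce
      then show "(\<Sum>z\<leftarrow>induced_word (Suc l) xs. h (tl z)) =
        ((\<Sum>z\<leftarrow>induced_word l xs. h z) + (- 1) * h (take l (concat xs))) + h (take l (concat (tl xs)))"
        by (simp add: sum_induced_word_tl)
    qed
    also have "\<dots> = expct P w (\<lambda>xs. \<Sum>z\<leftarrow>induced_word l xs. h z) - expct P w (\<lambda>xs. h (take l (concat xs)))
        + expct P w (\<lambda>xs. h (take l (concat (tl xs))))"
      unfolding expct_add expct_cmult by simp
    also have "expct P w (\<lambda>xs. h (take l (concat (tl xs)))) = A (tl w)"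
      by (subst wl(2)) (simp add: expct_Cons A_def set_P sum_pmf flip: sum_distrib_right)
    also have "expct P w (\<lambda>xs. \<Sum>z\<leftarrow>induced_word l xs. h z) = ?B (butlast w)"
    proof -
      have "induced_word l (xs @ ys) = induced_word l xs" if "xs \<in> chs (butlast w)" for xs ys
        using induced_word_append[OF listset_nonempty_blocks _ l, of xs "butlast w"] that length_listset[OF that] w
        by (simp add: chs_eq)
      then have "expct P (butlast w @ [last w]) (\<lambda>xs. \<Sum>z\<leftarrow>induced_word l xs. h z) = ?B (butlast w)"
        unfolding expct_append by (intro expct_cong) (simp add: expct_const)
      then show ?thesis using wl(1) by simp
    qed
    also have "expct P w (\<lambda>xs. h (take l (concat xs))) = A (butlast w)"
    proof -
      have "take l (concat (xs @ ys)) = take l (concat xs)" if "xs \<in> chs (butlast w)" for xs ys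
        using length_concat_ge[OF listset_nonempty_blocks, of xs "butlast w"] that length_listset[OF that] w
        by (simp add: chs_eq)
      then have "expct P (butlast w @ [last w]) (\<lambda>xs. h (take l (concat xs))) = A (butlast w)"
        unfolding expct_append A_def by (intro expct_cong) (simp add: expct_const del: concat_append)
      then show ?thesis using wl(1) by simp
    qed
    finally show "expct P w (\<lambda>xs. \<Sum>z\<leftarrow>induced_word (Suc l) xs. h (tl z)) = ?B (butlast w) - A (butlast w) + A (tl w)" .
  qed
  also have "\<dots> = (\<Sum>w | length w = Suc l. freq w * (?B (butlast w) - A (butlast w))) + (\<Sum>w | length w = Suc l. freq w * A (tl w))"
    by (simp add: distrib_left sum.distrib)
  also have "(\<Sum>w | length w = Suc l. freq w * (?B (butlast w) - A (butlast w))) = (\<Sum>w | length w = l. freq w * (?B w - A w))"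
    unfolding sum_words_snoc by (simp add: freq_snoc flip: sum_distrib_right)
  also have "(\<Sum>w | length w = Suc l. freq w * A (tl w)) = (\<Sum>w | length w = l. y w * A w)"
    unfolding sum_words_Cons by (simp add: y_def flip: sum_distrib_right)
  also have "(\<Sum>w | length w = l. freq w * (?B w - A w)) = c * (\<Sum>w | length w = l. freq w * h w) - (\<Sum>w | length w = l. freq w * A w)"
    using freq_eigen[OF l ep, of h] by (simp add: right_diff_distrib sum_subtractf)
  finally have "c * (\<Sum>v | length v = l. d v * h v) = (\<Sum>v | length v = l. d v * A v)"
    by (simp add: d_def left_diff_distrib sum_subtractf right_diff_distrib)
  also have "\<dots> \<le> (\<Sum>v | length v = l. \<bar>d v\<bar>)"
  proof (rule sum_mono)
    fix v
    have "\<bar>d v * A v\<bar> \<le> \<bar>d v\<bar> * 1" unfolding abs_mult using A1 by (intro mult_left_mono) auto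
    then show "d v * A v \<le> \<bar>d v\<bar>" by linarith
  qed
  also have "(\<Sum>v | length v = l. d v * h v) = (\<Sum>v | length v = l. \<bar>d v\<bar>)"
    by (simp add: h_def abs_sgn)
  finally have "(c - 1) * (\<Sum>v | length v = l. \<bar>d v\<bar>) \<le> 0" by (simp add: algebra_simps)
  then have "(\<Sum>v | length v = l. \<bar>d v\<bar>) \<le> 0" using ep by (simp add: mult_le_0_iff eigen_pair_def)
  moreover have "\<bar>d v\<bar> \<le> (\<Sum>v | length v = l. \<bar>d v\<bar>)"
    using finite_words by (intro member_le_sum) (auto simp: l_def)
  ultimately show ?thesis by (simp add: d_def y_def)
qed

end

section \<open>Measures on the subshift\<close>

lemma length_window [simp]: "length (window x k n) = n"
  by (simp add: window_def)

lemma nth_window [simp]: "j < n \<Longrightarrow> window x k n ! j = x (k + int j)"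
  by (simp add: window_def)

lemma window_eq_iff: "window x k n = v \<longleftrightarrow> length v = n \<and> (\<forall>j<n. x (k + int j) = v ! j)"
  by (auto simp: window_def list_eq_iff_nth_eq)

lemma window_left_shift: "window (left_shift x) k n = window x (k + 1) n"
  by (simp add: window_def left_shift_def algebra_simps)

lemma take_drop_window: "i + n \<le> m \<Longrightarrow> take n (drop i (window x k m)) = window x (k + int i) n"
  by (auto simp: list_eq_iff_nth_eq window_def algebra_simps)

context primitive_rs
begin

abbreviation "X \<equiv> rs_subshift \<theta>"
abbreviation "T \<equiv> rs_topology \<theta>"

definition cyl :: "int \<Rightarrow> 'a list \<Rightarrow> (int \<Rightarrow> 'a) set" where
  "cyl k v = {x \<in> X. window x k (length v) = v}"

text \<open>Symmetric windows are nested, so two such cylinders are disjoint or one contains the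
  other; with the empty set added, they form a countable intersection-stable generator.\<close>

definition central_cyls :: "(int \<Rightarrow> 'a) set set" where
  "central_cyls = insert {} {cyl (- int m) v | m v. length v = 2 * m + 1}"

lemma topspace_T: "topspace T = X"
  by (simp add: rs_topology_def)

lemma space_borel_T: "space (borel_on T) = X"
  by (simp add: borel_on_def topspace_T space_measure_of_conv)

lemma sets_borel_T: "sets (borel_on T) = sigma_sets X {U. openin T U}"
  unfolding borel_on_def topspace_T[symmetric]
  by (intro sets_measure_of) (auto dest: openin_subset)

lemma openin_cyl: "openin T (cyl k v)"
proof -
  have "openin (product_topology (\<lambda>_. discrete_topology UNIV) UNIV) {x. window x k (length v) = v}"
    unfolding openin_product_topology_alt
  proof safe
    fix x :: "int \<Rightarrow> 'a" assume x: "window x k (length v) = v"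
    define U where "U i = (if i \<in> (\<lambda>j. k + int j) ` {..<length v} then {x i} else UNIV)" for i
    have fin: "finite {i \<in> UNIV. U i \<noteq> topspace (discrete_topology UNIV)}"
      by (rule finite_subset[of _ "(\<lambda>j. k + int j) ` {..<length v}"]) (auto simp: U_def)
    have sub: "Pi\<^sub>E UNIV U \<subseteq> {x. window x k (length v) = v}"
    proof safe
      fix y assume y: "y \<in> Pi\<^sub>E UNIV U"
      have "y (k + int j) = x (k + int j)" if "j < length v" for j
      proof -
        have "y (k + int j) \<in> U (k + int j)" using y by blast
        moreover have "k + int j \<in> (\<lambda>j. k + int j) ` {..<length v}" using that by blast
        ultimately show ?thesis by (simp add: U_def)
      qed
      then show "window y k (length v) = v" using x by (simp add: window_eq_iff)
    qed
    show "\<exists>U. finite {i \<in> UNIV. U i \<noteq> topspace (discrete_topology UNIV)} \<and> (\<forall>i\<in>UNIV. openin (discrete_topology UNIV) (U i)) \<and>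
          x \<in> Pi\<^sub>E UNIV U \<and> Pi\<^sub>E UNIV U \<subseteq> {x. window x k (length v) = v}"
      using fin sub by (intro exI[of _ U]) (auto simp: U_def)
  qed
  then show ?thesis
    unfolding rs_topology_def openin_subtopology cyl_def by blast
qed

lemma cyl_measurable: "cyl k v \<in> sets (borel_on T)"
  unfolding sets_borel_T using openin_cyl by blast

lemma openin_contains_central_cyl:
  assumes "openin T U" "x \<in> U"
  shows "\<exists>m. cyl (- int m) (window x (- int m) (2 * m + 1)) \<subseteq> U"
proof -
  obtain V where V: "openin (product_topology (\<lambda>_. discrete_topology UNIV) UNIV) V" "U = V \<inter> X"
    using assms(1) unfolding rs_topology_def openin_subtopology by blast
  then obtain W where W: "finite {i. W i \<noteq> (UNIV :: 'a set)}" "x \<in> Pi\<^sub>E UNIV W" "Pi\<^sub>E UNIV W \<subseteq> V"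
    using assms(2) unfolding openin_product_topology_alt by force
  obtain m where m: "\<And>i. W i \<noteq> UNIV \<Longrightarrow> \<bar>i\<bar> \<le> int m"
  proof -
    have "finite ((\<lambda>i. nat \<bar>i\<bar>) ` {i. W i \<noteq> UNIV})" using W(1) by simp
    then obtain m where "\<forall>j\<in>(\<lambda>i. nat \<bar>i\<bar>) ` {i. W i \<noteq> UNIV}. j \<le> m" using finite_nat_set_iff_bounded_le by blast
    then show ?thesis using that[of m] by force
  qed
  have "y \<in> Pi\<^sub>E UNIV W" if "window y (- int m) (2 * m + 1) = window x (- int m) (2 * m + 1)" for y
  proof -
    have "y i \<in> W i" for i
    proof (cases "W i = UNIV")
      case False
      then have i: "\<bar>i\<bar> \<le> int m" using m by blast
      have "x (- int m + int j) = y (- int m + int j)" if "j < 2 * m + 1" for j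
        using arg_cong[OF \<open>window y _ _ = _\<close>, of "\<lambda>w. w ! j"] that by (simp del: One_nat_def add_Suc_right)
      moreover have "nat (i + int m) < 2 * m + 1" "- int m + int (nat (i + int m)) = i" using i by linarith+
      ultimately have "y i = x i" by metis
      then show ?thesis using W(2) by auto
    qed auto
    then show ?thesis by blast
  qed
  then have "y \<in> U" if "y \<in> cyl (- int m) (window x (- int m) (2 * m + 1))" for y
    using that W(3) V(2) unfolding cyl_def length_window by blast
  then show ?thesis by blast
qed

lemma countable_central_cyls: "countable central_cyls"
proof -
  have "central_cyls \<subseteq> insert {} ((\<lambda>(m, v). cyl (- int m) v) ` UNIV)"
    by (auto simp: central_cyls_def)
  then show ?thesis by (rule countable_subset) simp
qed

text \<open>Every open set is the union of the central cylinders it contains, and these are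
  countably many.\<close>

lemma sets_borel_T_central: "sets (borel_on T) = sigma_sets X central_cyls"
proof
  show "sigma_sets X central_cyls \<subseteq> sets (borel_on T)"
    unfolding sets_borel_T by (rule sigma_sets_mono') (auto simp: central_cyls_def openin_cyl)
  show "sets (borel_on T) \<subseteq> sigma_sets X central_cyls"
    unfolding sets_borel_T
  proof (rule sigma_sets_mono, safe)
    fix U assume U: "openin T U"
    have "U = \<Union>{C \<in> central_cyls. C \<subseteq> U}"
    proof safe
      fix x assume x: "x \<in> U"
      obtain m where m: "cyl (- int m) (window x (- int m) (2 * m + 1)) \<subseteq> U"
        using openin_contains_central_cyl[OF U x] by blast
      have "x \<in> X" using openin_subset[OF U] x topspace_T by auto
      then have "x \<in> cyl (- int m) (window x (- int m) (2 * m + 1))" by (simp add: cyl_def)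
      moreover have "cyl (- int m) (window x (- int m) (2 * m + 1)) \<in> central_cyls"
        unfolding central_cyls_def using length_window by blast
      ultimately show "x \<in> \<Union>{C \<in> central_cyls. C \<subseteq> U}" using m by blast
    qed auto
    moreover have "\<Union>{C \<in> central_cyls. C \<subseteq> U} \<in> sigma_sets X central_cyls"
      by (intro sigma_sets_UNION countable_subset[OF _ countable_central_cyls]) auto
    ultimately show "U \<in> sigma_sets X central_cyls" by simp
  qed
qed

lemma Int_stable_central_cyls: "Int_stable central_cyls"
proof -
  have aux: "cyl (- int m) v \<inter> cyl (- int n) w \<in> central_cyls"
    if "m \<le> n" "length v = 2 * m + 1" "length w = 2 * n + 1" for m n v w
  proof (cases "take (2 * m + 1) (drop (n - m) w) = v")
    case True
    have sub: "take (2 * m + 1) (drop (n - m) (window x (- int n) (2 * n + 1))) = window x (- int m) (2 * m + 1)"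
      for x :: "int \<Rightarrow> 'a"
      using that(1) by (subst take_drop_window) (auto simp: of_nat_diff)
    have "cyl (- int n) w \<subseteq> cyl (- int m) v"
    proof
      fix x assume "x \<in> cyl (- int n) w"
      then show "x \<in> cyl (- int m) v"
        using sub[of x] True unfolding cyl_def that(2,3) by simp
    qed
    then have "cyl (- int m) v \<inter> cyl (- int n) w = cyl (- int n) w" by blast
    then show ?thesis using that by (auto simp: central_cyls_def)
  next
    case False
    have sub: "take (2 * m + 1) (drop (n - m) (window x (- int n) (2 * n + 1))) = window x (- int m) (2 * m + 1)"
      for x :: "int \<Rightarrow> 'a"
      using that(1) by (subst take_drop_window) (auto simp: of_nat_diff)
    have "cyl (- int m) v \<inter> cyl (- int n) w = {}"
    proof safe
      fix x assume "x \<in> cyl (- int m) v" "x \<in> cyl (- int n) w"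
      then show "x \<in> {}"
        using sub[of x] False unfolding cyl_def that(2,3) by simp
    qed
    then show ?thesis by (simp add: central_cyls_def)
  qed
  show ?thesis
  proof (rule Int_stableI)
    fix a b assume ab: "a \<in> central_cyls" "b \<in> central_cyls"
    show "a \<inter> b \<in> central_cyls"
    proof (cases "a = {} \<or> b = {}")
      case True then show ?thesis by (auto simp: central_cyls_def)
    next
      case False
      then obtain m v n w where mv: "a = cyl (- int m) v" "length v = 2 * m + 1"
        and nw: "b = cyl (- int n) w" "length w = 2 * n + 1" using ab by (auto simp: central_cyls_def)
      show ?thesis
      proof (cases "m \<le> n")
        case True then show ?thesis using aux[OF True mv(2) nw(2)] mv nw by simp
      next
        case False then show ?thesis using aux[OF _ nw(2) mv(2)] mv nw by (simp add: Int_commute)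
      qed
    qed
  qed
qed

lemma measure_eqI_cyl:
  assumes "prob_space M" "prob_space N" "sets M = sets (borel_on T)" "sets N = sets (borel_on T)"
    and eq: "\<And>k v. v \<noteq> [] \<Longrightarrow> measure M (cyl k v) = measure N (cyl k v)"
  shows "M = N"
proof -
  interpret M: prob_space M by fact
  interpret N: prob_space N by fact
  show ?thesis
  proof (rule measure_eqI_generator_eq_countable[OF Int_stable_central_cyls, of X _ _ "(\<lambda>a. cyl 0 [a]) ` UNIV"])
    show "central_cyls \<subseteq> Pow X" by (auto simp: central_cyls_def cyl_def)
    show "sets M = sigma_sets X central_cyls" "sets N = sigma_sets X central_cyls"
      using assms sets_borel_T_central by auto
    fix C assume "C \<in> central_cyls"
    then consider "C = {}" | m v where "C = cyl (- int m) v" "length v = 2 * m + 1"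
      by (auto simp: central_cyls_def)
    then show "emeasure M C = emeasure N C"
    proof cases
      case 2
      then have "v \<noteq> []" by auto
      then show ?thesis using eq[of v "- int m"] 2 by (simp add: M.emeasure_eq_measure N.emeasure_eq_measure)
    qed simp
  next
    show "(\<lambda>a. cyl 0 [a]) ` UNIV \<subseteq> central_cyls"
    proof safe
      fix a show "cyl 0 [a] \<in> central_cyls"
        unfolding central_cyls_def by (intro insertI2 CollectI exI[of _ 0] exI[of _ "[a]"]) simp
    qed
    show "\<Union> ((\<lambda>a. cyl 0 [a]) ` UNIV) = X"
      by (auto simp: cyl_def window_def)
    show "emeasure M a \<noteq> \<infinity>" if "a \<in> (\<lambda>a. cyl 0 [a]) ` UNIV" for a by simp
  qed simp
qed

lemma left_shift_X: "x \<in> X \<Longrightarrow> left_shift x \<in> X"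
  by (auto simp: rs_subshift_def window_left_shift)

lemma left_shift_vimage_cyl: "left_shift -` cyl k v \<inter> X = cyl (k + 1) v"
proof -
  have "left_shift x \<in> X \<longleftrightarrow> x \<in> X" for x
  proof
    assume "left_shift x \<in> X"
    then have "legal \<theta> (window x (k + 1) n)" if "n \<ge> 1" for k n
      using that by (auto simp: rs_subshift_def window_left_shift)
    from this[of _ "k - 1" for k] show "x \<in> X" by (auto simp: rs_subshift_def)
  qed (rule left_shift_X)
  then show ?thesis by (auto simp: cyl_def window_left_shift)
qed

lemma measurable_left_shift:
  assumes "sets M = sets (borel_on T)"
  shows "left_shift \<in> measurable M M"
proof -
  have sp: "space M = X" using sets_eq_imp_space_eq[OF assms] space_borel_T by simp
  show ?thesis
  proof (rule measurable_sigma_sets[of M X central_cyls])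
    show "sets M = sigma_sets X central_cyls" using assms sets_borel_T_central by simp
    show "central_cyls \<subseteq> Pow X" by (auto simp: central_cyls_def cyl_def)
    show "left_shift \<in> space M \<rightarrow> X" using sp left_shift_X by auto
    fix C assume "C \<in> central_cyls"
    then show "left_shift -` C \<inter> space M \<in> sets M"
      unfolding sp assms by (auto simp: central_cyls_def left_shift_vimage_cyl cyl_measurable)
  qed
qed

lemma invariant_measure_cyl:
  assumes "invariant_prob T left_shift M"
  shows "measure M (cyl k v) = measure M (cyl 0 v)"
proof -
  have sets: "sets M = sets (borel_on T)" using assms by (simp add: invariant_prob_def)
  have sp: "space M = X" using sets_eq_imp_space_eq[OF sets] space_borel_T by simp
  have step: "measure M (cyl (k + 1) v) = measure M (cyl k v)" for k
  proof -
    have "emeasure M (left_shift -` cyl k v \<inter> space M) = emeasure M (cyl k v)"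
      using assms cyl_measurable[of k v] unfolding invariant_prob_def sets by blast
    then show ?thesis by (simp add: sp left_shift_vimage_cyl measure_def)
  qed
  show ?thesis
  proof (induction k rule: int_induct[of _ 0])
    case (step2 i) then show ?case using step[of "i - 1"] by simp
  qed (simp_all add: step)
qed

lemma invariant_probI:
  assumes "prob_space M" "sets M = sets (borel_on T)"
    and eq: "\<And>k v. v \<noteq> [] \<Longrightarrow> measure M (cyl (k + 1) v) = measure M (cyl k v)"
  shows "invariant_prob T left_shift M"
proof -
  have sp: "space M = X" using sets_eq_imp_space_eq[OF assms(2)] space_borel_T by simp
  interpret M: prob_space M by fact
  have ms: "left_shift \<in> measurable M M" using measurable_left_shift assms(2) .
  have "distr M M left_shift = M"
  proof (rule measure_eqI_cyl)
    fix k v assume "v \<noteq> ([] :: 'a list)"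
    then show "measure (distr M M left_shift) (cyl k v) = measure M (cyl k v)"
      using eq[of v k] cyl_measurable[of k v] assms(2) ms
      by (simp add: measure_distr sp left_shift_vimage_cyl)
  qed (use assms ms in \<open>auto intro: M.prob_space_distr\<close>)
  then have "emeasure M (left_shift -` B \<inter> space M) = emeasure M B" if "B \<in> sets M" for B
    using emeasure_distr[OF ms that] by simp
  then show ?thesis using assms by (simp add: invariant_prob_def)
qed

end

section \<open>The invariant measure of a random substitution\<close>

lemma distr_pmf_cong:
  assumes "\<And>w. w \<in> set_pmf p \<Longrightarrow> f w = g w" "\<And>w. f w \<in> space N" "\<And>w. g w \<in> space N"
  shows "distr (measure_pmf p) N f = distr (measure_pmf p) N g"
  using assms by (intro distr_cong_AE) (auto simp: AE_measure_pmf_iff)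

context random_rs
begin

section \<open>Finite-dimensional distributions and their consistency\<close>

definition word_pmf :: "nat \<Rightarrow> 'a list pmf" where
  "word_pmf n = embed_pmf (\<lambda>w. if length w = n then freq w else 0)"

lemma pmf_word_pmf: "pmf (word_pmf n) w = (if length w = n then freq w else 0)"
  unfolding word_pmf_def
proof (rule pmf_embed_pmf)
  show "0 \<le> (if length w = n then freq w else 0)" for w by (simp add: freq_nonneg)
  have "(\<integral>\<^sup>+ w. ennreal (if length w = n then freq w else 0) \<partial>count_space UNIV) =
    (\<Sum>w | length w = n. ennreal (if length w = n then freq w else 0))"
    by (rule nn_integral_count_space') (auto simp: finite_words)
  also have "\<dots> = ennreal (\<Sum>w | length w = n. freq w)"
    by (simp add: sum_ennreal freq_nonneg)
  finally show "(\<integral>\<^sup>+ w. ennreal (if length w = n then freq w else 0) \<partial>count_space UNIV) = 1"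
    by (simp add: freq_sum)
qed

lemma set_word_pmf: "w \<in> set_pmf (word_pmf n) \<Longrightarrow> length w = n"
  by (auto simp: set_pmf_iff pmf_word_pmf split: if_splits)

lemma map_butlast_word_pmf: "map_pmf butlast (word_pmf (Suc n)) = word_pmf n"
proof (rule pmf_eqI)
  fix v :: "'a list"
  have fin: "finite (butlast -` {v})"
  proof (rule finite_subset)
    show "butlast -` {v} \<subseteq> insert [] {w. length w = Suc (length v)}" by auto
  qed (simp add: finite_words)
  have "pmf (map_pmf butlast (word_pmf (Suc n))) v = (\<Sum>w\<in>butlast -` {v}. pmf (word_pmf (Suc n)) w)"
    by (simp add: pmf_map measure_measure_pmf_finite[OF fin])
  also have "\<dots> = (\<Sum>w | length w = Suc n. if butlast w = v then freq w else 0)"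
    using fin by (intro sum.mono_neutral_cong) (auto simp: finite_words pmf_word_pmf)
  also have "\<dots> = (\<Sum>u | length u = n. if u = v then \<Sum>a\<in>UNIV. freq (u @ [a]) else 0)"
    unfolding sum_words_snoc by (intro sum.cong) auto
  also have "\<dots> = pmf (word_pmf n) v"
    by (simp add: finite_words pmf_word_pmf freq_snoc)
  finally show "pmf (map_pmf butlast (word_pmf (Suc n))) v = pmf (word_pmf n) v" .
qed

lemma map_tl_word_pmf: "map_pmf tl (word_pmf (Suc n)) = word_pmf n"
proof (rule pmf_eqI)
  fix v :: "'a list"
  have fin: "finite (tl -` {v})"
  proof (rule finite_subset)
    show "tl -` {v} \<subseteq> insert [] {w. length w = Suc (length v)}" by auto
  qed (simp add: finite_words)
  have "pmf (map_pmf tl (word_pmf (Suc n))) v = (\<Sum>w\<in>tl -` {v}. pmf (word_pmf (Suc n)) w)"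
    by (simp add: pmf_map measure_measure_pmf_finite[OF fin])
  also have "\<dots> = (\<Sum>w | length w = Suc n. if tl w = v then freq w else 0)"
    using fin by (intro sum.mono_neutral_cong) (auto simp: finite_words pmf_word_pmf)
  also have "\<dots> = (\<Sum>u | length u = n. if u = v then \<Sum>a\<in>UNIV. freq (a # u) else 0)"
    unfolding sum_words_Cons by (intro sum.cong) auto
  also have "\<dots> = pmf (word_pmf n) v"
    by (simp add: finite_words pmf_word_pmf freq_Cons)
  finally show "pmf (map_pmf tl (word_pmf (Suc n))) v = pmf (word_pmf n) v" .
qed

text \<open>The type \<open>discrete\<close> makes the alphabet a Polish space, as the extension
  theorem requires of the coordinates. The word is laid out from position \<open>a\<close> on and
  restricted to \<open>J\<close>.\<close>

definition place :: "int \<Rightarrow> int set \<Rightarrow> 'a list \<Rightarrow> int \<Rightarrow> 'a discrete" where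
  "place a J w = (\<lambda>i\<in>J. discrete (w ! nat (i - a)))"

definition fdd :: "int \<Rightarrow> nat \<Rightarrow> int set \<Rightarrow> (int \<Rightarrow> 'a discrete) measure" where
  "fdd a n J = distr (measure_pmf (word_pmf n)) (PiM J (\<lambda>_. borel)) (place a J)"

lemma place_space: "place a J w \<in> space (PiM J (\<lambda>_. borel))"
  by (simp add: place_def space_PiM)

lemma fdd_extend_right:
  assumes "J \<subseteq> {a..<a + int n}"
  shows "fdd a (n + d) J = fdd a n J"
proof (induction d)
  case (Suc d)
  have "fdd a (n + d) J = distr (measure_pmf (word_pmf (Suc (n + d)))) (PiM J (\<lambda>_. borel)) (place a J \<circ> butlast)"
    unfolding fdd_def map_butlast_word_pmf[of "n + d", symmetric] map_pmf_rep_eq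
    by (subst distr_distr) (auto simp: place_space)
  also have "\<dots> = fdd a (n + Suc d) J"
    unfolding fdd_def add_Suc_right
  proof (rule distr_pmf_cong)
    fix w :: "'a list" assume "w \<in> set_pmf (word_pmf (Suc (n + d)))"
    then have "length w = Suc (n + d)" by (rule set_word_pmf)
    then show "(place a J \<circ> butlast) w = place a J w"
      using assms by (auto simp: place_def fun_eq_iff restrict_def nth_butlast subset_iff)
  qed (simp_all add: place_space)
  finally show ?case using Suc by simp
qed simp

lemma fdd_extend_left:
  assumes "J \<subseteq> {a..<a + int n}"
  shows "fdd (a - int d) (n + d) J = fdd a n J"
proof (induction d)
  case (Suc d)
  have "fdd (a - int d) (n + d) J = distr (measure_pmf (word_pmf (Suc (n + d)))) (PiM J (\<lambda>_. borel)) (place (a - int d) J \<circ> tl)"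
    unfolding fdd_def map_tl_word_pmf[of "n + d", symmetric] map_pmf_rep_eq
    by (subst distr_distr) (auto simp: place_space)
  also have "\<dots> = fdd (a - int (Suc d)) (n + Suc d) J"
    unfolding fdd_def add_Suc_right
  proof (rule distr_pmf_cong)
    fix w :: "'a list" assume "w \<in> set_pmf (word_pmf (Suc (n + d)))"
    then have w: "length w = Suc (n + d)" by (rule set_word_pmf)
    have "tl w ! nat (i - (a - int d)) = w ! nat (i - (a - int (Suc d)))" if "i \<in> J" for i
    proof -
      have i: "a \<le> i" "i < a + int n" using that assms by auto
      then have "nat (i - (a - int (Suc d))) = Suc (nat (i - (a - int d)))" by simp
      then show ?thesis using w i by (simp add: nth_tl)
    qed
    then show "(place (a - int d) J \<circ> tl) w = place (a - int (Suc d)) J w"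
      by (auto simp: place_def fun_eq_iff restrict_def)
  qed (simp_all add: place_space)
  finally show ?case using Suc by simp
qed simp

text \<open>Enlarging the interval to the right uses \<open>freq_snoc\<close>, to the left
  \<open>freq_Cons\<close>. The distribution on \<open>J\<close> is thus independent of the interval
  from which it is computed.\<close>

lemma fdd_extend:
  assumes "J \<subseteq> {b..<b + int m}" "a \<le> b" "b + int m \<le> a + int n"
  shows "fdd a n J = fdd b m J"
proof -
  define d where "d = nat (b - a)"
  define e where "e = nat (a + int n - (b + int m))"
  have a: "a = b - int d" and n: "n = (m + d) + e" using assms by (simp_all add: d_def e_def)
  have "fdd a n J = fdd a (m + d) J"
    unfolding n using assms by (intro fdd_extend_right) (auto simp: a)
  also have "\<dots> = fdd b m J" unfolding a by (rule fdd_extend_left[OF assms(1)])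
  finally show ?thesis .
qed

definition radius :: "int set \<Rightarrow> nat" where
  "radius J = Max (insert 0 ((\<lambda>i. nat \<bar>i\<bar>) ` J))"

text \<open>A canonical interval containing \<open>J\<close> is fixed here; by consistency any other
  gives the same measure.\<close>

definition marg :: "int set \<Rightarrow> (int \<Rightarrow> 'a discrete) measure" where
  "marg J = fdd (- int (radius J)) (2 * radius J + 1) J"

lemma radius_bound: "finite J \<Longrightarrow> i \<in> J \<Longrightarrow> \<bar>i\<bar> \<le> int (radius J)"
proof -
  assume "finite J" "i \<in> J"
  then have "nat \<bar>i\<bar> \<le> radius J" unfolding radius_def by (intro Max_ge) auto
  then show ?thesis by simp
qed

lemma subset_radius: "finite J \<Longrightarrow> J \<subseteq> {- int (radius J)..<- int (radius J) + int (2 * radius J + 1)}"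
  using radius_bound by (force simp: abs_le_iff)

lemma marg_eq_fdd:
  assumes "finite J" "J \<subseteq> {b..<b + int m}"
  shows "marg J = fdd b m J"
proof -
  define a where "a = min b (- int (radius J))"
  define n where "n = nat (max (b + int m) (int (radius J) + 1) - a)"
  have "a + int n = max (b + int m) (int (radius J) + 1)" by (auto simp: n_def a_def)
  then have "fdd a n J = fdd b m J" "fdd a n J = marg J"
    unfolding marg_def using assms subset_radius[OF assms(1)]
    by (intro fdd_extend; auto simp: a_def)+
  then show ?thesis by simp
qed

text \<open>Kolmogorov's extension theorem: \<open>lim.lim\<close> is the resulting probability
  measure on all bi-infinite sequences.\<close>

sublocale lim: polish_projective UNIV marg
proof (intro polish_projective.intro projective_family.intro, goal_cases)
  case (1 J H)
  then have JH: "J \<subseteq> H" "finite H" by simp_all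
  then have "finite J" using finite_subset by blast
  let ?a = "- int (radius H)" and ?n = "2 * radius H + 1"
  have "distr (marg H) (PiM J (\<lambda>_. borel)) (\<lambda>f. restrict f J) =
    distr (measure_pmf (word_pmf ?n)) (PiM J (\<lambda>_. borel)) ((\<lambda>f. restrict f J) \<circ> place ?a H)"
    unfolding marg_def fdd_def
    by (rule distr_distr) (use JH place_space in \<open>auto intro: measurable_restrict_subset\<close>)
  also have "(\<lambda>f. restrict f J) \<circ> place ?a H = place ?a J"
    using JH by (auto simp: place_def fun_eq_iff restrict_def)
  also have "distr (measure_pmf (word_pmf ?n)) (PiM J (\<lambda>_. borel)) (place ?a J) = marg J"
    using marg_eq_fdd[OF \<open>finite J\<close>, of ?a ?n] subset_radius[OF JH(2)] JH(1) by (auto simp: fdd_def)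
  finally show ?case by (rule sym)
next
  case (2 J)
  show ?case unfolding marg_def fdd_def
    by (rule measure_pmf.prob_space_distr) (simp add: place_space)
qed

section \<open>Transfer of the limit measure to the subshift\<close>

definition letters :: "(int \<Rightarrow> 'a discrete) \<Rightarrow> int \<Rightarrow> 'a" where
  "letters \<omega> = (\<lambda>i. of_discrete (\<omega> i))"

lemma window_event_eq_emb:
  "{\<omega>. window (letters \<omega>) k (length v) = v} =
     lim.emb UNIV {k..<k + int (length v)} {place k {k..<k + int (length v)} v}"
proof -
  have "window (letters \<omega>) k (length v) = v \<longleftrightarrow>
      restrict \<omega> {k..<k + int (length v)} = place k {k..<k + int (length v)} v" for \<omega>
  proof -
    have "window (letters \<omega>) k (length v) = v \<longleftrightarrow> (\<forall>j<length v. \<omega> (k + int j) = discrete (v ! j))"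
      by (auto simp: window_eq_iff letters_def discrete_inverse of_discrete_inverse)
        (metis of_discrete_inverse)
    also have "\<dots> \<longleftrightarrow> (\<forall>i\<in>{k..<k + int (length v)}. \<omega> i = discrete (v ! nat (i - k)))"
    proof safe
      fix i assume "\<forall>j<length v. \<omega> (k + int j) = discrete (v ! j)" "i \<in> {k..<k + int (length v)}"
      then show "\<omega> i = discrete (v ! nat (i - k))"
        by (auto dest!: spec[of _ "nat (i - k)"])
    next
      fix j assume "\<forall>i\<in>{k..<k + int (length v)}. \<omega> i = discrete (v ! nat (i - k))" "j < length v"
      then show "\<omega> (k + int j) = discrete (v ! j)"
        by (auto dest!: bspec[of _ _ "k + int j"])
    qed
    also have "\<dots> \<longleftrightarrow> restrict \<omega> {k..<k + int (length v)} = place k {k..<k + int (length v)} v"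
      by (force simp: place_def restrict_def fun_eq_iff)
    finally show ?thesis .
  qed
  then show ?thesis by (auto simp: prod_emb_def)
qed

lemma singleton_sets_PiM_discrete:
  "finite J \<Longrightarrow> {place a J v} \<in> sets (PiM J (\<lambda>_. borel :: 'a discrete measure))"
proof -
  assume "finite J"
  then have "(\<Pi>\<^sub>E i\<in>J. {place a J v i}) \<in> sets (PiM J (\<lambda>_. borel :: 'a discrete measure))"
    by (intro sets_PiM_I_finite) (auto simp: borel_open open_discrete)
  moreover have "(\<Pi>\<^sub>E i\<in>J. {place a J v i}) = {place a J v}"
    by (rule PiE_singleton) (auto simp: place_def extensional_def)
  ultimately show ?thesis by simp
qed

lemma window_event:
  shows window_event_sets: "{\<omega>. window (letters \<omega>) k (length v) = v} \<in> sets lim.lim"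
    and window_event_measure: "measure lim.lim {\<omega>. window (letters \<omega>) k (length v) = v} = freq v"
proof -
  let ?J = "{k..<k + int (length v)}"
  show "{\<omega>. window (letters \<omega>) k (length v) = v} \<in> sets lim.lim"
    unfolding window_event_eq_emb by (auto intro!: measurable_prod_emb singleton_sets_PiM_discrete)
  have "measure lim.lim {\<omega>. window (letters \<omega>) k (length v) = v} = measure (marg ?J) {place k ?J v}"
    unfolding window_event_eq_emb by (rule lim.measure_lim_emb) (auto intro!: singleton_sets_PiM_discrete)
  also have "\<dots> = measure (fdd k (length v) ?J) {place k ?J v}"
    by (subst marg_eq_fdd) auto
  also have "\<dots> = measure (measure_pmf (word_pmf (length v))) (place k ?J -` {place k ?J v})"
    unfolding fdd_def by (subst measure_distr) (auto simp: place_space singleton_sets_PiM_discrete)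
  also have "\<dots> = measure (measure_pmf (word_pmf (length v))) {v}"
  proof (rule measure_pmf.finite_measure_eq_AE)
    show "AE w in measure_pmf (word_pmf (length v)). (w \<in> place k ?J -` {place k ?J v}) = (w \<in> {v})"
    proof (subst AE_measure_pmf_iff, rule ballI)
      fix w assume "w \<in> set_pmf (word_pmf (length v))"
      then have w: "length w = length v" by (rule set_word_pmf)
      have "w = v" if "place k ?J w = place k ?J v"
      proof (rule nth_equalityI[OF w])
        fix i assume "i < length w"
        then have "discrete (w ! i) = discrete (v ! i)"
          using fun_cong[OF that, of "k + int i"] w by (simp add: place_def)
        then show "w ! i = v ! i" by (simp add: discrete_inject)
      qed
      then show "(w \<in> place k ?J -` {place k ?J v}) = (w \<in> {v})" by auto
    qed
  qed auto
  also have "\<dots> = freq v" by (simp add: measure_pmf_single pmf_word_pmf)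
  finally show "measure lim.lim {\<omega>. window (letters \<omega>) k (length v) = v} = freq v" .
qed

text \<open>Leaving the subshift means showing an illegal word somewhere: countably many events,
  each of measure zero.\<close>

lemma AE_letters: "AE \<omega> in lim.lim. letters \<omega> \<in> X"
proof -
  have "AE \<omega> in lim.lim. window (letters \<omega>) k (length v) \<noteq> v" if "v \<noteq> []" "\<not> legal \<theta> v" for k v
  proof (rule AE_I'[of "{\<omega>. window (letters \<omega>) k (length v) = v}"])
    show "{\<omega>. window (letters \<omega>) k (length v) = v} \<in> null_sets lim.lim"
      using window_event[of k v] freq_zero[OF that]
      by (simp add: null_sets_def lim.P.emeasure_eq_measure)
  qed auto
  then have "AE \<omega> in lim.lim. \<forall>k. \<forall>v. v \<noteq> [] \<longrightarrow> \<not> legal \<theta> v \<longrightarrow> window (letters \<omega>) k (length v) \<noteq> v"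
    by (simp add: AE_all_countable)
  then show ?thesis
  proof (rule AE_mp, intro AE_I2 impI)
    fix \<omega> assume *: "\<forall>k. \<forall>v. v \<noteq> [] \<longrightarrow> \<not> legal \<theta> v \<longrightarrow> window (letters \<omega>) k (length v) \<noteq> v"
    show "letters \<omega> \<in> X" unfolding rs_subshift_def
    proof safe
      fix k and n :: nat assume "1 \<le> n"
      moreover have "length (window (letters \<omega>) k n) = n" by simp
      ultimately have "window (letters \<omega>) k n \<noteq> []" by (metis list.size(3) not_one_le_zero)
      then show "legal \<theta> (window (letters \<omega>) k n)" using * length_window by metis
    qed
  qed
qed

text \<open>The limit measure is pushed forward to the subshift. Invariance comes for free, since
  the values on cylinders do not depend on the position.\<close>

lemma freq_measure_exists:
  "\<exists>M. invariant_prob T left_shift M \<and> (\<forall>k v. v \<noteq> [] \<longrightarrow> measure M (cyl k v) = freq v)"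
proof -
  obtain x0 where x0: "x0 \<in> X" using subshift_ne by blast
  define Y where "Y = {\<omega>. letters \<omega> \<in> X}"
  \<comment> \<open>The default \<open>x0\<close> on the null set of sequences outside the subshift
    makes the map total into \<open>X\<close> without changing any cylinder probability.\<close>
  define g where "g \<omega> = (if \<omega> \<in> Y then letters \<omega> else x0)" for \<omega>
  have space: "space lim.lim = UNIV" by (auto simp: space_PiM)
  have "Y = UNIV - (\<Union>(k, v)\<in>UNIV \<times> {v. v \<noteq> [] \<and> \<not> legal \<theta> v}. {\<omega>. window (letters \<omega>) k (length v) = v})"
  proof safe
    fix \<omega> k v assume "\<omega> \<in> Y" "v \<noteq> []" "\<not> legal \<theta> v" "window (letters \<omega>) k (length v) = v"
    then show False by (auto simp: Y_def rs_subshift_def Suc_le_eq dest!: spec[of _ k] spec[of _ "length v"])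
  next
    fix \<omega> assume *: "\<omega> \<notin> (\<Union>(k, v)\<in>UNIV \<times> {v. v \<noteq> [] \<and> \<not> legal \<theta> v}. {\<omega>. window (letters \<omega>) k (length v) = v})"
    have "legal \<theta> (window (letters \<omega>) k n)" if "n \<ge> 1" for k n
    proof (rule ccontr)
      assume "\<not> legal \<theta> (window (letters \<omega>) k n)"
      moreover have "window (letters \<omega>) k n \<noteq> []" using that length_window[of "letters \<omega>" k n] by fastforce
      ultimately show False using * by force
    qed
    then show "\<omega> \<in> Y" by (auto simp: Y_def rs_subshift_def)
  qed auto
  moreover have "\<dots> \<in> sets lim.lim"
  proof (rule sets.Diff)
    show "UNIV \<in> sets lim.lim" using sets.top[of lim.lim] unfolding space .
    show "(\<Union>(k, v)\<in>UNIV \<times> {v. v \<noteq> [] \<and> \<not> legal \<theta> v}. {\<omega>. window (letters \<omega>) k (length v) = v}) \<in> sets lim.lim"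
      by (rule sets.countable_UN') (use window_event_sets in auto)
  qed
  ultimately have Y: "Y \<in> sets lim.lim" by simp
  have gX: "g \<omega> \<in> X" for \<omega> using x0 by (auto simp: g_def Y_def)
  have g_meas: "g \<in> measurable lim.lim (borel_on T)"
  proof (rule measurable_sigma_sets[OF sets_borel_T_central])
    show "central_cyls \<subseteq> Pow X" by (auto simp: central_cyls_def cyl_def)
    show "g \<in> space lim.lim \<rightarrow> X" using gX by auto
    fix C assume "C \<in> central_cyls"
    then consider "C = {}" | m v where "C = cyl (- int m) v" by (auto simp: central_cyls_def)
    then show "g -` C \<inter> space lim.lim \<in> sets lim.lim"
    proof cases
      case 2
      have "g -` C \<inter> space lim.lim = (Y \<inter> {\<omega>. window (letters \<omega>) (- int m) (length v) = v}) \<union> (if x0 \<in> C then space lim.lim - Y else {})"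
        using x0 by (auto simp: g_def 2 cyl_def Y_def space_PiM)
      then show ?thesis using Y window_event_sets by auto
    qed simp
  qed
  define M where "M = distr lim.lim (borel_on T) g"
  have pM: "prob_space M" unfolding M_def by (rule lim.P.prob_space_distr[OF g_meas])
  have M_cyl: "measure M (cyl k v) = freq v" for k v
  proof -
    have "measure M (cyl k v) = measure lim.lim (g -` cyl k v \<inter> space lim.lim)"
      unfolding M_def by (rule measure_distr[OF g_meas cyl_measurable])
    also have "\<dots> = measure lim.lim {\<omega>. window (letters \<omega>) k (length v) = v}"
    proof (rule lim.P.finite_measure_eq_AE)
      show "AE \<omega> in lim.lim. (\<omega> \<in> g -` cyl k v \<inter> space lim.lim) = (\<omega> \<in> {\<omega>. window (letters \<omega>) k (length v) = v})"
        using AE_letters by (rule AE_mp) (auto simp: g_def Y_def cyl_def space)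
      show "g -` cyl k v \<inter> space lim.lim \<in> sets lim.lim" using measurable_sets[OF g_meas cyl_measurable] .
    qed (rule window_event_sets)
    also have "\<dots> = freq v" by (rule window_event_measure)
    finally show ?thesis .
  qed
  have "invariant_prob T left_shift M"
    by (rule invariant_probI[OF pM]) (simp_all add: M_cyl, simp add: M_def)
  then show ?thesis using M_cyl by blast
qed

end

theorem uniquely_ergodic_imp_independent:
  assumes "primitive_rs \<theta>" "uniquely_ergodic (rs_topology \<theta>) left_shift"
  shows "eigenvectors_independent_of_probabilities \<theta>"
  unfolding eigenvectors_independent_of_probabilities_def
proof (intro allI impI)
  fix l :: nat and P P' :: "'a::finite \<Rightarrow> 'a list pmf"
  assume l: "l \<ge> 1" and "random_substitution \<theta> P \<and> nondegenerate \<theta> P \<and>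
    random_substitution \<theta> P' \<and> nondegenerate \<theta> P'"
  then have "random_rs \<theta> P" "random_rs \<theta> P'"
    using assms(1) unfolding random_rs_def random_rs_axioms_def
    by (auto simp: random_substitution_def nondegenerate_def set_pmf_iff)
  then interpret A: random_rs \<theta> P + B: random_rs \<theta> P' by blast+
  obtain M where M: "invariant_prob (rs_topology \<theta>) left_shift M" "\<And>k v. v \<noteq> [] \<Longrightarrow> measure M (A.cyl k v) = A.freq v"
    using A.freq_measure_exists by blast
  obtain M' where M': "invariant_prob (rs_topology \<theta>) left_shift M'" "\<And>k v. v \<noteq> [] \<Longrightarrow> measure M' (A.cyl k v) = B.freq v"
    using B.freq_measure_exists by blast
  have "M = M'" using assms(2) M(1) M'(1) unfolding uniquely_ergodic_def by blast
  then have eq: "A.freq v = B.freq v" if "v \<noteq> []" for v using M(2)[OF that] M'(2)[OF that] by metis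
  obtain L c where A: "A.eigen_pair L c" using A.eigen_pair_exists by blast
  obtain L' c' where B: "B.eigen_pair L' c'" using B.eigen_pair_exists by blast
  show "induced_eigenvector \<theta> P l = induced_eigenvector \<theta> P' l"
  proof
    fix v
    show "induced_eigenvector \<theta> P l v = induced_eigenvector \<theta> P' l v"
    proof (cases "v \<in> legal_words \<theta> l")
      case True
      then have "length v = l" "v \<noteq> []" using l by (auto simp: legal_words_def)
      then show ?thesis using eq[of v] A.freq_eq[of v l] B.freq_eq[of v l] l by simp
    next
      case False
      then show ?thesis using A.induced_eigenvector_normalised(1)[OF l A] B.induced_eigenvector_normalised(1)[OF l B] by simp
    qed
  qed
qed

section \<open>Deterministic choices\<close>

lemma concat_map_concat: "concat (map f (concat (map g w))) = concat (map (\<lambda>a. concat (map f (g a))) w)"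
  by (induction w) auto

text \<open>Inducing is multiplicative for deterministic maps: the windows of the composed image,
  grouped by the block of \<open>f\<close> in which they start, are the images of the windows of the
  inner word.\<close>

lemma induced_word_comp:
  assumes "\<And>a. g a \<noteq> []" "\<And>a. f a \<noteq> []" "length w = n" "n \<ge> 1"
  shows "concat (map (\<lambda>v. induced_word n (map f v)) (induced_word n (map g w))) =
    induced_word n (map (\<lambda>a. concat (map f (g a))) w)"
proof -
  obtain a v where w: "w = a # v" using assms by (cases w) auto
  define Y where "Y = concat (map g w)"
  have "length (concat (map g v)) \<ge> length v"
    using length_concat_ge[of "map g v"] assms(1) by simp
  then have "concat (map (\<lambda>r. induced_word n (take n (drop r (map f Y)))) [0..<length (g a)]) =
     map (\<lambda>s. take n (drop s (concat (map f Y)))) [0..<length (concat (take (length (g a)) (map f Y)))]"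
    using assms(3,4) w assms(2)[THEN not_sym] by (intro concat_induced_word) (auto simp: Y_def)
  moreover have "concat (map f Y) = concat (map (\<lambda>a. concat (map f (g a))) w)"
    unfolding Y_def by (rule concat_map_concat)
  moreover have "take (length (g a)) (map f Y) = map f (g a)" by (simp add: Y_def w take_map)
  moreover have "induced_word n (map (\<lambda>a. concat (map f (g a))) w) =
      map (\<lambda>s. take n (drop s (concat (map (\<lambda>a. concat (map f (g a))) w)))) [0..<length (concat (map f (g a)))]"
    by (simp add: induced_word_def w)
  moreover have "map (\<lambda>v. induced_word n (map f v)) (induced_word n (map g w)) =
      map (\<lambda>r. induced_word n (take n (drop r (map f Y)))) [0..<length (g a)]"
  proof -
    have "induced_word n (map g w) = map (\<lambda>r. take n (drop r Y)) [0..<length (g a)]"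
      by (simp add: induced_word_def Y_def w)
    then show ?thesis by (simp add: comp_def take_map drop_map)
  qed
  ultimately show ?thesis by simp
qed

primrec iter_subst :: "('a \<Rightarrow> 'a list) \<Rightarrow> nat \<Rightarrow> 'a \<Rightarrow> 'a list" where
  "iter_subst f 0 a = [a]"
| "iter_subst f (Suc k) a = concat (map f (iter_subst f k a))"

lemma iter_subst_ne: "(\<And>a. f a \<noteq> []) \<Longrightarrow> iter_subst f k a \<noteq> []"
proof (induction k)
  case (Suc k)
  then show ?case by (cases "iter_subst f k a") auto
qed simp

text \<open>A perturbation of the Dirac mass at \<open>f a\<close>: of full support for
  \<open>0 < e < 1\<close>, hence non-degenerate, and degenerating as \<open>e\<close> tends to
  \<open>0\<close>.\<close>

definition mix_pmf :: "('a \<Rightarrow> 'a list) \<Rightarrow> ('a \<Rightarrow> 'a list pmf) \<Rightarrow> real \<Rightarrow> 'a \<Rightarrow> 'a list pmf" where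
  "mix_pmf f P e a = bind_pmf (bernoulli_pmf e) (\<lambda>b. if b then P a else return_pmf (f a))"

lemma pmf_mix_pmf:
  "0 \<le> e \<Longrightarrow> e \<le> 1 \<Longrightarrow> pmf (mix_pmf f P e a) x = e * pmf (P a) x + (1 - e) * (if x = f a then 1 else 0)"
  by (auto simp: mix_pmf_def pmf_bind)

lemma set_mix_pmf:
  "0 < e \<Longrightarrow> e < 1 \<Longrightarrow> f a \<in> set_pmf (P a) \<Longrightarrow> set_pmf (mix_pmf f P e a) = set_pmf (P a)"
  by (auto simp: mix_pmf_def set_pmf_bernoulli split: if_splits)

lemma (in finite_choices) expct_mix_tendsto:
  assumes f: "\<And>a. f a \<in> set_pmf (P a)"
    and e: "\<And>k. 0 < e k" "\<And>k. e k < 1" "e \<longlonglongrightarrow> 0"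
  shows "(\<lambda>k. expct (mix_pmf f P (e k)) w g) \<longlonglongrightarrow> g (map f w)"
proof (induction w arbitrary: g)
  case Nil
  then show ?case by (simp add: expct_def)
next
  case (Cons a w)
  have fc: "finite_choices (mix_pmf f P (e k))" for k
    by unfold_locales (simp add: set_mix_pmf e f finite_P)
  have "(\<lambda>k. \<Sum>x\<in>set_pmf (P a). (e k * pmf (P a) x + (1 - e k) * (if x = f a then 1 else 0)) *
      expct (mix_pmf f P (e k)) w (\<lambda>ys. g (x # ys)))
    \<longlonglongrightarrow> (\<Sum>x\<in>set_pmf (P a). (0 * pmf (P a) x + (1 - 0) * (if x = f a then 1 else 0)) * g (x # map f w))"
    by (intro tendsto_intros Cons.IH e(3))
  moreover have "(\<Sum>x\<in>set_pmf (P a). (e k * pmf (P a) x + (1 - e k) * (if x = f a then 1 else 0)) *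
      expct (mix_pmf f P (e k)) w (\<lambda>ys. g (x # ys))) = expct (mix_pmf f P (e k)) (a # w) g" for k
    unfolding finite_choices.expct_Cons[OF fc] using e(1,2)[of k]
    by (simp add: set_mix_pmf f pmf_mix_pmf)
  moreover have "(\<Sum>x\<in>set_pmf (P a). (0 * pmf (P a) x + (1 - 0) * (if x = f a then 1 else 0)) * g (x # map f w)) = g (map f (a # w))"
  proof -
    have "(\<Sum>x\<in>set_pmf (P a). (0 * pmf (P a) x + (1 - 0) * (if x = f a then 1 else 0)) * g (x # map f w)) =
      (\<Sum>x\<in>set_pmf (P a). if x = f a then g (x # map f w) else 0)" by (intro sum.cong) auto
    then show ?thesis using f[of a] finite_P[of a] by simp
  qed
  ultimately show ?case by simp
qed

context random_rs
begin

lemma random_substitution_P: "random_substitution \<theta> P" "nondegenerate \<theta> P"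
proof -
  show "random_substitution \<theta> P"
    using finite_images images_ne nonerasing by (simp add: random_substitution_def set_P)
  show "nondegenerate \<theta> P" unfolding nondegenerate_def using pmf_pos by (metis less_irrefl)
qed

lemma freq_indep:
  assumes "eigenvectors_independent_of_probabilities \<theta>" "random_rs \<theta> P'"
  shows "random_rs.freq \<theta> P' = freq"
proof
  fix v :: "'a list"
  interpret B: random_rs \<theta> P' by fact
  have "induced_eigenvector \<theta> P' (length v) = induced_eigenvector \<theta> P (length v)" if "v \<noteq> []"
  proof -
    have "1 \<le> length v" using that by (simp add: Suc_le_eq)
    then show ?thesis using assms(1) random_substitution_P B.random_substitution_P
      unfolding eigenvectors_independent_of_probabilities_def by blast
  qed
  then show "B.freq v = freq v" by (simp add: freq_def B.freq_def)
qed

text \<open>Letting the probability vectors degenerate to the Dirac masses at \<open>f\<close> keeps the eigenvector.\<close>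

lemma freq_eigen_det:
  assumes indep: "eigenvectors_independent_of_probabilities \<theta>"
    and f: "\<And>a. f a \<in> \<theta> a" and n: "n \<ge> 1"
  shows "(\<Sum>a\<in>UNIV. freq [a] * real (length (f a))) * (\<Sum>u | length u = n. freq u * h u) =
    (\<Sum>w | length w = n. freq w * (\<Sum>z\<leftarrow>induced_word n (map f w). h z))"
proof -
  define e :: "nat \<Rightarrow> real" where "e k = 1 / (real k + 2)" for k
  have e: "0 < e k" "e k < 1" for k by (auto simp: e_def)
  have e0: "e \<longlonglongrightarrow> 0" unfolding e_def by real_asymp
  define Q where "Q k = mix_pmf f P (e k)" for k
  have rs: "random_rs \<theta> (Q k)" for k
    by unfold_locales (simp add: Q_def set_mix_pmf e f set_P)
  define c where "c k = (SOME c. \<exists>L. random_rs.eigen_pair \<theta> (Q k) L c)" for k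
  have c: "\<exists>L. random_rs.eigen_pair \<theta> (Q k) L (c k)" for k
    unfolding c_def by (rule someI_ex) (use random_rs.eigen_pair_exists[OF rs] in blast)
  have eq: "c k * (\<Sum>u | length u = l. freq u * h u) =
      (\<Sum>w | length w = l. freq w * expct (Q k) w (\<lambda>xs. \<Sum>z\<leftarrow>induced_word l xs. h z))" if "l \<ge> 1" for k l h
  proof -
    obtain L where L: "random_rs.eigen_pair \<theta> (Q k) L (c k)" using c by blast
    show ?thesis using random_rs.freq_eigen[OF rs that L, of h] unfolding freq_indep[OF indep rs] .
  qed
  have lim: "(\<lambda>k. c k * (\<Sum>u | length u = l. freq u * h u)) \<longlonglongrightarrow>
      (\<Sum>w | length w = l. freq w * (\<Sum>z\<leftarrow>induced_word l (map f w). h z))" if "l \<ge> 1" for l h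
    unfolding eq[OF that] Q_def
    by (intro tendsto_sum tendsto_mult tendsto_const expct_mix_tendsto) (simp_all add: f e e0 set_P)
  \<comment> \<open>Length one and the constant test function \<open>1\<close> compute the limit of
    the eigenvalues themselves, namely the mean length of the images under \<open>f\<close>.\<close>
  have "(\<Sum>w | length w = 1. freq w * (\<Sum>z\<leftarrow>induced_word 1 (map f w). 1)) = (\<Sum>a\<in>UNIV. freq [a] * real (length (f a)))"
  proof -
    have "{w :: 'a list. length w = 0} = {[]}" by auto
    then show ?thesis
      using sum_words_Cons[of "\<lambda>w. freq w * (\<Sum>z\<leftarrow>induced_word 1 (map f w). 1)" 0]
      by (simp add: sum_list_triv induced_word_def)
  qed
  then have "c \<longlonglongrightarrow> (\<Sum>a\<in>UNIV. freq [a] * real (length (f a)))"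
    using lim[of 1 "\<lambda>_. 1"] freq_sum[of 1] by simp
  then have "(\<lambda>k. c k * (\<Sum>u | length u = n. freq u * h u)) \<longlonglongrightarrow>
      (\<Sum>a\<in>UNIV. freq [a] * real (length (f a))) * (\<Sum>u | length u = n. freq u * h u)"
    by (intro tendsto_mult tendsto_const)
  then show ?thesis using LIMSEQ_unique lim[OF n] by blast
qed

text \<open>Since the test function is arbitrary, the one-step identity can be applied to the
  induced sum of \<open>h\<close> again and again; \<open>induced_word_comp\<close> merges the
  steps.\<close>

lemma freq_eigen_iter:
  assumes indep: "eigenvectors_independent_of_probabilities \<theta>"
    and f: "\<And>a. f a \<in> \<theta> a" and n: "n \<ge> 1"
  shows "(\<Sum>a\<in>UNIV. freq [a] * real (length (f a))) ^ k * (\<Sum>u | length u = n. freq u * h u) =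
    (\<Sum>w | length w = n. freq w * (\<Sum>z\<leftarrow>induced_word n (map (iter_subst f k) w). h z))"
proof (induction k arbitrary: h)
  case 0
  have "induced_word n (map (iter_subst f 0) w) = [w]" if "length w = n" for w
  proof -
    have "concat (map (iter_subst f 0) v) = v" for v by (induction v) auto
    then show ?thesis using that n by (cases w) (auto simp: induced_word_def)
  qed
  then show ?case by (auto intro!: sum.cong simp del: iter_subst.simps)
next
  case (Suc k)
  let ?c = "\<Sum>a\<in>UNIV. freq [a] * real (length (f a))"
  have fne: "f a \<noteq> []" for a using f[of a] nonerasing[of a] by metis
  have "?c ^ Suc k * (\<Sum>u | length u = n. freq u * h u) =
    ?c ^ k * (\<Sum>w | length w = n. freq w * (\<Sum>z\<leftarrow>induced_word n (map f w). h z))"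
    using freq_eigen_det[OF assms] by (simp add: mult_ac)
  also have "\<dots> = (\<Sum>w | length w = n. freq w * (\<Sum>v\<leftarrow>induced_word n (map (iter_subst f k) w). \<Sum>z\<leftarrow>induced_word n (map f v). h z))"
    by (rule Suc.IH)
  also have "\<dots> = (\<Sum>w | length w = n. freq w * (\<Sum>z\<leftarrow>induced_word n (map (iter_subst f (Suc k)) w). h z))"
  proof (intro sum.cong refl arg_cong2[where f = "(*)"])
    fix w :: "'a list" assume "w \<in> {w. length w = n}"
    then have w: "length w = n" by simp
    have "induced_word n (map (iter_subst f (Suc k)) w) =
        concat (map (\<lambda>v. induced_word n (map f v)) (induced_word n (map (iter_subst f k) w)))"
    proof -
      have "iter_subst f (Suc k) = (\<lambda>a. concat (map f (iter_subst f k a)))" by (rule ext) simp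
      then show ?thesis using induced_word_comp[of "iter_subst f k" f w n, OF iter_subst_ne[OF fne] fne w n] by simp
    qed
    moreover have "(\<Sum>z\<leftarrow>concat (map F vs). h z) = (\<Sum>v\<leftarrow>vs. \<Sum>z\<leftarrow>F v. h z)" for F :: "'a list \<Rightarrow> 'a list list" and vs
      by (induction vs) auto
    ultimately show "(\<Sum>v\<leftarrow>induced_word n (map (iter_subst f k) w). \<Sum>z\<leftarrow>induced_word n (map f v). h z) =
      (\<Sum>z\<leftarrow>induced_word n (map (iter_subst f (Suc k)) w). h z)" by simp
  qed
  finally show ?case .
qed

section \<open>Averages over factors of a random word\<close>

lemma sum_freq_prefix:
  "(\<Sum>w | length w = n + d. freq w * F (take n w)) = (\<Sum>v | length v = n. freq v * F v)"
proof (induction d)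
  case (Suc d)
  have "(\<Sum>w | length w = n + Suc d. freq w * F (take n w)) =
    (\<Sum>v | length v = n + d. \<Sum>a\<in>UNIV. freq (v @ [a]) * F (take n v))"
    unfolding add_Suc_right sum_words_snoc by simp
  also have "\<dots> = (\<Sum>v | length v = n + d. freq v * F (take n v))"
    by (simp add: freq_snoc flip: sum_distrib_right)
  finally show ?case using Suc by simp
qed simp

lemma sum_freq_suffix:
  "(\<Sum>w | length w = d + n. freq w * F (drop d w)) = (\<Sum>v | length v = n. freq v * F v)"
proof (induction d)
  case (Suc d)
  have "(\<Sum>w | length w = Suc d + n. freq w * F (drop (Suc d) w)) =
    (\<Sum>v | length v = d + n. \<Sum>a\<in>UNIV. freq (a # v) * F (drop d v))"
    unfolding add_Suc sum_words_Cons by simp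
  also have "\<dots> = (\<Sum>v | length v = d + n. freq v * F (drop d v))"
    by (simp add: freq_Cons flip: sum_distrib_right)
  finally show ?case using Suc by simp
qed simp

lemma sum_freq_factor:
  assumes "i + n \<le> N"
  shows "(\<Sum>w | length w = N. freq w * F (take n (drop i w))) = (\<Sum>v | length v = n. freq v * F v)"
proof -
  obtain d where N: "N = i + (n + d)" using assms by (metis le_Suc_ex add.assoc)
  show ?thesis unfolding N sum_freq_suffix[where d = i and n = "n + d" and F = "\<lambda>v. F (take n v)"] by (rule sum_freq_prefix)
qed

text \<open>Windows of length \<open>n\<close> in the first block depend on the first
  \<open>n\<close> letters only; further letters average out. This allows conditioning on prefixes
  longer than the window.\<close>

lemma freq_eigen_long:
  assumes ep: "eigen_pair L c" and n: "1 \<le> n" "n \<le> N"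
  shows "c * (\<Sum>u | length u = n. freq u * h u) =
    (\<Sum>w | length w = N. freq w * expct P w (\<lambda>xs. \<Sum>z\<leftarrow>induced_word n xs. h z))"
proof -
  obtain d where N: "N = n + d" using n le_Suc_ex by blast
  have "expct P w (\<lambda>xs. \<Sum>z\<leftarrow>induced_word n xs. h z) = expct P (take n w) (\<lambda>xs. \<Sum>z\<leftarrow>induced_word n xs. h z)"
    if "length w = N" for w
  proof -
    have "induced_word n (xs @ ys) = induced_word n xs" if "xs \<in> chs (take n w)" for xs ys
      using induced_word_append[OF listset_nonempty_blocks, of xs "take n w" n] that length_listset[OF that] n \<open>length w = N\<close>
      by (simp add: chs_eq)
    then have "expct P (take n w @ drop n w) (\<lambda>xs. \<Sum>z\<leftarrow>induced_word n xs. h z) =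
        expct P (take n w) (\<lambda>xs. \<Sum>z\<leftarrow>induced_word n xs. h z)"
      unfolding expct_append by (intro expct_cong) (simp add: expct_const)
    then show ?thesis by simp
  qed
  then have "(\<Sum>w | length w = N. freq w * expct P w (\<lambda>xs. \<Sum>z\<leftarrow>induced_word n xs. h z)) =
    (\<Sum>w | length w = N. freq w * expct P (take n w) (\<lambda>xs. \<Sum>z\<leftarrow>induced_word n xs. h z))"
    by (intro sum.cong) auto
  also have "\<dots> = (\<Sum>w | length w = n. freq w * expct P w (\<lambda>xs. \<Sum>z\<leftarrow>induced_word n xs. h z))"
    unfolding N by (rule sum_freq_prefix)
  finally show ?thesis using freq_eigen[OF n(1) ep] by simp
qed

end

section \<open>Predicting a letter from its successors\<close>

primrec mistakes :: "('a list \<Rightarrow> 'a) \<Rightarrow> 'a list \<Rightarrow> nat" where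
  "mistakes \<Phi> [] = 0"
| "mistakes \<Phi> (b # s) = (if b = \<Phi> s then 0 else 1) + mistakes \<Phi> s"

text \<open>The halving predictor: \<open>\<Phi> s\<close> is the most frequent predecessor of \<open>s\<close> among the words of \<open>E\<close>
  that end in \<open>s\<close>, so that each mistake halves the number of remaining candidates.\<close>

lemma halving_predictor:
  fixes E :: "'a::finite list set"
  assumes "finite E"
  shows "\<exists>\<Phi>. \<forall>u\<in>E. 2 ^ mistakes \<Phi> u \<le> card E"
proof -
  define N where "N s = card {u \<in> E. suffix s u}" for s
  define \<Phi> where "\<Phi> s = (SOME b. \<forall>c. N (c # s) \<le> N (b # s))" for s
  have \<Phi>: "N (c # s) \<le> N (\<Phi> s # s)" for c s
  proof -
    have fin: "finite (range (\<lambda>b. N (b # s)))" by simp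
    then have "Max (range (\<lambda>b. N (b # s))) \<in> range (\<lambda>b. N (b # s))" by (intro Max_in) auto
    then obtain b where "N (b # s) = Max (range (\<lambda>b. N (b # s)))" by (metis (no_types, lifting) imageE)
    then have "\<exists>b. \<forall>c. N (c # s) \<le> N (b # s)" using Max_ge[OF fin] by (intro exI[of _ b]) auto
    from someI_ex[OF this] show ?thesis unfolding \<Phi>_def by blast
  qed
  have step: "2 ^ mistakes \<Phi> s * N s \<le> card E" for s
  proof (induction s)
    case Nil
    then show ?case by (simp add: N_def)
  next
    case (Cons b s)
    have mono: "N (b # s) \<le> N s"
      unfolding N_def using assms by (intro card_mono) (auto dest: suffix_ConsD)
    show ?case
    proof (cases "b = \<Phi> s")
      case True
      have "2 ^ mistakes \<Phi> s * N (b # s) \<le> 2 ^ mistakes \<Phi> s * N s" by (rule mult_left_mono[OF mono]) simp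
      from order_trans[OF this Cons] show ?thesis by (simp add: True)
    next
      case False
      have "N (b # s) + N (\<Phi> s # s) = card ({u \<in> E. suffix (b # s) u} \<union> {u \<in> E. suffix (\<Phi> s # s) u})"
        unfolding N_def using assms False by (intro card_Un_disjoint[symmetric]) (auto simp: suffix_def)
      also have "\<dots> \<le> N s"
        unfolding N_def using assms by (intro card_mono) (auto dest: suffix_ConsD)
      finally have "2 * N (b # s) \<le> N s" using \<Phi>[of b s] by linarith
      then have "2 ^ mistakes \<Phi> s * (2 * N (b # s)) \<le> 2 ^ mistakes \<Phi> s * N s" by (rule mult_left_mono) simp
      from order_trans[OF this Cons] show ?thesis by (simp add: False mult_ac)
    qed
  qed
  have "2 ^ mistakes \<Phi> u \<le> card E" if "u \<in> E" for u
  proof -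
    have "N u \<noteq> 0" unfolding N_def using that assms by (auto simp: card_eq_0_iff)
    then have "2 ^ mistakes \<Phi> u * 1 \<le> 2 ^ mistakes \<Phi> u * N u" by (intro mult_left_mono) auto
    from order_trans[OF this step] show ?thesis by simp
  qed
  then show ?thesis by blast
qed

lemma mistakes_le_length: "mistakes \<Phi> u \<le> length u"
  by (induction u) auto

text \<open>Take the first index \<open>j\<close> whose \<open>m\<close>-block has a short image.
  All later summands belong to letters of that very block, so together they are bounded by the
  length of its image, which is less than \<open>B\<close>.\<close>

lemma sum_first_hits_le:
  fixes g :: "'a \<Rightarrow> 'a list" and B :: nat
  assumes "length w \<ge> 2 * m"
  shows "(\<Sum>i<m. if length (concat (map g (take m (drop i w)))) < B then length (g (w ! i)) else 0) \<le> B"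
proof (cases "\<exists>i<m. length (concat (map g (take m (drop i w)))) < B")
  case False
  then have "(\<Sum>i<m. if length (concat (map g (take m (drop i w)))) < B then length (g (w ! i)) else 0) = 0"
    by (intro sum.neutral) auto
  then show ?thesis by simp
next
  case True
  define P where "P i \<longleftrightarrow> i < m \<and> length (concat (map g (take m (drop i w)))) < B" for i
  define j where "j = (LEAST i. P i)"
  have "\<exists>i. P i" using True by (auto simp: P_def)
  then have j: "P j" unfolding j_def by (rule LeastI_ex)
  have min: "\<not> P i" if "i < j" for i using not_less_Least[of i P] that by (simp add: j_def)
  have "(\<Sum>i<m. if length (concat (map g (take m (drop i w)))) < B then length (g (w ! i)) else 0)
      = (\<Sum>i\<in>{j..<m}. if length (concat (map g (take m (drop i w)))) < B then length (g (w ! i)) else 0)"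
    using min by (intro sum.mono_neutral_right) (auto simp: P_def)
  also have "\<dots> \<le> (\<Sum>i\<in>{j..<m}. length (g (w ! i)))" by (intro sum_mono) auto
  also have "\<dots> \<le> (\<Sum>i\<in>{j..<j+m}. length (g (w ! i)))" by (intro sum_mono2) auto
  also have "\<dots> = (\<Sum>i<m. length (g (take m (drop j w) ! i)))"
    using assms j by (intro sum.reindex_bij_witness[of _ "\<lambda>i. i + j" "\<lambda>i. i - j"]) (auto simp: P_def add.commute)
  also have "\<dots> = length (concat (map g (take m (drop j w))))"
  proof -
    have "length (take m (drop j w)) = m" using assms j by (auto simp: P_def min_def)
    then show ?thesis by (simp add: length_concat sum_list_sum_nth atLeast0LessThan del: length_take)
  qed
  also have "\<dots> \<le> B" using j by (simp add: P_def)
  finally show ?thesis .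
qed

context random_rs
begin

definition pred_error :: "nat \<Rightarrow> ('a list \<Rightarrow> 'a) \<Rightarrow> real" where
  "pred_error j \<Phi> = (\<Sum>u | length u = Suc j. freq u * (if hd u = \<Phi> (tl u) then 0 else 1))"

text \<open>By the left marginal, the mistake made with \<open>j\<close> letters to the right has
  the same expectation in words of every length exceeding \<open>j\<close>.\<close>

lemma sum_freq_mistakes: "(\<Sum>u | length u = n. freq u * real (mistakes \<Phi> u)) = (\<Sum>j<n. pred_error j \<Phi>)"
proof (induction n)
  case (Suc n)
  have "(\<Sum>u | length u = Suc n. freq u * real (mistakes \<Phi> u)) =
    (\<Sum>u | length u = Suc n. freq u * (if hd u = \<Phi> (tl u) then 0 else 1) + freq u * real (mistakes \<Phi> (drop 1 u)))"
    by (intro sum.cong) (auto simp: length_Suc_conv algebra_simps)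
  also have "\<dots> = pred_error n \<Phi> + (\<Sum>u | length u = 1 + n. freq u * real (mistakes \<Phi> (drop 1 u)))"
    by (simp add: sum.distrib pred_error_def)
  also have "(\<Sum>u | length u = 1 + n. freq u * real (mistakes \<Phi> (drop 1 u))) = (\<Sum>u | length u = n. freq u * real (mistakes \<Phi> u))"
    by (rule sum_freq_suffix[where F = "\<lambda>u. real (mistakes \<Phi> u)"])
  finally show ?case using Suc by simp
qed simp

text \<open>Stationarity replaces \<open>m\<close> times the average over words of length
  \<open>m\<close> by the sum over \<open>m\<close> consecutive positions in a word of length
  \<open>2 * m\<close>, to which \<open>sum_first_hits_le\<close> applies. Blocks inflating too
  little therefore contribute few image letters.\<close>

lemma sum_freq_short_inflation:
  fixes g :: "'a \<Rightarrow> 'a list" and B :: nat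
  assumes "m \<ge> 1"
  shows "real m * (\<Sum>w | length w = m. freq w * (if length (concat (map g w)) < B then real (length (g (hd w))) else 0)) \<le> B"
proof -
  define b where "b w = (if length (concat (map g w)) < B then real (length (g (hd w))) else 0)" for w
  have "real m * (\<Sum>w | length w = m. freq w * b w) = (\<Sum>i<m. \<Sum>w | length w = m. freq w * b w)" by simp
  also have "\<dots> = (\<Sum>i<m. \<Sum>w | length w = 2 * m. freq w * b (take m (drop i w)))"
  proof (rule sum.cong)
    fix i assume "i \<in> {..<m}"
    then show "(\<Sum>w | length w = m. freq w * b w) = (\<Sum>w | length w = 2 * m. freq w * b (take m (drop i w)))"
      by (intro sum_freq_factor[symmetric]) simp
  qed simp
  also have "\<dots> = (\<Sum>w | length w = 2 * m. freq w * (\<Sum>i<m. b (take m (drop i w))))"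
    by (subst sum.swap) (simp add: sum_distrib_left)
  also have "\<dots> \<le> (\<Sum>w | length w = 2 * m. freq w * B)"
  proof (intro sum_mono mult_left_mono freq_nonneg)
    fix w :: "'a list" assume "w \<in> {w. length w = 2 * m}"
    then have w: "length w = 2 * m" by simp
    have "(\<Sum>i<m. b (take m (drop i w))) =
      real (\<Sum>i<m. if length (concat (map g (take m (drop i w)))) < B then length (g (w ! i)) else 0)"
      unfolding of_nat_sum
      by (intro sum.cong) (use w assms in \<open>auto simp: b_def hd_drop_conv_nth\<close>)
    also have "\<dots> \<le> real B" using sum_first_hits_le[of m w g B] w by (simp only: of_nat_le_iff)
    finally show "(\<Sum>i<m. b (take m (drop i w))) \<le> real B" .
  qed
  also have "\<dots> = B" using freq_sum[of "2 * m"] by (simp flip: sum_distrib_right)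
  finally show ?thesis by (simp add: b_def)
qed

text \<open>Most words of length \<open>n\<close> are factors of \<open>f\<^sup>k v\<close> with \<open>|v| = m\<close> much smaller than \<open>n\<close>; there are
  few such words, so the halving predictor makes few mistakes on them.\<close>

lemma predictor_bound:
  fixes m n K :: nat and c :: real
  assumes indep: "eigenvectors_independent_of_probabilities \<theta>"
    and f: "\<And>a. f a \<in> \<theta> a" and c: "c = (\<Sum>a\<in>UNIV. freq [a] * real (length (f a)))" "c > 0"
    and K: "\<And>a. length (iter_subst f k a) \<le> K" and mn: "1 \<le> m" "m \<le> n"
  shows "\<exists>j \<Phi>. pred_error j \<Phi> \<le> (real K + real CARD('a) * m) / n + (real n + real K) / (m * c ^ k)"
proof -
  define g where "g = iter_subst f k"
  have fne: "f a \<noteq> []" for a using f[of a] nonerasing[of a] by metis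
  have gne: "g a \<noteq> []" for a unfolding g_def by (rule iter_subst_ne[OF fne])
  \<comment> \<open>Offsets below \<open>K\<close> suffice, because windows start in the image of
    the first letter, whose length is at most \<open>K\<close>.\<close>
  define E where "E = (\<lambda>(r, v). take n (drop r (concat (map g v)))) ` ({..<K} \<times> {v. length v = m})"
  have finE: "finite E" unfolding E_def by (intro finite_imageI finite_cartesian_product finite_words) simp
  have cardE: "card E \<le> 2 ^ (K + CARD('a) * m)"
  proof -
    have "card E \<le> card ({..<K} \<times> {v :: 'a list. length v = m})"
      unfolding E_def by (intro card_image_le finite_cartesian_product finite_words) simp
    also have "\<dots> = K * CARD('a) ^ m"
      using card_lists_length_eq[of "UNIV :: 'a set" m] by (simp add: card_cartesian_product)
    also have "\<dots> \<le> 2 ^ K * (2 ^ CARD('a)) ^ m"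
      by (intro mult_mono power_mono) (auto simp: less_imp_le)
    finally show ?thesis by (simp add: power_add power_mult)
  qed
  obtain \<Phi> where \<Phi>: "\<And>u. u \<in> E \<Longrightarrow> 2 ^ mistakes \<Phi> u \<le> card E" using halving_predictor[OF finE] by blast
  have few: "mistakes \<Phi> u \<le> K + CARD('a) * m" if "u \<in> E" for u
    using order_trans[OF \<Phi>[OF that] cardE] by simp
  define bad where "bad u = (if u \<in> E then 0 else (1::real))" for u
  have "c ^ k * (\<Sum>u | length u = n. freq u * bad u) =
      (\<Sum>w | length w = n. freq w * (\<Sum>z\<leftarrow>induced_word n (map g w). bad z))"
    unfolding g_def c(1) using freq_eigen_iter[OF indep f] mn by simp
  \<comment> \<open>If the first \<open>m\<close> letters have an image of length at least
    \<open>n + K\<close>, every window at an offset below \<open>K\<close> fits into it and belongs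
    to \<open>E\<close>. Otherwise all windows are counted as bad.\<close>
  also have "\<dots> \<le> (\<Sum>w | length w = n. freq w *
      (if length (concat (map g (take m w))) < n + K then real (length (g (hd (take m w)))) else 0))"
  proof (intro sum_mono mult_left_mono freq_nonneg)
    fix w :: "'a list" assume "w \<in> {w. length w = n}"
    then have w: "length w = n" by simp
    then obtain a v where av: "w = a # v" using mn by (cases w) auto
    have hd: "hd (take m w) = a" using av mn by (cases m) auto
    show "(\<Sum>z\<leftarrow>induced_word n (map g w). bad z) \<le>
      (if length (concat (map g (take m w))) < n + K then real (length (g (hd (take m w)))) else 0)"
    proof (cases "length (concat (map g (take m w))) < n + K")
      case True
      have "(\<Sum>z\<leftarrow>zs. bad z) \<le> length zs" for zs by (induction zs) (auto simp: bad_def)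
      from this[of "induced_word n (map g w)"] show ?thesis
        using True unfolding hd by (simp add: length_induced_word av)
    next
      case False
      have "bad z = 0" if "z \<in> set (induced_word n (map g w))" for z
      proof -
        obtain r where r: "r < length (g a)" "z = take n (drop r (concat (map g w)))"
          using \<open>z \<in> _\<close> by (auto simp: induced_word_def av)
        have rK: "r < K" using r(1) K[of a] by (simp add: g_def)
        have "concat (map g w) = concat (map g (take m w)) @ concat (map g (drop m w))"
          by (metis append_take_drop_id concat_append map_append)
        then have "z = take n (drop r (concat (map g (take m w))))"
          using r(2) False rK by simp
        moreover have "(r, take m w) \<in> {..<K} \<times> {v. length v = m}" using rK w mn by simp
        ultimately have "z \<in> E" unfolding E_def by (metis (mono_tags, lifting) case_prod_conv image_eqI)
        then show ?thesis by (simp add: bad_def)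
      qed
      then have "(\<Sum>z\<leftarrow>induced_word n (map g w). bad z) = 0" by (simp add: sum_list_0 cong: map_cong)
      then show ?thesis by simp
    qed
  qed
  also have "\<dots> = (\<Sum>w | length w = m. freq w * (if length (concat (map g w)) < n + K then real (length (g (hd w))) else 0))"
    using mn by (intro sum_freq_factor[where i = 0 and n = m and N = n and
      F = "\<lambda>w. if length (concat (map g w)) < n + K then real (length (g (hd w))) else 0", unfolded drop_0]) simp
  also have "\<dots> \<le> (real n + real K) / m"
    using sum_freq_short_inflation[OF mn(1), of g "n + K"] mn by (simp add: field_simps)
  finally have bad_mass: "(\<Sum>u | length u = n. freq u * bad u) \<le> (real n + real K) / (m * c ^ k)"
    using c(2) mn by (simp add: field_simps)
  have "(\<Sum>j<n. pred_error j \<Phi>) = (\<Sum>u | length u = n. freq u * real (mistakes \<Phi> u))"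
    by (rule sum_freq_mistakes[symmetric])
  also have "\<dots> \<le> (\<Sum>u | length u = n. freq u * (real K + real CARD('a) * m) + n * (freq u * bad u))"
  proof (rule sum_mono)
    fix u :: "'a list" assume "u \<in> {u. length u = n}"
    then have u: "length u = n" by simp
    have "real (mistakes \<Phi> u) \<le> (real K + real CARD('a) * m) + n * bad u"
    proof (cases "u \<in> E")
      case True
      then have "real (mistakes \<Phi> u) \<le> real (K + CARD('a) * m)" using few by (simp only: of_nat_le_iff)
      then show ?thesis using True by (simp add: bad_def)
    next
      case False
      have "real (mistakes \<Phi> u) \<le> real n" using mistakes_le_length[of \<Phi> u] u by simp
      moreover have "0 \<le> real K + real CARD('a) * m" by simp
      ultimately show ?thesis using False by (simp only: bad_def if_False mult_1_right)
    qed
    then have "freq u * real (mistakes \<Phi> u) \<le> freq u * ((real K + real CARD('a) * m) + n * bad u)"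
      using freq_nonneg by (rule mult_left_mono)
    then show "freq u * real (mistakes \<Phi> u) \<le> freq u * (real K + real CARD('a) * m) + n * (freq u * bad u)"
      by (simp add: algebra_simps)
  qed
  also have "\<dots> = (real K + real CARD('a) * m) + n * (\<Sum>u | length u = n. freq u * bad u)"
    using freq_sum[of n] by (simp add: sum.distrib flip: sum_distrib_left sum_distrib_right)
  also have "\<dots> \<le> (real K + real CARD('a) * m) + n * ((real n + real K) / (m * c ^ k))"
    using bad_mass by (intro add_left_mono mult_left_mono) auto
  also have "\<dots> = n * ((real K + real CARD('a) * m) / n + (real n + real K) / (m * c ^ k))"
  proof -
    have "real n > 0" using mn by simp
    then show ?thesis by (simp add: field_simps)
  qed
  finally have le: "(\<Sum>j<n. pred_error j \<Phi>) \<le> n * ((real K + real CARD('a) * m) / n + (real n + real K) / (m * c ^ k))" .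
  \<comment> \<open>The \<open>n\<close> errors cannot all exceed their average.\<close>
  show ?thesis
  proof (rule ccontr)
    assume "\<not> ?thesis"
    then have gt: "pred_error j \<Phi> > (real K + real CARD('a) * m) / n + (real n + real K) / (m * c ^ k)" for j
      by (meson not_le)
    have "(\<Sum>j<n. (real K + real CARD('a) * m) / n + (real n + real K) / (m * c ^ k)) < (\<Sum>j<n. pred_error j \<Phi>)"
      using gt mn by (intro sum_strict_mono) (auto simp: lessThan_empty_iff)
    then show False using le by simp
  qed
qed

text \<open>Each of the four terms of \<open>predictor_bound\<close> is made at most
  \<open>d / 4\<close>. Order of choices: the ratio \<open>q\<close> of \<open>n\<close> to
  \<open>m\<close> controls \<open>A * m / n\<close>; then \<open>k\<close> controls
  \<open>n / (m * c ^ k)\<close>, which is \<open>q / c ^ k\<close>; this fixes \<open>K\<close>,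
  and a large \<open>m\<close> controls both terms containing \<open>K\<close>.\<close>

lemma predictor_exists:
  assumes indep: "eigenvectors_independent_of_probabilities \<theta>" and d: "d > 0"
  shows "\<exists>j \<Phi>. pred_error j \<Phi> \<le> d"
proof -
  obtain b w where bw: "w \<in> \<theta> b" "length w \<ge> 2" using long_image by blast
  \<comment> \<open>One letter receives an image of length at least two; as every letter has
    positive frequency, the mean length \<open>c\<close> exceeds \<open>1\<close>.\<close>
  define f where "f a = (if a = b then w else (SOME w. w \<in> \<theta> a))" for a
  have f: "f a \<in> \<theta> a" for a
    unfolding f_def using bw images_ne[of a] some_in_eq[of "\<theta> a"] by auto
  define c where "c = (\<Sum>a\<in>UNIV. freq [a] * real (length (f a)))"
  have "(\<Sum>a\<in>UNIV. freq [a]) < c"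
    unfolding c_def
  proof (rule sum_strict_mono_ex1)
    have "length (f a) \<ge> 1" for a using f[of a] nonerasing[of a] by (cases "f a") auto
    then show "\<forall>a\<in>UNIV. freq [a] \<le> freq [a] * real (length (f a))"
      using freq_nonneg mult_left_mono[of 1 "real (length (f a))" "freq [a]" for a] by auto
    have "freq [b] < freq [b] * real (length (f b))"
      using freq_pos[OF legal_letter[of b]] bw by (simp add: f_def)
    then show "\<exists>a\<in>UNIV. freq [a] < freq [a] * real (length (f a))" by blast
  qed simp
  moreover have "(\<Sum>a\<in>UNIV. freq [a]) = 1" using freq_snoc[of "[]"] by (simp add: freq_def)
  ultimately have c1: "c > 1" by simp
  define A where "A = real CARD('a)"
  have large: "\<exists>q :: nat. q \<ge> 1 \<and> real q \<ge> x" for x :: real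
  proof -
    obtain q0 :: nat where "x \<le> real q0" using real_arch_simple by blast
    then show ?thesis by (intro exI[of _ "Suc q0"]) simp
  qed
  obtain q :: nat where q: "q \<ge> 1" "real q \<ge> 4 * A / d" using large by blast
  obtain k where k: "4 * real q / d < c ^ k" using real_arch_pow[OF c1] by blast
  define K where "K = Max (range (\<lambda>a. length (iter_subst f k a)))"
  have K: "length (iter_subst f k a) \<le> K" for a unfolding K_def by (intro Max_ge) auto
  obtain m :: nat where m: "m \<ge> 1" "real m \<ge> 4 * real K / d"
    using large by blast
  define n where "n = m * q"
  have n: "m \<le> n" "n \<ge> 1" using q m by (auto simp: n_def)
  have ck: "c ^ k \<ge> 1" using c1 by simp
  obtain j \<Phi> where le: "pred_error j \<Phi> \<le> (real K + A * m) / n + (real n + real K) / (m * c ^ k)"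
    using predictor_bound[OF indep f c_def _ K m(1) n(1)] c1 unfolding A_def by auto
  have "real K / n \<le> d / 4"
  proof -
    have "4 * real K \<le> d * m" using m(2) d by (simp add: field_simps)
    also have "\<dots> \<le> d * n" using n d by simp
    finally show ?thesis using n by (simp add: field_simps)
  qed
  moreover have "A * m / n \<le> d / 4"
  proof -
    have "A * m / n = A / q" using m q by (simp add: n_def)
    also have "\<dots> \<le> d / 4" using q d by (simp add: field_simps)
    finally show ?thesis .
  qed
  moreover have "real n / (m * c ^ k) \<le> d / 4"
  proof -
    have "real n / (m * c ^ k) = q / c ^ k" using m by (simp add: n_def)
    also have "\<dots> \<le> d / 4" using k d c1 by (simp add: field_simps)
    finally show ?thesis .
  qed
  moreover have "real K / (m * c ^ k) \<le> d / 4"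
  proof -
    have "real K / (m * c ^ k) \<le> real K / m" using ck m by (intro divide_left_mono) (auto simp: field_simps)
    also have "\<dots> \<le> d / 4" using m d by (simp add: field_simps)
    finally show ?thesis .
  qed
  ultimately have "pred_error j \<Phi> \<le> d" using le unfolding add_divide_distrib distrib_left distrib_right by linarith
  then show ?thesis by blast
qed

end

section \<open>Rigidity of the realisations\<close>

lemma concat_eq_append_Cons:
  "concat xs = A @ b # t \<Longrightarrow>
     \<exists>xs1 A2 t1 xs2. xs = xs1 @ (A2 @ b # t1) # xs2 \<and> t = t1 @ concat xs2"
proof (induction xs arbitrary: A)
  case (Cons x xs)
  show ?case
  proof (cases "length A < length x")
    case True
    then obtain s where s: "x = A @ s" "s @ concat xs = b # t"
      using Cons.prems by (auto simp: append_eq_append_conv2)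
    with True obtain t1 where "s = b # t1" by (cases s) auto
    then show ?thesis using s by (intro exI[of _ "[]"] exI[of _ A] exI[of _ t1] exI[of _ xs]) auto
  next
    case False
    then obtain A' where "A = x @ A'" "concat xs = A' @ b # t"
      using Cons.prems by (auto simp: append_eq_append_conv2)
    with Cons.IH[of A'] obtain xs1 A2 t1 xs2 where
      "xs = xs1 @ (A2 @ b # t1) # xs2" "t = t1 @ concat xs2" by blast
    then show ?thesis by (intro exI[of _ "x # xs1"] exI[of _ A2] exI[of _ t1] exI[of _ xs2]) auto
  qed
qed simp

lemma not_suffix_decomp:
  assumes "\<not> suffix x y" "\<not> suffix y x"
  obtains A b A' b' t where "x = A @ b # t" "y = A' @ b' # t" "b \<noteq> b'"
proof -
  have "rev x \<parallel> rev y" using assms by (simp add: parallel_def suffix_to_prefix)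
  from parallel_decomp[OF this] obtain as b bs c cs where
    "b \<noteq> c" "rev x = as @ b # bs" "rev y = as @ c # cs" by blast
  then have "x = rev bs @ b # rev as" "y = rev cs @ c # rev as" "b \<noteq> c"
    by (metis append_Cons append_Nil append_assoc rev.simps(2) rev_append rev_rev_ident)+
  then show ?thesis using that by blast
qed

lemma member_le_sum_list_nonneg:
  fixes h :: "'b \<Rightarrow> real"
  assumes "z \<in> set zs" "\<And>z. h z \<ge> 0"
  shows "h z \<le> (\<Sum>z\<leftarrow>zs. h z)"
  using assms(1)
proof (induction zs)
  case (Cons a zs)
  have "0 \<le> (\<Sum>z\<leftarrow>zs. h z)" by (rule sum_list_nonneg) (use assms(2) in auto)
  then show ?case using Cons assms(2)[of a] by auto
qed simp

context random_rs
begin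

lemma freq_append_le: "freq (x @ u) \<le> freq u"
proof (induction x)
  case (Cons a x)
  have "freq (a # (x @ u)) \<le> (\<Sum>a\<in>UNIV. freq (a # (x @ u)))"
    using freq_nonneg by (intro member_le_sum) auto
  then show ?case using Cons by (simp add: freq_Cons)
qed simp

lemma sum_freq_append: "(\<Sum>v | length v = m. freq (u @ v)) = freq u"
proof (induction m)
  case 0
  have "{v :: 'a list. length v = 0} = {[]}" by auto
  then show ?case by simp
next
  case (Suc m)
  have "(\<Sum>v | length v = Suc m. freq (u @ v)) = (\<Sum>v | length v = m. \<Sum>a\<in>UNIV. freq ((u @ v) @ [a]))"
    unfolding sum_words_snoc by simp
  then show ?case using Suc by (simp only: freq_snoc)
qed

text \<open>The probability of failing to predict \<open>b\<close> when \<open>t\<close> is fixed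
  and only the image of the word \<open>v\<close> behind it is random. Both competing letters are
  compared against this same future.\<close>

definition miss :: "nat \<Rightarrow> ('a list \<Rightarrow> 'a) \<Rightarrow> 'a \<Rightarrow> 'a list \<Rightarrow> 'a list \<Rightarrow> real" where
  "miss j \<Phi> b t v = expct P v (\<lambda>zs. if b = \<Phi> (take j (t @ concat zs)) then 0 else 1)"

text \<open>The letter \<open>b\<close> lies in the first block, so the window starting at it is
  among those counted by the eigenvector equation for \<open>q @ v\<close>. Keeping just this
  window, the choice \<open>ys\<close> and words beginning with \<open>q\<close> discards
  non-negative terms only.\<close>

lemma pred_error_lower_bound:
  assumes ep: "eigen_pair L c" and ys: "ys \<in> chs q" "concat ys = A @ b # t" "length A < length (hd ys)"
  shows "pmf (choice_pmf P q) ys * (\<Sum>v | length v = Suc j. freq (q @ v) *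
      miss j \<Phi> b t v) \<le> c * pred_error j \<Phi>"
proof -
  define h where "h u = (if hd u = \<Phi> (tl u) then 0 else (1::real))" for u
  define S where "S xs = (\<Sum>z\<leftarrow>induced_word (Suc j) xs. h z)" for xs
  have hS: "h z \<ge> 0" "S xs \<ge> 0" for z xs unfolding S_def h_def by (auto intro!: sum_list_nonneg)
  have "ys \<noteq> []" using ys(2) by auto
  have "pmf (choice_pmf P q) ys * (\<Sum>v | length v = Suc j. freq (q @ v) *
      miss j \<Phi> b t v) =
    (\<Sum>v | length v = Suc j. freq (q @ v) * (pmf (choice_pmf P q) ys *
      miss j \<Phi> b t v))"
    by (simp add: sum_distrib_left mult_ac)
  also have "\<dots> \<le> (\<Sum>v | length v = Suc j. freq (q @ v) * expct P (q @ v) S)"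
  proof (intro sum_mono mult_left_mono freq_nonneg)
    fix v :: "'a list"
    have "miss j \<Phi> b t v \<le> expct P v (\<lambda>zs. S (ys @ zs))"
      unfolding miss_def
    proof (rule expct_mono)
      fix zs
      have "take (Suc j) (drop (length A) (concat (ys @ zs))) \<in> set (induced_word (Suc j) (ys @ zs))"
        unfolding induced_word_def using ys(3) \<open>ys \<noteq> []\<close> by (auto simp del: concat_append)
      then have "h (take (Suc j) (drop (length A) (concat (ys @ zs)))) \<le> S (ys @ zs)"
        unfolding S_def using hS by (intro member_le_sum_list_nonneg) auto
      then show "(if b = \<Phi> (take j (t @ concat zs)) then 0 else 1) \<le> S (ys @ zs)"
        by (simp add: ys(2) h_def)
    qed
    then have "pmf (choice_pmf P q) ys * miss j \<Phi> b t v \<le>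
      pmf (choice_pmf P q) ys * expct P v (\<lambda>zs. S (ys @ zs))" by (rule mult_left_mono) simp
    also have "\<dots> \<le> expct P q (\<lambda>ys. expct P v (\<lambda>zs. S (ys @ zs)))"
      using ys(1) hS by (intro expct_ge_single[where g = "\<lambda>ys. expct P v (\<lambda>zs. S (ys @ zs))"] expct_nonneg) auto
    finally show "pmf (choice_pmf P q) ys * miss j \<Phi> b t v \<le> expct P (q @ v) S"
      by (simp add: expct_append)
  qed
  also have "\<dots> = (\<Sum>w\<in>(@) q ` {v. length v = Suc j}. freq w * expct P w S)"
    by (subst sum.reindex) (auto simp: inj_on_def)
  also have "\<dots> \<le> (\<Sum>w | length w = length q + Suc j. freq w * expct P w S)"
    using hS by (intro sum_mono2 finite_words mult_nonneg_nonneg freq_nonneg expct_nonneg) auto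
  also have "\<dots> = c * pred_error j \<Phi>"
    unfolding pred_error_def S_def h_def by (rule freq_eigen_long[OF ep, symmetric]) auto
  finally show ?thesis .
qed

text \<open>Otherwise \<open>b\<close> and \<open>b'\<close> both precede, with positive probability, the same random future, and no
  predictor can be right about both.\<close>

lemma last_difference_impossible:
  assumes indep: "eigenvectors_independent_of_probabilities \<theta>" and q: "legal \<theta> (x @ q')"
    and ys: "ys \<in> listset (map \<theta> (x @ q'))" "concat ys = A @ b # t" "length A < length (hd ys)"
    and ys': "ys' \<in> listset (map \<theta> q')" "concat ys' = A' @ b' # t" "length A' < length (hd ys')"
  shows "b = b'"
proof (rule ccontr)
  assume ne: "b \<noteq> b'"
  obtain L c where ep: "eigen_pair L c" using eigen_pair_exists by blast
  then have c: "c > 0" by (simp add: eigen_pair_def)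
  define \<kappa> where "\<kappa> = min (pmf (choice_pmf P (x @ q')) ys) (pmf (choice_pmf P q') ys')"
  have \<kappa>: "\<kappa> > 0" using ys(1) ys'(1) by (simp add: \<kappa>_def pmf_positive_iff set_choice_pmf set_P)
  have fq: "freq (x @ q') > 0" by (rule freq_pos[OF q])
  \<comment> \<open>The factor \<open>4 * c\<close> makes twice the bound on
    \<open>c * pred_error j \<Phi>\<close> equal to half of
    \<open>\<kappa> * freq (x @ q')\<close>.\<close>
  obtain j \<Phi> where small: "pred_error j \<Phi> \<le> \<kappa> * freq (x @ q') / (4 * c)"
    using predictor_exists[OF indep, of "\<kappa> * freq (x @ q') / (4 * c)"] \<kappa> fq c by auto
  define e where "e = miss j \<Phi> b t"
  define e' where "e' = miss j \<Phi> b' t"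
  have e_nonneg: "e v \<ge> 0" "e' v \<ge> 0" for v unfolding e_def e'_def miss_def by (auto intro: expct_nonneg)
  \<comment> \<open>A prediction is a single letter, hence wrong for at least one of
    \<open>b\<close> and \<open>b'\<close>.\<close>
  have sum1: "e v + e' v \<ge> 1" for v
  proof -
    have "expct P v (\<lambda>_. 1) \<le> expct P v (\<lambda>zs. (if b = \<Phi> (take j (t @ concat zs)) then 0 else 1) +
        (if b' = \<Phi> (take j (t @ concat zs)) then 0 else 1))"
      using ne by (intro expct_mono) auto
    then show ?thesis by (simp add: expct_const expct_add e_def e'_def miss_def)
  qed
  have S: "\<kappa> * (\<Sum>v | length v = Suc j. freq (x @ q' @ v) * e v) \<le> c * pred_error j \<Phi>"
  proof -
    have "\<kappa> * (\<Sum>v | length v = Suc j. freq (x @ q' @ v) * e v) \<le>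
      pmf (choice_pmf P (x @ q')) ys * (\<Sum>v | length v = Suc j. freq ((x @ q') @ v) * e v)"
      unfolding append_assoc using e_nonneg freq_nonneg
      by (intro mult_right_mono sum_nonneg mult_nonneg_nonneg) (auto simp: \<kappa>_def)
    also have "\<dots> \<le> c * pred_error j \<Phi>"
      unfolding e_def by (rule pred_error_lower_bound[OF ep ys(1)[folded chs_eq] ys(2,3)])
    finally show ?thesis .
  qed
  \<comment> \<open>The block of \<open>b'\<close> may start later than that of \<open>b\<close>.
    Dropping the prefix \<open>x\<close> can only increase frequencies, so both errors are bounded
    with the same weights.\<close>
  have S': "\<kappa> * (\<Sum>v | length v = Suc j. freq (x @ q' @ v) * e' v) \<le> c * pred_error j \<Phi>"
  proof -
    have "\<kappa> * (\<Sum>v | length v = Suc j. freq (x @ q' @ v) * e' v) \<le>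
      pmf (choice_pmf P q') ys' * (\<Sum>v | length v = Suc j. freq (q' @ v) * e' v)"
      using e_nonneg freq_nonneg freq_append_le \<kappa>
      by (intro mult_mono sum_nonneg sum_mono mult_right_mono mult_nonneg_nonneg) (auto simp: \<kappa>_def)
    also have "\<dots> \<le> c * pred_error j \<Phi>"
      unfolding e'_def by (rule pred_error_lower_bound[OF ep ys'(1)[folded chs_eq] ys'(2,3)])
    finally show ?thesis .
  qed
  have "freq (x @ q') = (\<Sum>v | length v = Suc j. freq (x @ q' @ v) * 1)"
    using sum_freq_append[of "x @ q'" "Suc j"] by simp
  also have "\<dots> \<le> (\<Sum>v | length v = Suc j. freq (x @ q' @ v) * (e v + e' v))"
    using sum1 freq_nonneg by (intro sum_mono mult_left_mono) auto
  finally have "\<kappa> * freq (x @ q') \<le> \<kappa> * (\<Sum>v | length v = Suc j. freq (x @ q' @ v) * (e v + e' v))"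
    using \<kappa> by (intro mult_left_mono) auto
  also have "\<dots> \<le> 2 * (c * pred_error j \<Phi>)"
    using S S' by (simp add: distrib_left sum.distrib)
  also have "\<dots> \<le> 2 * (c * (\<kappa> * freq (x @ q') / (4 * c)))"
    using small c by (intro mult_left_mono) auto
  also have "\<dots> = \<kappa> * freq (x @ q') / 2" using c by simp
  finally show False using \<kappa> fq by (simp add: zero_less_mult_iff)
qed

text \<open>At the last difference, \<open>b\<close> and \<open>b'\<close> may stem from different
  letters of \<open>p\<close>. Cutting \<open>p\<close> before each of these letters puts both into
  first blocks; one of the two remaining words is a suffix of the other, as
  \<open>last_difference_impossible\<close> demands.\<close>

lemma realisations_suffix_comparable:
  assumes indep: "eigenvectors_independent_of_probabilities \<theta>" and p: "legal \<theta> p"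
    and u: "u \<in> realisations \<theta> p" "u' \<in> realisations \<theta> p"
  shows "suffix u u' \<or> suffix u' u"
proof (rule ccontr)
  assume "\<not> ?thesis"
  then have "\<not> suffix u u'" "\<not> suffix u' u" by simp_all
  then obtain A b A' b' t where dec: "u = A @ b # t" "u' = A' @ b' # t" "b \<noteq> b'"
    by (rule not_suffix_decomp)
  obtain xs xs' where xs: "xs \<in> listset (map \<theta> p)" "concat xs = A @ b # t"
    and xs': "xs' \<in> listset (map \<theta> p)" "concat xs' = A' @ b' # t"
    using u dec by (auto simp: realisations_def)
  obtain y A2 t1 z where y: "xs = y @ (A2 @ b # t1) # z" "t = t1 @ concat z"
    using concat_eq_append_Cons[OF xs(2)] by blast
  obtain y' A2' t1' z' where y': "xs' = y' @ (A2' @ b' # t1') # z'" "t = t1' @ concat z'"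
    using concat_eq_append_Cons[OF xs'(2)] by blast
  have d: "(A2 @ b # t1) # z \<in> listset (map \<theta> (drop (length y) p))"
    using drop_mem_listset[OF xs(1), of "length y"] y by simp
  have d': "(A2' @ b' # t1') # z' \<in> listset (map \<theta> (drop (length y') p))"
    using drop_mem_listset[OF xs'(1), of "length y'"] y' by simp
  have len: "length y < length p" "length y' < length p"
    using length_listset[OF xs(1)] length_listset[OF xs'(1)] y y' by auto
  have split: "drop i p = take (k - i) (drop i p) @ drop k p" if "i \<le> k" for i k
    using that append_take_drop_id[of "k - i" "drop i p"] by simp
  have leg: "legal \<theta> (drop i p)" if "i < length p" for i
    using that by (intro legal_sublist[OF p]) auto
  have c: "concat ((A2 @ b # t1) # z) = A2 @ b # t" "length A2 < length (hd ((A2 @ b # t1) # z))"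
    using y by simp_all
  have c': "concat ((A2' @ b' # t1') # z') = A2' @ b' # t" "length A2' < length (hd ((A2' @ b' # t1') # z'))"
    using y' by simp_all
  show False
  proof (cases "length y \<le> length y'")
    case True
    let ?x = "take (length y' - length y) (drop (length y) p)"
    have "legal \<theta> (?x @ drop (length y') p)" "(A2 @ b # t1) # z \<in> listset (map \<theta> (?x @ drop (length y') p))"
      by (subst split[OF True, symmetric], rule leg[OF len(1)]) (subst split[OF True, symmetric], rule d)
    then show False
      using last_difference_impossible[OF indep _ _ c d' c'] dec(3) by blast
  next
    case False
    then have le: "length y' \<le> length y" by simp
    let ?x = "take (length y - length y') (drop (length y') p)"
    have "legal \<theta> (?x @ drop (length y) p)" "(A2' @ b' # t1') # z' \<in> listset (map \<theta> (?x @ drop (length y) p))"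
      by (subst split[OF le, symmetric], rule leg[OF len(2)]) (subst split[OF le, symmetric], rule d')
    then show False
      using last_difference_impossible[OF indep _ _ c' d c] dec(3) by metis
  qed
qed

lemma realisations_length_inj:
  assumes "eigenvectors_independent_of_probabilities \<theta>" "legal \<theta> p"
    and "u \<in> realisations \<theta> p" "u' \<in> realisations \<theta> p" "length u = length u'"
  shows "u = u'"
  using realisations_suffix_comparable[OF assms(1-4)] assms(5) by (auto simp: suffix_def)

text \<open>Exchanging two realisations \<open>w\<^sub>1, w\<^sub>2\<close> of the same letter at two places preserves the length, hence
  the word; this forces the period \<open>|w\<^sub>2| - |w\<^sub>1|\<close>.\<close>

lemma periodic_between_returns:
  assumes indep: "eigenvectors_independent_of_probabilities \<theta>" and leg: "legal \<theta> ([a] @ v @ [a])"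
    and w: "w1 \<in> \<theta> a" "w2 \<in> \<theta> a" "length w1 \<le> length w2" and V: "V \<in> realisations \<theta> v"
    and i: "i + (length w2 - length w1) < length (w1 @ V @ w2)"
  shows "(w1 @ V @ w2) ! i = (w1 @ V @ w2) ! (i + (length w2 - length w1))"
proof -
  have r: "w1 @ V @ w2 \<in> realisations \<theta> ([a] @ v @ [a])" "w2 @ V @ w1 \<in> realisations \<theta> ([a] @ v @ [a])"
    using w V by (auto intro!: realisations_append simp: realisations_singleton simp del: append_Cons append_Nil)
  have eq: "w1 @ V @ w2 = w2 @ V @ w1"
    by (rule realisations_length_inj[OF indep leg r]) simp
  have "suffix w1 w2 \<or> suffix w2 w1"
    using realisations_suffix_comparable[OF indep legal_letter[of a]] w by (simp add: realisations_singleton)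
  then have "suffix w1 w2" using w(3) by (auto simp: suffix_def)
  then obtain s where s: "w2 = s @ w1" by (auto simp: suffix_def)
  obtain s' where s': "w2 = w1 @ s'"
    using eq w(3) by (auto simp: append_eq_append_conv2)
  \<comment> \<open>The exchanged word has \<open>Q\<close> both as a prefix, followed by
    \<open>s'\<close>, and as a suffix, preceded by \<open>s\<close>. This overlap is the period
    \<open>length s\<close>.\<close>
  define Q where "Q = w1 @ V @ w1"
  have W: "w1 @ V @ w2 = Q @ s'" "w1 @ V @ w2 = s @ Q"
    using eq s s' by (auto simp: Q_def)
  have d: "length w2 - length w1 = length s" "length s' = length s" using s s' by auto (metis add.commute add_left_cancel length_append s s')
  have "i < length Q" using i d W by simp
  then have "(Q @ s') ! i = Q ! i" "(s @ Q) ! (i + length s) = Q ! i"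
    by (simp_all add: nth_append)
  then show ?thesis using d W by metis
qed

text \<open>Two realisations of one letter must differ in length. The period comes from one such
  pair, fixed beforehand, and is therefore the same for all legal words.\<close>

lemma deterministic_or_periodic:
  assumes indep: "eigenvectors_independent_of_probabilities \<theta>"
  shows "(\<forall>a. \<exists>w. \<theta> a = {w}) \<or>
    (\<exists>d>0. \<forall>u. legal \<theta> u \<longrightarrow> (\<forall>i. i + d < length u \<longrightarrow> u ! i = u ! (i + d)))"
proof (cases "\<forall>a. \<exists>w. \<theta> a = {w}")
  case False
  then obtain a where a: "\<nexists>w. \<theta> a = {w}" by blast
  then obtain w w' where "w \<in> \<theta> a" "w' \<in> \<theta> a" "w \<noteq> w'" using images_ne[of a] by blast
  moreover have "length w \<noteq> length w'"
    using calculation realisations_length_inj[OF indep legal_letter[of a], of w w'] by (auto simp: realisations_singleton)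
  ultimately obtain w1 w2 where w: "w1 \<in> \<theta> a" "w2 \<in> \<theta> a" "length w1 < length w2" by (metis linorder_neqE_nat)
  define d where "d = length w2 - length w1"
  have "u ! i = u ! (i + d)" if u: "legal \<theta> u" and i: "i + d < length u" for u i
  proof -
    obtain K where "\<And>k b. k \<ge> K \<Longrightarrow> \<exists>x\<in>power_realisations \<theta> k [b]. sublist u x"
      using legal_eventually_everywhere[OF u] by blast
    then obtain x where x: "x \<in> power_realisations \<theta> (Suc K) [a]" "sublist u x" by (meson le_SucI order_refl)
    then obtain v where v: "v \<in> power_realisations \<theta> K [a]" "x \<in> realisations \<theta> v" by auto
    \<comment> \<open>The word \<open>v\<close> has a realisation containing \<open>u\<close>;
      placing it between two copies of \<open>a\<close> puts \<open>u\<close> inside a word known to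
      be periodic.\<close>
    obtain q r where leg: "legal \<theta> ([a] @ q @ v @ r @ [a])"
      using legal_join[OF legal_letter legal_power_realisation[OF legal_letter v(1)] legal_letter] by blast
    obtain y z where yz: "y \<in> realisations \<theta> q" "z \<in> realisations \<theta> r" using realisations_ne by blast
    have V: "y @ x @ z \<in> realisations \<theta> (q @ v @ r)"
      using yz v by (intro realisations_append)
    obtain s t where st: "x = s @ u @ t" using x(2) by (auto simp: sublist_def)
    define W where "W = w1 @ (y @ x @ z) @ w2"
    define n where "n = length w1 + length y + length s"
    have nth: "W ! (n + k) = u ! k" if "k < length u" for k
      using that by (simp add: W_def n_def st nth_append)
    have "W ! (n + i) = W ! (n + i + d)"
      unfolding W_def d_def
      using periodic_between_returns[OF indep _ w(1,2) _ V, of "n + i"] leg w(3) i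
      by (simp add: n_def st d_def)
    then show ?thesis using nth[of i] nth[of "i + d"] i by (simp add: add.assoc)
  qed
  moreover have "d > 0" using w by (simp add: d_def)
  ultimately show ?thesis by blast
qed blast

end

section \<open>Uniform frequencies and uniqueness of the invariant measure\<close>

definition visits :: "(int \<Rightarrow> 'a) \<Rightarrow> 'a list \<Rightarrow> nat \<Rightarrow> real" where
  "visits x v n = (\<Sum>i<n. if window x (int i) (length v) = v then 1 else 0)"

context primitive_rs
begin

text \<open>For each \<open>\<epsilon>\<close> one length \<open>n\<close> has to work for all
  points simultaneously; integrating \<open>visits\<close> for this \<open>n\<close> determines
  every invariant measure up to \<open>\<epsilon>\<close>.\<close>

definition has_frequency :: "'a list \<Rightarrow> real \<Rightarrow> bool" where
  "has_frequency v \<alpha> \<longleftrightarrow>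
     (\<forall>\<epsilon>>0. \<exists>n\<ge>1. \<forall>x\<in>X. \<bar>visits x v n - real n * \<alpha>\<bar> \<le> real n * \<epsilon>)"

text \<open>By invariance, the integral of \<open>visits\<close> over \<open>n\<close> positions is
  \<open>n\<close> times the measure of the cylinder.\<close>

lemma invariant_measure_near_frequency:
  assumes inv: "invariant_prob T left_shift N" and n: "n \<ge> 1"
    and near: "\<And>x. x \<in> X \<Longrightarrow> \<bar>visits x v n - real n * \<alpha>\<bar> \<le> real n * \<epsilon>"
  shows "\<bar>measure N (cyl 0 v) - \<alpha>\<bar> \<le> \<epsilon>"
proof -
  interpret N: prob_space N using inv by (simp add: invariant_prob_def)
  have sets: "sets N = sets (borel_on T)" using inv by (simp add: invariant_prob_def)
  have sp: "space N = X" using sets_eq_imp_space_eq[OF sets] space_borel_T by simp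
  have cyl: "cyl k v \<in> sets N" for k using cyl_measurable sets by simp
  have int: "integrable N (\<lambda>x. \<Sum>i<n. indicator (cyl (int i) v) x :: real)"
    using cyl by (intro Bochner_Integration.integrable_sum integrable_real_indicator) (auto simp: N.emeasure_eq_measure)
  have "(\<integral>x. (\<Sum>i<n. indicator (cyl (int i) v) x) \<partial>N) = (\<Sum>i<n. measure N (cyl (int i) v))"
    using cyl by (subst Bochner_Integration.integral_sum) (auto intro!: integrable_real_indicator simp: N.emeasure_eq_measure)
  also have "\<dots> = real n * measure N (cyl 0 v)"
    by (subst invariant_measure_cyl[OF inv]) simp
  finally have eq: "(\<integral>x. (\<Sum>i<n. indicator (cyl (int i) v) x) \<partial>N) = real n * measure N (cyl 0 v)" .
  have vis: "(\<Sum>i<n. indicator (cyl (int i) v) x) = visits x v n" if "x \<in> X" for x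
    unfolding visits_def using that by (intro sum.cong) (auto simp: cyl_def indicator_def)
  have "(\<integral>x. (\<Sum>i<n. indicator (cyl (int i) v) x) \<partial>N) \<le> (\<integral>x. real n * \<alpha> + real n * \<epsilon> \<partial>N)"
  proof (intro integral_mono int)
    fix x assume "x \<in> space N"
    then show "(\<Sum>i<n. indicator (cyl (int i) v) x) \<le> real n * \<alpha> + real n * \<epsilon>"
      using near[of x] vis[of x] unfolding sp abs_le_iff by linarith
  qed simp
  moreover have "(\<integral>x. real n * \<alpha> - real n * \<epsilon> \<partial>N) \<le> (\<integral>x. (\<Sum>i<n. indicator (cyl (int i) v) x) \<partial>N)"
  proof (intro integral_mono int)
    fix x assume "x \<in> space N"
    then show "real n * \<alpha> - real n * \<epsilon> \<le> (\<Sum>i<n. indicator (cyl (int i) v) x)"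
      using near[of x] vis[of x] unfolding sp abs_le_iff by linarith
  qed simp
  ultimately have "real n * (\<alpha> - \<epsilon>) \<le> real n * measure N (cyl 0 v)" "real n * measure N (cyl 0 v) \<le> real n * (\<alpha> + \<epsilon>)"
    unfolding eq by (simp_all add: N.prob_space algebra_simps)
  then show ?thesis using n by (simp add: abs_le_iff)
qed

lemma unique_invariant_measure:
  assumes unif: "\<And>v. v \<noteq> [] \<Longrightarrow> \<exists>\<alpha>. has_frequency v \<alpha>"
    and inv: "invariant_prob T left_shift M" "invariant_prob T left_shift N"
  shows "M = N"
proof (rule measure_eqI_cyl)
  fix k and v :: "'a list" assume v: "v \<noteq> []"
  obtain \<alpha> where \<alpha>: "\<And>\<epsilon>. \<epsilon> > 0 \<Longrightarrow> \<exists>n\<ge>1. \<forall>x\<in>X. \<bar>visits x v n - real n * \<alpha>\<bar> \<le> real n * \<epsilon>"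
    using unif[OF v] unfolding has_frequency_def by blast
  have "measure M' (cyl 0 v) = \<alpha>" if "invariant_prob T left_shift M'" for M'
  proof -
    have "\<bar>measure M' (cyl 0 v) - \<alpha>\<bar> \<le> \<epsilon>" if "\<epsilon> > 0" for \<epsilon>
    proof -
      obtain n where n: "n \<ge> 1" "\<And>x. x \<in> X \<Longrightarrow> \<bar>visits x v n - real n * \<alpha>\<bar> \<le> real n * \<epsilon>"
        using \<alpha>[OF \<open>\<epsilon> > 0\<close>] by blast
      show ?thesis by (rule invariant_measure_near_frequency[OF \<open>invariant_prob T left_shift M'\<close> n])
    qed
    then have "\<bar>measure M' (cyl 0 v) - \<alpha>\<bar> \<le> 0" by (rule field_le_epsilon[where y = 0, simplified])
    then show ?thesis by simp
  qed
  then have "measure M (cyl 0 v) = measure N (cyl 0 v)" using inv by metis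
  then show "measure M (cyl k v) = measure N (cyl k v)"
    using invariant_measure_cyl[OF inv(1), of k v] invariant_measure_cyl[OF inv(2), of k v] by simp
qed (use inv in \<open>auto simp: invariant_prob_def\<close>)

subsection \<open>The periodic case\<close>

text \<open>Every point is a shift of every other: a legal word contains a period of each, and
  periodicity propagates the agreement. Counts over a full period are unaffected by the
  shift.\<close>

lemma uniform_if_periodic:
  assumes d: "d > 0" and per: "\<And>u i. legal \<theta> u \<Longrightarrow> i + d < length u \<Longrightarrow> u ! i = u ! (i + d)"
  shows "\<exists>\<alpha>. has_frequency v \<alpha>"
proof -
  have legal_window: "legal \<theta> (window x k n)" if "x \<in> X" "n \<ge> 1" for x k n
    using that by (simp add: rs_subshift_def)
  have x_per: "x (k + int d) = x k" if "x \<in> X" for x k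
    using per[OF legal_window[OF that, of "d + 1" k], of 0] by simp
  have x_nat: "x (int i) = L ! (j + i)" if x: "x \<in> X" and L: "legal \<theta> L" "\<And>i. i < d \<Longrightarrow> x (int i) = L ! (j + i)" "j + i < length L" for x L i j
    using L(3)
  proof (induction i rule: less_induct)
    case (less i)
    show ?case
    proof (cases "i < d")
      case False
      then have i: "i = (i - d) + d" by simp
      have "x (int i) = x (int (i - d) + int d)" using False by (simp add: of_nat_diff)
      also have "\<dots> = x (int (i - d))" by (rule x_per[OF x])
      also have "\<dots> = L ! (j + (i - d))" by (rule less.IH) (use less.prems False d in auto)
      also have "\<dots> = L ! (j + (i - d) + d)" using per[OF L(1), of "j + (i - d)"] less.prems False by auto
      finally show ?thesis using False by simp
    qed (rule L(2))
  qed
  have x_mod: "x k = x (k mod int d)" if "x \<in> X" for x k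
  proof -
    have "x (k + int d * m) = x k" for k and m :: int
    proof (induction m arbitrary: k rule: int_induct[of _ 0])
      case (step1 i) then show ?case using x_per[OF that, of "k + int d * i"] by (simp add: algebra_simps)
    next
      case (step2 i) then show ?case using x_per[OF that, of "k + int d * (i - 1)"] by (simp add: algebra_simps)
    qed simp
    from this[of "k mod int d" "k div int d"] show ?thesis by simp
  qed
  have orbit: "\<exists>s :: nat. \<forall>k. y k = x (k + int s)" if x: "x \<in> X" and y: "y \<in> X" for x y
  proof -
    \<comment> \<open>One occurrence of \<open>window y 0 d\<close> after
      \<open>window x 0 d\<close> gives the shift \<open>s\<close>; the repeated copy fills the
      third slot of \<open>legal_join\<close>.\<close>
    obtain q r where L: "legal \<theta> (window x 0 d @ q @ window y 0 d @ r @ window y 0 d)"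
      using legal_join legal_window x y d by (metis Suc_leI One_nat_def)
    define L where "L = window x 0 d @ q @ window y 0 d @ r @ window y 0 d"
    define s where "s = d + length q"
    have "y k = x (k + int s)" for k
    proof -
      define i where "i = nat (k mod int d)"
      have i: "i < d" "int i = k mod int d" using d by (auto simp: i_def nat_less_iff)
      have "y k = y (int i)" using x_mod[OF y, of k] i by simp
      also have "\<dots> = L ! (s + i)" using i(1) by (simp add: L_def s_def nth_append)
      also have "\<dots> = x (int (s + i))"
        using x_nat[OF x, of L 0 "s + i"] L i(1) by (auto simp: L_def[symmetric]) (auto simp: L_def nth_append s_def)
      also have "\<dots> = x ((int s + k) mod int d)"
        using x_mod[OF x, of "int (s + i)"] i(2) by (simp add: mod_add_right_eq)
      also have "\<dots> = x (k + int s)" using x_mod[OF x, of "int s + k"] by (simp add: add.commute)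
      finally show ?thesis .
    qed
    then show ?thesis by blast
  qed
  obtain x where x: "x \<in> X" using subshift_ne by blast
  define F where "F i = (if window x i (length v) = v then 1 else (0::real))" for i :: int
  have F_per: "F (i + int d) = F i" for i
  proof -
    have "x (i + int d + int j) = x (i + int j)" for j
      using x_per[OF x, of "i + int j"] by (simp add: algebra_simps)
    then have "window x (i + int d) n = window x i n" for n by (simp add: window_def)
    then show ?thesis by (simp add: F_def)
  qed
  have F_shift: "(\<Sum>i<d. F (int i + int s)) = (\<Sum>i<d. F (int i))" for s
  proof (induction s)
    case (Suc s)
    have *: "(\<Sum>i<n. F (int i + int (Suc s))) = (\<Sum>i<n. F (int i + int s)) + F (int n + int s) - F (int s)" for n
      by (induction n) (auto simp: algebra_simps)
    show ?case using Suc *[of d] F_per[of "int s"] by (simp add: add.commute)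
  qed simp
  have "visits y v d = visits x v d" if y: "y \<in> X" for y
  proof -
    obtain s :: nat where s: "\<And>k. y k = x (k + int s)" using orbit[OF x y] by blast
    have "window y k n = window x (k + int s) n" for k n
      by (simp add: window_def s add.commute add.left_commute)
    then have "visits y v d = (\<Sum>i<d. F (int i + int s))" by (simp add: visits_def F_def)
    then show ?thesis unfolding F_shift by (simp add: visits_def F_def)
  qed
  \<comment> \<open>With \<open>n = d\<close> and the frequency taken over one period, the error is
    exactly zero.\<close>
  then show ?thesis using d unfolding has_frequency_def
    by (intro exI[of _ "visits x v d / d"] allI impI exI[of _ d]) (auto simp: Suc_le_eq)
qed

end

subsection \<open>The deterministic case\<close>

lemma iter_subst_add: "iter_subst f (m + k) a = concat (map (iter_subst f k) (iter_subst f m a))"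
proof (induction k)
  case 0
  have "concat (map (iter_subst f 0) u) = u" for u by (induction u) auto
  then show ?case by simp
next
  case (Suc k)
  then show ?case by (simp add: concat_map_concat del: iter_subst.simps(2)) (simp add: concat_map_concat)
qed

lemma sum_lessThan_add:
  fixes F :: "nat \<Rightarrow> real"
  shows "(\<Sum>r<m + k. F r) = (\<Sum>r<m. F r) + (\<Sum>r<k. F (m + r))"
  by (induction k) auto

text \<open>Windows truncated by the end of \<open>u\<close> are shorter than \<open>v\<close> and do not contribute.\<close>

definition hits :: "'a list \<Rightarrow> 'a list \<Rightarrow> real" where
  "hits v u = (\<Sum>r<length u. if take (length v) (drop r u) = v then 1 else 0)"

lemma hits_append:
  "hits v (x @ y) = (\<Sum>r<length x. if take (length v) (drop r (x @ y)) = v then 1 else 0) + hits v y"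
proof -
  have "hits v (x @ y) = (\<Sum>r<length x + length y. if take (length v) (drop r (x @ y)) = v then 1 else 0)"
    by (simp add: hits_def)
  also have "\<dots> = (\<Sum>r<length x. if take (length v) (drop r (x @ y)) = v then 1 else 0) +
      (\<Sum>r<length y. if take (length v) (drop (length x + r) (x @ y)) = v then 1 else 0)"
    by (rule sum_lessThan_add)
  finally show ?thesis by (simp add: hits_def)
qed

lemma hits_nonneg: "0 \<le> hits v u"
  by (auto simp: hits_def intro: sum_nonneg)

lemma hits_le_length: "hits v u \<le> length u"
proof -
  have "hits v u \<le> (\<Sum>r<length u. 1)" unfolding hits_def by (intro sum_mono) auto
  then show ?thesis by simp
qed

text \<open>Only windows crossing the end of \<open>x\<close> make a difference, and at most
  \<open>length v\<close> of them start inside \<open>x\<close>.\<close>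

lemma hits_prefix_part:
  "hits v x \<le> (\<Sum>r<length x. if take (length v) (drop r (x @ y)) = v then 1 else 0)"
  "(\<Sum>r<length x. if take (length v) (drop r (x @ y)) = v then 1 else 0) \<le> hits v x + length v"
proof -
  let ?l = "length v"
  have eq: "take ?l (drop r (x @ y)) = take ?l (drop r x)" if "r + ?l \<le> length x" for r
    using that by simp
  have le: "r + ?l \<le> length x" if "take ?l (drop r x) = v" "r < length x" for r
    using arg_cong[OF that(1), of length] that(2) by auto
  show "hits v x \<le> (\<Sum>r<length x. if take ?l (drop r (x @ y)) = v then 1 else 0)"
    unfolding hits_def
  proof (rule sum_mono)
    fix r assume "r \<in> {..<length x}"
    then show "(if take ?l (drop r x) = v then 1 else 0) \<le> (if take ?l (drop r (x @ y)) = v then 1 else (0::real))"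
      using le[of r] eq[of r] by (cases "take ?l (drop r x) = v") (simp_all del: drop_append)
  qed
  have "(\<Sum>r<length x. if take ?l (drop r (x @ y)) = v then 1 else 0) \<le>
      (\<Sum>r<length x. (if take ?l (drop r x) = v then 1 else 0) + (if length x < r + ?l then 1 else (0::real)))"
    using eq by (intro sum_mono) (auto simp: not_le)
  also have "\<dots> = hits v x + (\<Sum>r<length x. if length x < r + ?l then 1 else (0::real))"
    by (simp add: sum.distrib hits_def)
  also have "(\<Sum>r<length x. if length x < r + ?l then 1 else (0::real)) = card {r \<in> {..<length x}. length x < r + ?l}"
    by (subst sum.inter_filter[symmetric]) auto
  also have "card {r \<in> {..<length x}. length x < r + ?l} \<le> card {length x - ?l..<length x}"
    by (intro card_mono) auto
  also have "\<dots> \<le> ?l" by simp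
  finally show "(\<Sum>r<length x. if take ?l (drop r (x @ y)) = v then 1 else 0) \<le> hits v x + ?l" by simp
qed

lemma hits_factor:
  "hits v u \<le> hits v (p @ u @ s)"
  "hits v (p @ u @ s) \<le> hits v u + real (length p) + real (length s) + real (length v)"
proof -
  have "hits v (p @ u @ s) \<le> real (length p) + hits v (u @ s)"
  proof -
    have "(\<Sum>r<length p. if take (length v) (drop r (p @ u @ s)) = v then 1 else 0) \<le> (\<Sum>r<length p. 1 :: real)"
      by (intro sum_mono) auto
    then show ?thesis by (simp add: hits_append[of v p])
  qed
  moreover have "hits v (u @ s) \<le> hits v u + length v + length s"
    using hits_prefix_part(2)[of v u s] hits_le_length[of v s] by (simp add: hits_append)
  ultimately show "hits v (p @ u @ s) \<le> hits v u + real (length p) + real (length s) + real (length v)" by simp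
  have "hits v (u @ s) \<le> hits v (p @ u @ s)"
    unfolding hits_append[of v p] by (simp add: sum_nonneg)
  moreover have "hits v u \<le> hits v (u @ s)"
    using hits_prefix_part(1)[of v u s] hits_nonneg[of v s] by (simp add: hits_append)
  ultimately show "hits v u \<le> hits v (p @ u @ s)" by simp
qed

lemma visits_near_hits: "\<bar>visits x v n - hits v (window x 0 n)\<bar> \<le> length v"
proof -
  have "visits x v n = (\<Sum>r<length (window x 0 n). if take (length v) (drop r (window x 0 n @ window x (int n) (length v))) = v then 1 else 0)"
  proof -
    have "window x 0 n @ window x (int n) (length v) = window x 0 (n + length v)"
      by (rule nth_equalityI) (auto simp: nth_append)
    then show ?thesis unfolding visits_def length_window
      by (intro sum.cong refl) (simp add: take_drop_window)
  qed
  then show ?thesis using hits_prefix_part[of v "window x 0 n" "window x (int n) (length v)"] by simp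
qed

lemma concat_map_covers_prefix:
  assumes "\<And>a. length (g a) \<le> B" "concat (map g y) = u @ t"
  shows "\<exists>y' s. prefix y' y \<and> concat (map g y') = u @ s \<and> length s \<le> B"
  using assms(2)
proof (induction y arbitrary: u)
  case (Cons a y)
  then consider s where "g a = u @ s" | u' where "u = g a @ u'" "concat (map g y) = u' @ t"
    by (auto simp: append_eq_append_conv2)
  then show ?case
  proof cases
    case 1
    then show ?thesis using assms(1)[of a] by (intro exI[of _ "[a]"] exI[of _ s]) auto
  next
    case 2
    from Cons.IH[OF 2(2)] obtain y' s where "prefix y' y" "concat (map g y') = u' @ s" "length s \<le> B" by blast
    then show ?thesis using 2 by (intro exI[of _ "a # y'"] exI[of _ s]) auto
  qed
qed simp

text \<open>Desubstitution of a factor: keeping just the blocks that meet \<open>u\<close> leaves an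
  excess of at most one block at either end.\<close>

lemma concat_map_covers:
  assumes B: "\<And>a. length (g a) \<le> B" and "concat (map g y) = p0 @ u @ t0"
  shows "\<exists>y' p s. sublist y' y \<and> concat (map g y') = p @ u @ s \<and> length p \<le> B \<and> length s \<le> B"
  using assms(2)
proof (induction y arbitrary: p0)
  case (Cons a y)
  then consider p1 where "p0 = g a @ p1" "concat (map g y) = p1 @ u @ t0" | t where "g a = p0 @ t"
    by (auto simp: append_eq_append_conv2)
  then show ?case
  proof cases
    case 1
    from Cons.IH[OF 1(2)] show ?thesis by (meson sublist_Cons_right)
  next
    case 2
    obtain y' s where "prefix y' (a # y)" "concat (map g y') = (p0 @ u) @ s" "length s \<le> B"
      using concat_map_covers_prefix[where g = g and y = "a # y" and u = "p0 @ u" and t = t0, OF B] Cons.prems by auto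
    then show ?thesis using B[of a] 2 by (intro exI[of _ y'] exI[of _ p0] exI[of _ s]) auto
  qed
qed simp

locale deterministic_rs = primitive_rs \<theta> for \<theta> :: "'a::finite \<Rightarrow> 'a list set" +
  fixes f :: "'a \<Rightarrow> 'a list"
  assumes det: "\<theta> a = {f a}"
begin

abbreviation "g \<equiv> iter_subst f"

lemma f_ne: "f a \<noteq> []"
  using nonerasing[of a] det[of a] by auto

lemma g_ne: "g k a \<noteq> []"
  by (rule iter_subst_ne[OF f_ne])

lemma listset_det: "listset (map \<theta> u) = {map f u}"
  by (induction u) (auto simp: set_Cons_def det)

lemma realisations_det: "realisations \<theta> u = {concat (map f u)}"
  by (simp add: realisations_def listset_det)

lemma power_realisations_det: "power_realisations \<theta> k u = {concat (map (g k) u)}"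
proof (induction k)
  case 0
  have "concat (map (g 0) u) = u" by (induction u) auto
  then show ?case by simp
next
  case (Suc k)
  then show ?case by (simp add: realisations_det concat_map_concat)
qed

lemma occurs_eventually:
  assumes "legal \<theta> u"
  shows "\<exists>K. \<forall>k\<ge>K. \<forall>b. sublist u (g k b)"
  using legal_eventually_everywhere[OF assms] by (simp add: power_realisations_det)

lemma legal_inflation: "legal \<theta> u \<Longrightarrow> legal \<theta> (concat (map (g k) u))"
  using legal_power_realisation[of u _ k] by (simp add: power_realisations_det)

lemma window_legal:
  assumes "w \<in> legal_words \<theta> l" "l \<ge> 1" "z \<in> set (induced_word l (map (g k) w))"
  shows "z \<in> legal_words \<theta> l"
proof -
  have "length z = l"
    using length_mem_induced_word[of "map (g k) w" l z] assms g_ne by (auto simp: legal_words_def)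
  moreover have "sublist z (concat (map (g k) w))"
    using assms(3) sublist_order.order_trans[OF sublist_take sublist_drop] by (auto simp: induced_word_def)
  moreover have "z \<noteq> []" using \<open>length z = l\<close> assms(2) by auto
  ultimately show ?thesis
    using legal_sublist[OF legal_inflation[of w k], of z] assms(1) by (auto simp: legal_words_def)
qed

text \<open>There are finitely many words to consider, so a common exponent exists. Each already
  occurs inside the image of the first letter, which is where the windows start.\<close>

lemma all_windows_occur:
  assumes "l \<ge> 1"
  shows "\<exists>K. \<forall>k\<ge>K. (\<forall>a b. a \<in> set (g k b)) \<and>
    (\<forall>w\<in>legal_words \<theta> l. \<forall>z\<in>legal_words \<theta> l. z \<in> set (induced_word l (map (g k) w)))"
proof -
  obtain K1 where K1: "\<And>z k b. legal \<theta> z \<Longrightarrow> k \<ge> K1 z \<Longrightarrow> sublist z (g k b)"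
    using occurs_eventually by metis
  define U where "U = legal_words \<theta> l \<union> range (\<lambda>a. [a])"
  have U: "finite U" "U \<noteq> {}" unfolding U_def
    using finite_subset[OF _ finite_words[of l], of "legal_words \<theta> l"] by (auto simp: legal_words_def)
  define K where "K = Max (K1 ` U)"
  have sub: "sublist z (g k b)" if "z \<in> U" "k \<ge> K" for z k b
  proof (rule K1)
    show "legal \<theta> z" using that legal_letter by (auto simp: U_def legal_words_def)
    show "K1 z \<le> k" using Max_ge[of "K1 ` U" "K1 z"] U that by (simp add: K_def)
  qed
  have "z \<in> set (induced_word l (map (g k) w))" if "k \<ge> K" "w \<in> legal_words \<theta> l" "z \<in> legal_words \<theta> l" for k w z
  proof -
    have "length w = l" using that(2) by (simp add: legal_words_def)
    then obtain a v where w: "w = a # v" using assms by (cases w) auto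
    have "sublist z (g k a)" using sub[of z k a] that by (simp add: U_def)
    then obtain p s where ps: "g k a = p @ z @ s" by (auto simp: sublist_def)
    have z: "length z = l" "z \<noteq> []" using that(3) assms by (auto simp: legal_words_def)
    have "z = take l (drop (length p) (concat (map (g k) w)))" using ps z by (simp add: w)
    moreover have "length p < length (hd (map (g k) w))" using ps z assms by (simp add: w)
    ultimately show ?thesis unfolding induced_word_def by force
  qed
  moreover have "a \<in> set (g k b)" if "k \<ge> K" for k a b
    using sub[of "[a]" k b] that set_mono_sublist[of "[a]" "g k b"] by (auto simp: U_def)
  ultimately show ?thesis by blast
qed

lemma length_g_add: "length (g (m + k) a) = (\<Sum>e\<leftarrow>g m a. length (g k e))"
  by (simp add: iter_subst_add length_concat comp_def)

text \<open>For large \<open>m\<close> the word \<open>g m b\<close> contains every letter, so at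
  level \<open>j = k - m\<close> all images are at most as long as \<open>g k b\<close>. Inflating
  by \<open>m\<close> multiplies the maximal length by at most \<open>B\<close>; going from
  \<open>j\<close> to \<open>k\<close> and on to \<open>m + k\<close> costs the factor
  \<open>B * B\<close>, independent of \<open>k\<close>.\<close>

lemma length_ratio:
  "\<exists>K. \<forall>m\<ge>K. \<exists>\<eta>>0. \<forall>k\<ge>m. \<forall>a b. \<eta> * real (length (g (m + k) a)) \<le> real (length (g k b))"
proof -
  obtain K where K: "\<And>k a b. k \<ge> K \<Longrightarrow> a \<in> set (g k b)" using all_windows_occur[of 1] by auto
  have "\<exists>\<eta>>0. \<forall>k\<ge>m. \<forall>a b. \<eta> * real (length (g (m + k) a)) \<le> real (length (g k b))" if m: "m \<ge> K" for m
  proof -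
    define B where "B = Max (range (\<lambda>a. length (g m a)))"
    have B: "length (g m a) \<le> B" for a unfolding B_def by (intro Max_ge) auto
    have B1: "B > 0" using B[of undefined] g_ne[of m undefined] by (metis gr0I le_zero_eq length_0_conv)
    have le: "length (g (m + j) a) \<le> B * N" if "\<And>e. length (g j e) \<le> N" for j a N
    proof -
      have "(\<Sum>e\<leftarrow>u. length (g j e)) \<le> length u * N" for u
        by (induction u) (use that in \<open>auto intro: add_mono\<close>)
      then have "length (g (m + j) a) \<le> length (g m a) * N" unfolding length_g_add .
      also have "\<dots> \<le> B * N" using B by simp
      finally show ?thesis .
    qed
    have B2: "1 / (real B * real B) * real (length (g (m + k) a)) \<le> real (length (g k b))" if "k \<ge> m" for k a b
    proof -
      obtain j where k: "k = m + j" using le_Suc_ex[OF \<open>k \<ge> m\<close>] by blast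
      have 1: "length (g j e) \<le> length (g k b)" for e
      proof -
        have "length (g j e) \<in> set (map (\<lambda>e. length (g j e)) (g m b))" using K[OF m, of e b] by auto
        from member_le_sum_list[OF this] show ?thesis unfolding k length_g_add by simp
      qed
      have "length (g (m + j) e) \<le> B * length (g k b)" for e by (rule le) (rule 1)
      then have "length (g k e) \<le> B * length (g k b)" for e by (simp only: k)
      then have "length (g (m + k) a) \<le> B * (B * length (g k b))" by (rule le)
      then have "real (length (g (m + k) a)) \<le> real (B * (B * length (g k b)))" by (simp only: of_nat_le_iff)
      then show ?thesis using B1 by (simp add: field_simps)
    qed
    have "1 / (real B * real B) > 0" using B1 by simp
    then show ?thesis using B2 by (intro exI[of _ "1 / (real B * real B)"] conjI allI impI)
  qed
  then show ?thesis by blast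
qed

text \<open>Inflating \<open>m\<close> times more replaces the ratios by weighted averages in which every old ratio has a
  weight of at least \<open>\<eta>\<close>, so that their oscillation contracts by the factor \<open>1 - \<eta>\<close>.\<close>

lemma frequencies_converge:
  assumes l: "length v = l" "l \<ge> 1"
  shows "\<exists>\<alpha>. \<forall>\<epsilon>>0. \<exists>k. \<forall>w\<in>legal_words \<theta> l.
    \<bar>real (count_list (induced_word l (map (g k) w)) v) - \<alpha> * real (length (g k (hd w)))\<bar> \<le> \<epsilon> * real (length (g k (hd w)))"
proof -
  define I where "I = legal_words \<theta> l"
  have I: "finite I" "I \<noteq> {}" unfolding I_def
    using finite_subset[OF _ finite_words[of l], of "legal_words \<theta> l"] legal_words_ne[OF l(2)] by (auto simp: legal_words_def)
  define c where "c k w = real (count_list (induced_word l (map (g k) w)) v)" for k w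
  define n where "n k w = real (length (g k (hd w)))" for k and w :: "'a list"
  have n_pos: "n k w > 0" for k w using g_ne by (simp add: n_def)
  obtain K1 where K1: "\<And>k w z. k \<ge> K1 \<Longrightarrow> w \<in> I \<Longrightarrow> z \<in> I \<Longrightarrow> z \<in> set (induced_word l (map (g k) w))"
    using all_windows_occur[OF l(2)] unfolding I_def by blast
  obtain K2 where K2: "\<And>m. m \<ge> K2 \<Longrightarrow> \<exists>\<eta>>0. \<forall>k\<ge>m. \<forall>a b. \<eta> * real (length (g (m + k) a)) \<le> real (length (g k b))"
    using length_ratio by blast
  define m where "m = max K1 K2"
  obtain \<eta> where \<eta>: "\<eta> > 0" "\<And>k a b. k \<ge> m \<Longrightarrow> \<eta> * real (length (g (m + k) a)) \<le> real (length (g k b))"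
    using K2[of m] by (auto simp: m_def)
  have \<eta>1: "\<eta> \<le> 1"
  proof -
    have "length (g m a) \<le> length (g (m + m) a)" for a
    proof -
      have "(\<Sum>e\<leftarrow>u. length (g m e)) \<ge> length u" for u
      proof (induction u)
        case (Cons e u)
        moreover have "length (g m e) \<ge> 1" using g_ne[of m e] by (simp add: Suc_le_eq)
        ultimately show ?case by simp
      qed simp
      then show ?thesis unfolding length_g_add .
    qed
    from this[of undefined] have "\<eta> * real (length (g (m + m) undefined)) \<le> 1 * real (length (g (m + m) undefined))"
      using \<eta>(2)[of m undefined undefined] by linarith
    then show ?thesis using g_ne[of "m + m" undefined] by (simp only: mult_le_cancel_right) auto
  qed
  define zs where "zs w = induced_word l (map (g m) w)" for w
  have zs: "set (zs w) \<subseteq> I" if "w \<in> I" for w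
    using window_legal[OF _ l(2)] that unfolding I_def zs_def by blast
  have lenI: "length w = l" if "w \<in> I" for w using that by (simp add: I_def legal_words_def)
  have c_add: "c (m + k) w = (\<Sum>z\<leftarrow>zs w. c k z)" if "w \<in> I" for k w
  proof -
    have "g (m + k) = (\<lambda>a. concat (map (g k) (g m a)))" by (rule ext) (rule iter_subst_add)
    then have "induced_word l (map (g (m + k)) w) = concat (map (\<lambda>z. induced_word l (map (g k) z)) (zs w))"
      unfolding zs_def using induced_word_comp[of "g m" "g k" w l, OF g_ne g_ne lenI[OF that] l(2)] by simp
    moreover have "real (count_list (concat (map F us)) v) = (\<Sum>z\<leftarrow>us. real (count_list (F z) v))"
      for us and F :: "'a list \<Rightarrow> 'a list list" by (induction us) auto
    ultimately show ?thesis by (simp add: c_def)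
  qed
  have n_add: "n (m + k) w = (\<Sum>z\<leftarrow>zs w. n k z)" if "w \<in> I" for k w
  proof -
    have "w \<noteq> []" using lenI[OF that] l(2) by auto
    then have "map hd (zs w) = g m (hd w)"
      unfolding zs_def using map_hd_induced_word[OF l(2), of "map (g m) w"] by (simp add: list.map_sel)
    then have "(\<Sum>z\<leftarrow>zs w. n k z) = (\<Sum>e\<leftarrow>g m (hd w). real (length (g k e)))"
      unfolding n_def by (metis (no_types, lifting) list.map_comp map_eq_conv comp_apply)
    moreover have "(\<Sum>e\<leftarrow>us. real (length (g k e))) = real (\<Sum>e\<leftarrow>us. length (g k e))" for us
      by (induction us) auto
    ultimately show ?thesis by (simp add: n_def length_g_add)
  qed
  have contract: "\<exists>lo' hi'. lo \<le> lo' \<and> hi' \<le> hi \<and> lo' \<le> hi' \<and> hi' - lo' \<le> (1 - \<eta>) * (hi - lo) \<and>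
      (\<forall>w\<in>I. lo' * n (m + k) w \<le> c (m + k) w \<and> c (m + k) w \<le> hi' * n (m + k) w)"
    if k: "k \<ge> m" and lh: "lo \<le> hi" and bnd: "\<And>w. w \<in> I \<Longrightarrow> lo * n k w \<le> c k w \<and> c k w \<le> hi * n k w" for k lo hi
  proof -
    \<comment> \<open>Any fixed word will do, since it occurs among the windows of every
      \<open>w\<close> after \<open>m\<close> steps. Its ratio \<open>t\<close> pulls the upper
      bound down by \<open>\<eta> * (hi - t)\<close> and the lower one up by
      \<open>\<eta> * (t - lo)\<close>, together \<open>\<eta> * (hi - lo)\<close>.\<close>
    obtain w0 where w0: "w0 \<in> I" using I by blast
    define t where "t = c k w0 / n k w0"
    have t: "lo \<le> t" "t \<le> hi" "c k w0 = t * n k w0"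
      using bnd[OF w0] n_pos[of k w0] by (auto simp: t_def field_simps)
    have up: "c (m + k) w \<le> (hi - \<eta> * (hi - t)) * n (m + k) w" if w: "w \<in> I" for w
    proof -
      have w0z: "w0 \<in> set (zs w)" unfolding zs_def using K1[of m w w0] w w0 by (simp add: m_def)
      have "(hi - t) * n k w0 = hi * n k w0 - c k w0" using t by (simp add: algebra_simps)
      also have "\<dots> \<le> (\<Sum>z\<leftarrow>zs w. hi * n k z - c k z)"
      proof -
        have "(if z \<in> I then hi * n k z - c k z else 0) \<ge> 0" for z using bnd[of z] by auto
        from member_le_sum_list_nonneg[where h = "\<lambda>z. if z \<in> I then hi * n k z - c k z else 0", OF w0z this]
        have "hi * n k w0 - c k w0 \<le> (\<Sum>z\<leftarrow>zs w. if z \<in> I then hi * n k z - c k z else 0)" using w0 by simp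
        also have "\<dots> = (\<Sum>z\<leftarrow>zs w. hi * n k z - c k z)"
          using zs[OF w] by (intro arg_cong[where f = sum_list] map_cong) auto
        finally show ?thesis .
      qed
      also have "\<dots> = hi * n (m + k) w - c (m + k) w"
        unfolding n_add[OF w] c_add[OF w] by (simp add: sum_list_subtractf sum_list_const_mult)
      finally have "c (m + k) w \<le> hi * n (m + k) w - (hi - t) * n k w0" by simp
      also have "\<dots> \<le> hi * n (m + k) w - (hi - t) * (\<eta> * n (m + k) w)"
        using \<eta>(2)[OF k] t(2) unfolding n_def by (intro diff_left_mono mult_left_mono) auto
      finally show ?thesis by (simp add: algebra_simps)
    qed
    have down: "(lo + \<eta> * (t - lo)) * n (m + k) w \<le> c (m + k) w" if w: "w \<in> I" for w
    proof -
      have w0z: "w0 \<in> set (zs w)" unfolding zs_def using K1[of m w w0] w w0 by (simp add: m_def)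
      have "(t - lo) * n k w0 = c k w0 - lo * n k w0" using t by (simp add: algebra_simps)
      also have "\<dots> \<le> (\<Sum>z\<leftarrow>zs w. c k z - lo * n k z)"
      proof -
        have "(if z \<in> I then c k z - lo * n k z else 0) \<ge> 0" for z using bnd[of z] by auto
        from member_le_sum_list_nonneg[where h = "\<lambda>z. if z \<in> I then c k z - lo * n k z else 0", OF w0z this]
        have "c k w0 - lo * n k w0 \<le> (\<Sum>z\<leftarrow>zs w. if z \<in> I then c k z - lo * n k z else 0)" using w0 by simp
        also have "\<dots> = (\<Sum>z\<leftarrow>zs w. c k z - lo * n k z)"
          using zs[OF w] by (intro arg_cong[where f = sum_list] map_cong) auto
        finally show ?thesis .
      qed
      also have "\<dots> = c (m + k) w - lo * n (m + k) w"
        unfolding n_add[OF w] c_add[OF w] by (simp add: sum_list_subtractf sum_list_const_mult)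
      finally have "lo * n (m + k) w + (t - lo) * n k w0 \<le> c (m + k) w" by simp
      moreover have "(t - lo) * (\<eta> * n (m + k) w) \<le> (t - lo) * n k w0"
        using \<eta>(2)[OF k] t(1) unfolding n_def by (intro mult_left_mono) auto
      ultimately show ?thesis by (simp add: algebra_simps)
    qed
    have "\<eta> * (hi - t) \<ge> 0" "\<eta> * (t - lo) \<ge> 0" using \<eta>(1) t by auto
    moreover have "(1 - \<eta>) * (hi - lo) \<ge> 0" using \<eta>1 lh by simp
    moreover have "(hi - \<eta> * (hi - t)) - (lo + \<eta> * (t - lo)) = (1 - \<eta>) * (hi - lo)" by (simp add: algebra_simps)
    ultimately show ?thesis
      by (intro exI[of _ "lo + \<eta> * (t - lo)"] exI[of _ "hi - \<eta> * (hi - t)"]) (use up down in auto)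
  qed
  \<comment> \<open>The levels are \<open>m * Suc j\<close> rather than \<open>m * j\<close> because
    the contraction step requires a level of at least \<open>m\<close>; the initial bounds are
    \<open>(0, 1)\<close>.\<close>
  define good where "good j p \<longleftrightarrow> fst p \<le> snd p \<and>
    (\<forall>w\<in>I. fst p * n (m * Suc j) w \<le> c (m * Suc j) w \<and> c (m * Suc j) w \<le> snd p * n (m * Suc j) w)"
    for j and p :: "real \<times> real"
  have "\<exists>F. \<forall>j. good j (F j) \<and> (fst (F j) \<le> fst (F (Suc j)) \<and> snd (F (Suc j)) \<le> snd (F j) \<and>
      snd (F (Suc j)) - fst (F (Suc j)) \<le> (1 - \<eta>) * (snd (F j) - fst (F j)))"
  proof (rule dependent_nat_choice)
    have "c k w \<le> n k w" if "w \<in> I" for k w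
    proof -
      have "w \<noteq> []" using lenI[OF that] l(2) by auto
      then show ?thesis using count_le_length[of "induced_word l (map (g k) w)" v]
        by (simp add: c_def n_def length_induced_word list.map_sel)
    qed
    moreover have "c k w \<ge> 0" for k w by (simp add: c_def)
    ultimately show "\<exists>p. good 0 p" by (intro exI[of _ "(0, 1)"]) (auto simp: good_def)
    fix p j assume p: "good j p"
    have "m * Suc j \<ge> m" by simp
    from contract[OF this, of "fst p" "snd p"] p obtain lo' hi' where
      "fst p \<le> lo'" "hi' \<le> snd p" "lo' \<le> hi'" "hi' - lo' \<le> (1 - \<eta>) * (snd p - fst p)"
      "\<forall>w\<in>I. lo' * n (m + m * Suc j) w \<le> c (m + m * Suc j) w \<and> c (m + m * Suc j) w \<le> hi' * n (m + m * Suc j) w"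
      unfolding good_def by blast
    then show "\<exists>q. good (Suc j) q \<and> (fst p \<le> fst q \<and> snd q \<le> snd p \<and> snd q - fst q \<le> (1 - \<eta>) * (snd p - fst p))"
      by (intro exI[of _ "(lo', hi')"]) (auto simp: good_def)
  qed
  then obtain F where F: "\<And>j. good j (F j)" "\<And>j. fst (F j) \<le> fst (F (Suc j))" "\<And>j. snd (F (Suc j)) \<le> snd (F j)"
      "\<And>j. snd (F (Suc j)) - fst (F (Suc j)) \<le> (1 - \<eta>) * (snd (F j) - fst (F j))" by blast
  have mono: "fst (F i) \<le> fst (F j)" "snd (F j) \<le> snd (F i)" if "i \<le> j" for i j
    using that F(2,3) by (auto intro: lift_Suc_mono_le[of "\<lambda>j. fst (F j)"] lift_Suc_antimono_le[of "\<lambda>j. snd (F j)"])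
  have fs: "fst (F i) \<le> snd (F j)" for i j
    using mono(1)[of i "max i j"] mono(2)[of j "max i j"] F(1)[of "max i j"] by (auto simp: good_def)
  define \<alpha> where "\<alpha> = (SUP j. fst (F j))"
  have bdd: "bdd_above (range (\<lambda>j. fst (F j)))" using fs by (intro bdd_aboveI2)
  have \<alpha>: "fst (F j) \<le> \<alpha>" "\<alpha> \<le> snd (F j)" for j
    unfolding \<alpha>_def using fs bdd by (auto intro: cSUP_upper cSUP_least)
  have width: "snd (F j) - fst (F j) \<le> (1 - \<eta>) ^ j * (snd (F 0) - fst (F 0))" for j
  proof (induction j)
    case (Suc j)
    have "(1 - \<eta>) * (snd (F j) - fst (F j)) \<le> (1 - \<eta>) * ((1 - \<eta>) ^ j * (snd (F 0) - fst (F 0)))"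
      using Suc \<eta>1 by (intro mult_left_mono) auto
    then show ?case using F(4)[of j] by (simp add: mult.assoc)
  qed simp
  have "\<exists>k. \<forall>w\<in>I. \<bar>c k w - \<alpha> * n k w\<bar> \<le> \<epsilon> * n k w" if \<epsilon>: "\<epsilon> > 0" for \<epsilon>
  proof -
    have "(\<lambda>j. (1 - \<eta>) ^ j * (snd (F 0) - fst (F 0))) \<longlonglongrightarrow> 0 * (snd (F 0) - fst (F 0))"
      using \<eta>(1) \<eta>1 by (intro tendsto_mult LIMSEQ_realpow_zero tendsto_const) auto
    then have "\<forall>\<^sub>F j in sequentially. (1 - \<eta>) ^ j * (snd (F 0) - fst (F 0)) < \<epsilon>"
      using \<epsilon> by (intro order_tendstoD(2)) auto
    then obtain j where "(1 - \<eta>) ^ j * (snd (F 0) - fst (F 0)) < \<epsilon>" using eventually_happens' by force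
    then have j: "snd (F j) - fst (F j) \<le> \<epsilon>" using width[of j] by linarith
    have "\<bar>c (m * Suc j) w - \<alpha> * n (m * Suc j) w\<bar> \<le> \<epsilon> * n (m * Suc j) w" if w: "w \<in> I" for w
    proof -
      let ?n = "n (m * Suc j) w"
      have b: "fst (F j) * ?n \<le> c (m * Suc j) w" "c (m * Suc j) w \<le> snd (F j) * ?n"
        using F(1)[of j] w by (auto simp: good_def)
      have "snd (F j) * ?n \<le> (\<alpha> + \<epsilon>) * ?n" "(\<alpha> - \<epsilon>) * ?n \<le> fst (F j) * ?n"
        using \<alpha>[of j] j n_pos[of "m * Suc j" w] by (auto intro!: mult_right_mono)
      then show ?thesis using b by (simp add: abs_le_iff algebra_simps)
    qed
    then show ?thesis by blast
  qed
  then show ?thesis unfolding c_def n_def I_def by blast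
qed

text \<open>A long window is, up to bounded ends, a concatenation of blocks \<open>g k a\<close> for
  a fixed \<open>k\<close>. Within each block the hits are counted by the induced word of the next
  \<open>l\<close> letters, where \<open>frequencies_converge\<close> gives the right
  proportion.\<close>

lemma uniform_if_deterministic:
  assumes v: "v \<noteq> []"
  shows "\<exists>\<alpha>. has_frequency v \<alpha>"
proof -
  define l where "l = length v"
  have l: "length v = l" "l \<ge> 1" using v by (auto simp: l_def Suc_le_eq)
  obtain \<alpha> where \<alpha>: "\<And>\<epsilon>. \<epsilon> > 0 \<Longrightarrow> \<exists>k. \<forall>w\<in>legal_words \<theta> l.
    \<bar>real (count_list (induced_word l (map (g k) w)) v) - \<alpha> * real (length (g k (hd w)))\<bar> \<le> \<epsilon> * real (length (g k (hd w)))"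
    using frequencies_converge[OF l] by blast
  have "\<exists>n\<ge>1. \<forall>x\<in>X. \<bar>visits x v n - real n * \<alpha>\<bar> \<le> real n * \<epsilon>" if \<epsilon>: "\<epsilon> > 0" for \<epsilon>
  proof -
    obtain k where k: "\<And>w. w \<in> legal_words \<theta> l \<Longrightarrow>
      \<bar>real (count_list (induced_word l (map (g k) w)) v) - \<alpha> * real (length (g k (hd w)))\<bar> \<le> \<epsilon> / 2 * real (length (g k (hd w)))"
      using \<alpha>[of "\<epsilon> / 2"] \<epsilon> by auto
    define B where "B = Max (range (\<lambda>a. length (g k a)))"
    have B: "length (g k a) \<le> B" for a unfolding B_def by (intro Max_ge) auto
    \<comment> \<open>Pays for the tail of fewer than \<open>l\<close> letters, from which no word
      of length \<open>l\<close> can be taken: at most \<open>l * B\<close> image letters, each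
      contributing at most \<open>1 + \<bar>\<alpha>\<bar>\<close>.\<close>
    define C where "C = (1 + \<bar>\<alpha>\<bar>) * real (l * B)"
    let ?Y = "\<lambda>y. concat (map (g k) y)"
    have C0: "C \<ge> 0" by (simp add: C_def)
    have whole: "\<bar>hits v (?Y y) - \<alpha> * real (length (?Y y))\<bar> \<le> \<epsilon> / 2 * real (length (?Y y)) + C"
      if "y = [] \<or> legal \<theta> y" for y
      using that
    proof (induction y)
      case Nil
      then show ?case using C0 by (simp add: hits_def)
    next
      case (Cons a y)
      show ?case
      proof (cases "length (a # y) \<ge> l")
        case False
        have "length (?Y u) \<le> length u * B" for u
          by (induction u) (use B in \<open>auto intro: add_mono\<close>)
        then have "length (?Y (a # y)) \<le> length (a # y) * B" .
        also have "\<dots> \<le> l * B" using False by (intro mult_right_mono) auto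
        finally have len: "real (length (?Y (a # y))) \<le> real (l * B)" by (simp only: of_nat_le_iff)
        have "\<bar>hits v (?Y (a # y)) - \<alpha> * real (length (?Y (a # y)))\<bar> \<le>
            \<bar>hits v (?Y (a # y))\<bar> + \<bar>\<alpha> * real (length (?Y (a # y)))\<bar>" by (rule abs_triangle_ineq4)
        also have "\<dots> \<le> (1 + \<bar>\<alpha>\<bar>) * real (length (?Y (a # y)))"
          using hits_nonneg[of v "?Y (a # y)"] hits_le_length[of v "?Y (a # y)"] by (simp add: abs_mult distrib_right)
        also have "\<dots> \<le> C" unfolding C_def using len by (intro mult_left_mono) auto
        finally show ?thesis using \<epsilon> by (simp add: add_increasing)
      next
        case True
        define w where "w = take l (a # y)"
        have "length w = l" using True by (simp add: w_def)
        moreover obtain l' where "l = Suc l'" using l(2) by (cases l) auto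
        then have hd: "hd w = a" "w \<noteq> []" by (auto simp: w_def)
        moreover have "legal \<theta> w"
          by (rule legal_sublist[of "a # y"]) (use Cons.prems hd in \<open>auto simp: w_def\<close>)
        ultimately have w: "w \<in> legal_words \<theta> l" "hd w = a" by (simp_all add: legal_words_def)
        have "induced_word l (map (g k) w) = induced_word l (map (g k) w @ map (g k) (drop l (a # y)))"
          using induced_word_append[of "map (g k) w" l "map (g k) (drop l (a # y))"] l(2) g_ne True by (auto simp: w_def)
        also have "map (g k) w @ map (g k) (drop l (a # y)) = map (g k) (a # y)"
          unfolding w_def by (simp flip: map_append del: list.map)
        finally have iw: "induced_word l (map (g k) w) = map (\<lambda>r. take l (drop r (?Y (a # y)))) [0..<length (g k a)]"
          by (simp add: induced_word_def)
        have "real (count_list (map F [0..<N]) v) = (\<Sum>r<N. if F r = v then 1 else 0)" for F N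
          by (induction N) auto
        then have cnt: "hits v (?Y (a # y)) = real (count_list (induced_word l (map (g k) w)) v) + hits v (?Y y)"
          unfolding iw using hits_append[of v "g k a" "?Y y"] l(1) by simp
        have "y = [] \<or> legal \<theta> y" using Cons.prems legal_sublist[of "a # y" y] by (auto simp: sublist_Cons_right)
        then have IH: "\<bar>hits v (?Y y) - \<alpha> * real (length (?Y y))\<bar> \<le> \<epsilon> / 2 * real (length (?Y y)) + C" by (rule Cons.IH)
        have len: "real (length (?Y (a # y))) = real (length (g k a)) + real (length (?Y y))" by simp
        show ?thesis using IH k[OF w(1)] unfolding cnt len w(2) distrib_left by linarith
      qed
    qed
    \<comment> \<open>Beyond \<open>C\<close>, this covers the overhang \<open>N \<le> 2 * B\<close>
      at the two ends (in hits, in length times \<open>\<alpha>\<close>, and in the relative error)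
      and twice \<open>l\<close> for windows across a boundary.\<close>
    define D where "D = C + (\<epsilon> + 2 * \<bar>\<alpha>\<bar> + 2) * real B + 2 * real l"
    have near: "\<bar>visits x v n - real n * \<alpha>\<bar> \<le> \<epsilon> / 2 * real n + D" if x: "x \<in> X" and n: "n \<ge> 1" for x n
    proof -
      define u where "u = window x 0 n"
      have u: "length u = n" "legal \<theta> u" using x n by (auto simp: u_def rs_subshift_def)
      obtain K where K: "\<And>k b. k \<ge> K \<Longrightarrow> sublist u (g k b)" using occurs_eventually[OF u(2)] by blast
      \<comment> \<open>Splitting off the last \<open>k\<close> inflations exhibits \<open>u\<close>
        inside a concatenation of blocks of level \<open>k\<close>; the letter
        \<open>undefined\<close> is arbitrary.\<close>
      have "sublist u (?Y (g K undefined))" using K[of "K + k" undefined] by (simp add: iter_subst_add)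
      then obtain p0 t0 where "?Y (g K undefined) = p0 @ u @ t0" by (auto simp: sublist_def)
      from concat_map_covers[where g = "g k", OF B this] obtain y p s where
        y: "sublist y (g K undefined)" "?Y y = p @ u @ s" "length p \<le> B" "length s \<le> B" by blast
      have "legal \<theta> (g K undefined)" using legal_inflation[OF legal_letter[of undefined], of K] by simp
      then have "y = [] \<or> legal \<theta> y" using legal_sublist y(1) by blast
      from whole[OF this] have W: "\<bar>hits v (p @ u @ s) - \<alpha> * real (length (p @ u @ s))\<bar> \<le> \<epsilon> / 2 * real (length (p @ u @ s)) + C"
        unfolding y(2) .
      define N where "N = real (length p) + real (length s)"
      have N: "0 \<le> N" "N \<le> 2 * real B" using y(3,4) by (auto simp: N_def)
      have len: "real (length (p @ u @ s)) = real n + N" by (simp add: u N_def)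
      have h: "\<bar>hits v u - hits v (p @ u @ s)\<bar> \<le> N + real l"
        using hits_factor[where v = v and u = u and p = p and s = s] by (simp add: N_def l(1))
      have vh: "\<bar>visits x v n - hits v u\<bar> \<le> real l" using visits_near_hits[of x v n] by (simp add: u_def l(1))
      have aN: "\<bar>\<alpha> * N\<bar> \<le> 2 * \<bar>\<alpha>\<bar> * real B"
        using mult_left_mono[OF N(2), of "\<bar>\<alpha>\<bar>"] N(1) by (simp add: abs_mult)
      have eN: "\<epsilon> / 2 * N \<le> \<epsilon> * real B" using mult_left_mono[OF N(2), of "\<epsilon> / 2"] \<epsilon> by simp
      have "visits x v n - real n * \<alpha> = (visits x v n - hits v u) + (hits v u - hits v (p @ u @ s)) +
          (hits v (p @ u @ s) - \<alpha> * (real n + N)) + \<alpha> * N" by (simp add: algebra_simps)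
      then have "\<bar>visits x v n - real n * \<alpha>\<bar> \<le> real l + (N + real l) + (\<epsilon> / 2 * (real n + N) + C) + 2 * \<bar>\<alpha>\<bar> * real B"
        using vh h W[unfolded len] aN by linarith
      also have "\<dots> \<le> \<epsilon> / 2 * real n + D" using N(2) eN unfolding D_def distrib_left distrib_right by linarith
      finally show ?thesis .
    qed
    \<comment> \<open>Half of \<open>\<epsilon>\<close> is spent on the blocks; a length of at least
      \<open>2 * D / \<epsilon>\<close> absorbs the constant error in the other half.\<close>
    obtain n0 :: nat where n0: "2 * D / \<epsilon> \<le> real n0" using real_arch_simple by blast
    define n where "n = Suc n0"
    have "2 * D / \<epsilon> \<le> real n" using n0 by (simp add: n_def)
    then have "D \<le> \<epsilon> / 2 * real n" using \<epsilon> by (simp add: field_simps)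
    then have "\<bar>visits x v n - real n * \<alpha>\<bar> \<le> real n * \<epsilon>" if "x \<in> X" for x
    proof -
      have "real n * \<epsilon> = \<epsilon> / 2 * real n + \<epsilon> / 2 * real n" by simp
      moreover have "1 \<le> n" by (simp add: n_def)
      ultimately show ?thesis using near[OF that, of n] \<open>D \<le> \<epsilon> / 2 * real n\<close> by linarith
    qed
    then show ?thesis by (intro exI[of _ n]) (simp add: n_def)
  qed
  then show ?thesis unfolding has_frequency_def by blast
qed

end

theorem independent_imp_uniquely_ergodic:
  assumes "random_rs \<theta> P" "eigenvectors_independent_of_probabilities \<theta>"
  shows "uniquely_ergodic (rs_topology \<theta>) left_shift"
proof -
  interpret random_rs \<theta> P by fact
  have unif: "\<exists>\<alpha>. has_frequency v \<alpha>" if v: "v \<noteq> []" for v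
    using deterministic_or_periodic[OF assms(2)]
  proof
    assume "\<forall>a. \<exists>w. \<theta> a = {w}"
    then obtain f where "\<And>a. \<theta> a = {f a}" by metis
    then interpret deterministic_rs \<theta> f by unfold_locales
    show ?thesis by (rule uniform_if_deterministic[OF v])
  next
    assume "\<exists>d>0. \<forall>u. legal \<theta> u \<longrightarrow> (\<forall>i. i + d < length u \<longrightarrow> u ! i = u ! (i + d))"
    then show ?thesis using uniform_if_periodic by blast
  qed
  obtain M where "invariant_prob T left_shift M" using freq_measure_exists by blast
  then show ?thesis unfolding uniquely_ergodic_def using unique_invariant_measure[OF unif] by blast
qed

theorem theorem26:
  fixes \<theta> :: "'a::finite \<Rightarrow> 'a list set"
    and P :: "'a \<Rightarrow> 'a list pmf"
  assumes "random_substitution \<theta> P"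
    and "nondegenerate \<theta> P"
    and "primitive_substitution \<theta>"
    and "rs_subshift \<theta> \<noteq> {}"
  shows "(uniquely_ergodic (rs_topology \<theta>) left_shift \<longrightarrow>
            eigenvectors_independent_of_probabilities \<theta>) \<and>
         (ergodic left_shift (rs_measure \<theta> P) \<longrightarrow>
            (uniquely_ergodic (rs_topology \<theta>) left_shift \<longleftrightarrow>
               eigenvectors_independent_of_probabilities \<theta>))"
proof -
  interpret random_rs \<theta> P
    using assms by unfold_locales
      (auto simp: random_substitution_def nondegenerate_def set_pmf_iff)
  show ?thesis
    using uniquely_ergodic_imp_independent[OF primitive_rs_axioms]
      independent_imp_uniquely_ergodic[OF random_rs_axioms] by blast
qed

end
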